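(* Let $p$ be a power of $2$, let $q$ be a power of $p$, let $R(x)=\sum_{i=0}^e a_ix^{p^i}\in\mathbb{F}_q[x]$ with $e\ge1$, $a_e\ne0$, and let $A\subset H_R$ be a maximal abelian subgroup with $A\subset\mathbb{F}_q^2$. Let $\psi$ be a nontrivial character of $\mathbb{F}_p$, let $\xi\in A_\psi^\vee$, and let $t\in\mathbb{F}_q$. Write $F_A(x)=\sum_{i=0}^eb_ix^{p^i}$ for the polynomial $F_A$ of the context, and put $F^*(t)=\sum_{i=0}^e(b_it)^{p^{-i}}$ and $R_t(x)=R(x)+F^*(t)^2x$. With $A_t$, $\xi_t$, $c_{R,\xi}$ and the Frobenius eigenvalues $\tau$ as in the context, one has $$\tau_{R_t,\xi_t,q}=\xi_q(t,\,t^2+c_{R,\xi}t)\cdot\tau_{R,\xi,q}.$$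
   Context: Basics. $\mathbb{F}$ is an algebraic closure of $\mathbb{F}_q$; finite fields are viewed inside $\mathbb{F}$; $\ell$ is an odd prime; for $u\in\mathbb{F}$, $u^{1/2}$ and $u^{p^{-i}}$ denote the unique roots. $G^\vee=\mathrm{Hom}(G,\overline{\mathbb{Q}}_\ell^\times)$ for a finite abelian group $G$. $\mathscr{A}$ is the set of $\mathbb{F}_p$-linearized polynomials $\sum_i c_ix^{p^i}\in\mathbb{F}_q[x]$; $\mathrm{Ker}\,g=\{x\in\mathbb{F}: g(x)=0\}$ for $g\in\mathscr{A}$. For $R\in\mathscr{A}$ of degree $p^e$, $e\ge1$, $C_R$ is the affine curve $y^p-y=xR(x)$ over $\mathbb{F}_q$. Heisenberg group. For $R=\sum_{i=0}^ea_ix^{p^i}$ put $E_R(x)=R(x)^{p^e}+\sum_{i=0}^e(a_ix)^{p^{e-i}}$, $f_R(x,y)=-\sum_{i=0}^{e-1}\bigl(\sum_{j=0}^{e-i-1}(a_ix^{p^i}y)^{p^j}+(xR(y))^{p^i}\bigr)$ and $V_R=\mathrm{Ker}\,E_R$ (an $\mathbb{F}_p$-space of dimension $2e$). $H_R=\{(a,b)\in V_R\times\mathbb{F}: b^p-b=aR(a)\}$ is a group under $(a,b)\cdot(a',b')=(a+a',b+b'+f_R(a,a'))$, with center $\{0\}\times\mathbb{F}_p\simeq\mathbb{F}_p$. It acts on $C_{R,\mathbb{F}}$ on the right by $(x,y)\cdot(a,b)=(x+a,y+b+f_R(x,a))$. Let $\pi:H_R\to V_R$, $(a,b)\mapsto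 a$. Choices attached to $A$. $\overline{A}=\pi(A)\subset\mathbb{F}_q$ is an $e$-dimensional $\mathbb{F}_p$-subspace and $A=\pi^{-1}(\overline{A})$. Put $\overline{U}=\{a\in\overline{A}: f_R(a,a)=0\}$, an $\mathbb{F}_p$-subspace of dimension $e-1$. Fix (such data exist) a separable $f_{\overline{U}}\in\mathscr{A}$, $s_0\in\mathbb{F}_q$ with $S(x)=x^p+s_0x$, and $\Delta\in\mathbb{F}_q[x]$ with $\Delta(0)=0$, such that $\overline{U}=\mathrm{Ker}\,f_{\overline{U}}$, $\overline{A}=\mathrm{Ker}(f_{\overline{U}}^p+f_{\overline{U}})$ and $\Delta(x)^p+\Delta(x)=xR(x)+f_{\overline{U}}(x)S(f_{\overline{U}}(x))$. Put $F_A=f_{\overline{U}}^p+f_{\overline{U}}$. Fix $\alpha\in\mathbb{F}_q$ with $\alpha^{p^{-1}}+\alpha=s_0+1$ (it exists), and an $\mathbb{F}_p$-linear map $r:\overline{A}\to\overline{U}$ restricting to the identity on $\overline{U}$. Witt vectors. $W_2$ is the ring scheme of length-$2$ Witt vectors over $\mathbb{F}_2$: $(a,b)+(c,d)=(a+c,b+d+ac)$, $(a,b)\cdot(c,d)=(ac,bc^2+a^2d)$. $\mathrm{Tr}_{2^m/2^n}:W_2(\mathbb{F}_{2^m})\to W_2(\mathbb{F}_{2^n})$ is $(a,b)\mapsto\sum_{i=0}^{m/n-1}(a^{2^{in}},b^{2^{in}})$ (sum in $W_2$). Fix a faithful character $\xi_2$ of $W_2(\mathbb{F}_2)\simeq\mathbb{Z}/4\mathbb{Z}$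 and put $\xi_{2^n}:=\xi_2\circ\mathrm{Tr}_{2^n/2}$. Characters. The map $\varphi:A\to W_2(\mathbb{F}_p)\times\overline{U}$, $(a,b)\mapsto\bigl((f_{\overline{U}}(a),\,b+\Delta(a)+\alpha^{p^{-1}}f_{\overline{U}}(a)^2),\,r(a)\bigr)$, is an isomorphism of groups. $A_\psi^\vee$ is the set of $\xi\in A^\vee$ with $\xi(0,c)=\psi(c)$ for $c\in\mathbb{F}_p$. Write $\xi=(\xi_{W_2}\boxtimes\xi_{\overline{U}})\circ\varphi$. There is a unique $(a_{W_2},b_{W_2})\in W_2(\mathbb{F}_p)^\times$ with $\xi_{W_2}(x,y)=\xi_p((a_{W_2},b_{W_2})\cdot(x,y))$ for all $(x,y)\in W_2(\mathbb{F}_p)$. There is a unique $a(x)\in\mathscr{A}$ with $x^q+x=a(F_A(x))=F_A(a(x))$; it induces a surjection $\mathbb{F}_q\to\overline{A}$. $\beta_\xi\in\mathbb{F}_q$ is the unique element with $\xi_{\overline{U}}(r(a(x)))=\psi(\mathrm{Tr}_{\mathbb{F}_q/\mathbb{F}_p}(\beta_\xi x))$ for all $x\in\mathbb{F}_q$. Put $c_{R,\xi}=(\alpha+b_{W_2}/a_{W_2}^2)^{1/2}+a_{W_2}\beta_\xi\in\mathbb{F}_q$. The twist. One has $V_{R_t}=V_R$ and $f_{R_t}=f_R$. Let $\pi_t:H_{R_t}\to V_R$, $(a,b)\mapsto a$, and $A_t=\pi_t^{-1}(\overline{A})$; this is a maximal abelian subgroup of $H_{R_t}$ contained in $\mathbb{F}_q^2$.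 Let $S_t(x)=S(x)+(t^{p^{-1}}+t)^2x$ and let $\Delta_t\in\mathbb{F}_q[x]$ be the unique polynomial with $\Delta_t(0)=0$ and $\Delta_t^p+\Delta_t=xR_t(x)+f_{\overline{U}}(x)S_t(f_{\overline{U}}(x))$. Then $\varphi_t:A_t\to W_2(\mathbb{F}_p)\times\overline{U}$, $(a,b)\mapsto\bigl((f_{\overline{U}}(a),\,b+\Delta_t(a)+(t^2+\alpha)^{p^{-1}}f_{\overline{U}}(a)^2),\,r(a)\bigr)$, is an isomorphism, and $\xi_t:=(\xi_{W_2}\boxtimes\xi_{\overline{U}})\circ\varphi_t\in A_t^\vee$. Frobenius eigenvalues. For $(R',A',\xi')=(R,A,\xi)$ or $(R_t,A_t,\xi_t)$, the map $C_{R'}\to\mathbb{A}^1_{\mathbb{F}_q}$, $(x,y)\mapsto F_A(x)$, is a finite étale Galois covering with group $A'$. $\mathcal{Q}_{\xi'}$ is the rank-one smooth $\overline{\mathbb{Q}}_\ell$-sheaf associated with it and $\xi'$ (Deligne's convention: if $s\in\mathbb{A}^1(\mathbb{F}_{q^m})$, $P\in C_{R'}(\mathbb{F})$ lies over $s$ and the $q^m$-power Frobenius sends $P$ to $P\cdot g$, $g\in A'$, then the geometric Frobenius at $s$ acts on the stalk by $\xi'(g)$). $H^1_{\rm c}(\mathbb{A}^1_{\mathbb{F}},\mathcal{Q}_{\xi'})$ is one-dimensional, and $\tau_{R',\xi',q}$ is the eigenvalue of the geometric Frobenius $\mathrm{Fr}_q$ on it. *)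

theory Defs
  imports "HOL-Analysis.Analysis" "HOL-Algebra.Algebraic_Closure_Type"
begin

section \<open>Finite fields, linearized polynomials, characters\<close>

text \<open>
  All finite fields of characteristic 2 are viewed inside one algebraic closure of the prime
  field, which is a type.
\<close>

definition is_closure_of_F2 :: "'f::alg_closed_field itself \<Rightarrow> bool" where
  "is_closure_of_F2 _ \<longleftrightarrow> CHAR('f) = 2 \<and> (\<forall>x::'f. \<exists>n>0. x ^ (2 ^ n) = x)"

definition Fin :: "nat \<Rightarrow> 'f::field set" where
  "Fin q = {x. x ^ q = x}"

text \<open>Only used for \<open>k\<close> a power of 2, where the root is unique.\<close>

definition rad :: "nat \<Rightarrow> 'f::field \<Rightarrow> 'f" where
  "rad k u = (THE v. v ^ k = u)"

definition poly_over :: "'f::field set \<Rightarrow> 'f poly \<Rightarrow> bool" where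
  "poly_over K g \<longleftrightarrow> (\<forall>k. Polynomial.coeff g k \<in> K)"

definition linearized :: "nat \<Rightarrow> nat \<Rightarrow> 'f::field poly \<Rightarrow> bool" where
  "linearized p q g \<longleftrightarrow> poly_over (Fin q) g \<and>
     (\<forall>k. Polynomial.coeff g k \<noteq> 0 \<longrightarrow> (\<exists>i. k = p ^ i))"

definition Ker :: "'f::field poly \<Rightarrow> 'f set" where
  "Ker g = {x. poly g x = 0}"

definition separable_poly :: "'f::field poly \<Rightarrow> bool" where
  "separable_poly g \<longleftrightarrow> coprime g (pderiv g)"

definition field_trace :: "nat \<Rightarrow> nat \<Rightarrow> 'f::field \<Rightarrow> 'f" where
  "field_trace p m x = (\<Sum>i<m. x ^ (p ^ i))"

definition additive_group :: "'a::comm_monoid_add set \<Rightarrow> 'a monoid" where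
  "additive_group S = \<lparr>carrier = S, mult = (+), one = 0\<rparr>"

definition dual :: "('g, 'm) monoid_scheme \<Rightarrow> ('g \<Rightarrow> 'l::field) set" where
  "dual G = {\<theta>. (\<forall>x\<in>carrier G. \<theta> x \<noteq> 0) \<and>
     (\<forall>x\<in>carrier G. \<forall>y\<in>carrier G. \<theta> (x \<otimes>\<^bsub>G\<^esub> y) = \<theta> x * \<theta> y)}"

definition abelian_subgroup :: "'g set \<Rightarrow> ('g, 'm) monoid_scheme \<Rightarrow> bool" where
  "abelian_subgroup A G \<longleftrightarrow> subgroup A G \<and> (\<forall>x\<in>A. \<forall>y\<in>A. x \<otimes>\<^bsub>G\<^esub> y = y \<otimes>\<^bsub>G\<^esub> x)"

definition maximal_abelian_subgroup :: "'g set \<Rightarrow> ('g, 'm) monoid_scheme \<Rightarrow> bool" where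
  "maximal_abelian_subgroup A G \<longleftrightarrow> abelian_subgroup A G \<and>
     (\<forall>B. abelian_subgroup B G \<and> A \<subseteq> B \<longrightarrow> B = A)"


section \<open>Witt vectors of length 2\<close>

definition W2 :: "'f::field set \<Rightarrow> ('f \<times> 'f) ring" where
  "W2 K = \<lparr>carrier = K \<times> K,
     mult = (\<lambda>(a, b) (c, d). (a * c, b * c ^ 2 + a ^ 2 * d)), one = (1, 0),
     zero = (0, 0), add = (\<lambda>(a, b) (c, d). (a + c, b + d + a * c))\<rparr>"

text \<open>The trace from Witt vectors over the field of order \<open>2^m\<close> to those over the field of
  order \<open>2^n\<close>.\<close>

definition W2_trace :: "nat \<Rightarrow> nat \<Rightarrow> 'f::field \<times> 'f \<Rightarrow> 'f \<times> 'f" where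
  "W2_trace m n u =
     finsum (W2 UNIV) (\<lambda>i. (fst u ^ (2 ^ (i * n)), snd u ^ (2 ^ (i * n)))) {..<m div n}"

definition W2_char :: "('f::field \<times> 'f \<Rightarrow> 'l) \<Rightarrow> nat \<Rightarrow> 'f \<times> 'f \<Rightarrow> 'l" where
  "W2_char \<xi>2 m = \<xi>2 \<circ> W2_trace m 1"


section \<open>The Heisenberg group\<close>

text \<open>
  \<open>R\<close> is the polynomial \<open>\<Sum>i\<le>e. a\<^sub>i x^(p^i)\<close>, so \<open>a\<^sub>i\<close> is its coefficient at \<open>p^i\<close>.
  The function \<open>heis_f\<close> is evaluated both at points of the finite fields and at points of
  extensions of the function field.
\<close>

definition heis_f :: "nat \<Rightarrow> nat \<Rightarrow> 'a::field poly \<Rightarrow> 'a \<Rightarrow> 'a \<Rightarrow> 'a" where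
  "heis_f p e R x y =
     - (\<Sum>i<e. (\<Sum>j\<le>e - i - 1. (Polynomial.coeff R (p ^ i) * x ^ (p ^ i) * y) ^ (p ^ j))
               + (x * poly R y) ^ (p ^ i))"

definition heis_V :: "nat \<Rightarrow> nat \<Rightarrow> 'f::field poly \<Rightarrow> 'f set" where
  "heis_V p e R = {x. poly R x ^ (p ^ e)
     + (\<Sum>i\<le>e. (Polynomial.coeff R (p ^ i) * x) ^ (p ^ (e - i))) = 0}"

definition heis :: "nat \<Rightarrow> nat \<Rightarrow> 'f::field poly \<Rightarrow> ('f \<times> 'f) monoid" where
  "heis p e R = \<lparr>carrier = {(a, b). a \<in> heis_V p e R \<and> b ^ p - b = a * poly R a},
     mult = (\<lambda>(a, b) (a', b'). (a + a', b + b' + heis_f p e R a a')), one = (0, 0)\<rparr>"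

definition phi ::
    "nat \<Rightarrow> 'f::field poly \<Rightarrow> 'f poly \<Rightarrow> 'f \<Rightarrow> ('f \<Rightarrow> 'f) \<Rightarrow> 'f \<times> 'f \<Rightarrow> ('f \<times> 'f) \<times> 'f" where
  "phi p f \<Delta> \<alpha> r = (\<lambda>(a, b). ((poly f a, b + poly \<Delta> a + rad p \<alpha> * poly f a ^ 2), r a))"

definition box_char :: "('a \<Rightarrow> 'l::field) \<Rightarrow> ('b \<Rightarrow> 'l) \<Rightarrow> 'a \<times> 'b \<Rightarrow> 'l" where
  "box_char \<theta> \<theta>' = (\<lambda>(u, v). \<theta> u * \<theta>' v)"

definition F_star :: "nat \<Rightarrow> nat \<Rightarrow> 'f::field poly \<Rightarrow> 'f \<Rightarrow> 'f" where
  "F_star p e F t = (\<Sum>i\<le>e. rad (p ^ i) (Polynomial.coeff F (p ^ i) * t))"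


section \<open>Coefficients: an algebraic closure of the field of \<open>l\<close>-adic numbers\<close>

text \<open>
  The absolute value is \<open>\<bar>x\<bar> = dist x 0\<close>. It is normalized at \<open>l\<close>, the closure of the rationals
  is complete, hence is the field of \<open>l\<close>-adic numbers, and the whole field is algebraic over it.
\<close>

definition Ql :: "'l::{field_char_0, metric_space} set" where
  "Ql = closure \<rat>"

definition is_closure_of_Ql ::
    "nat \<Rightarrow> 'l::{field_char_0, alg_closed_field, metric_space} itself \<Rightarrow> bool" where
  "is_closure_of_Ql l _ \<longleftrightarrow>
     (\<forall>x y z::'l. dist (x + z) (y + z) = dist x y) \<and>
     (\<forall>x y::'l. dist (x * y) 0 = dist x 0 * dist y 0) \<and>
     (\<forall>x y z::'l. dist x z \<le> max (dist x y) (dist y z)) \<and>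
     dist (of_nat l) (0::'l) = 1 / real l \<and>
     complete (Ql :: 'l set) \<and>
     (\<forall>x::'l. \<exists>P. P \<noteq> 0 \<and> poly_over Ql P \<and> poly P x = 0)"


section \<open>Galois theory of the function field of the affine line\<close>

text \<open>
  \<open>'f ffc\<close> is an algebraic closure of the rational function field \<open>'f(s)\<close>; the constants
  \<open>'f\<close> embed by \<open>cst\<close>, and \<open>coord\<close> is the coordinate \<open>s\<close> of the affine line. Automorphism
  groups of \<open>'f ffc\<close> agree with those of the separable closure.
\<close>

type_synonym 'f ffc = "'f poly fract alg_closure"

definition cst :: "'f::field \<Rightarrow> 'f ffc" where
  "cst z = to_ac (Fraction_Field.Fract [:z:] 1)"

definition coord :: "'f::field ffc" where
  "coord = to_ac (Fraction_Field.Fract [:0, 1:] 1)"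

definition field_auts :: "('k::field \<Rightarrow> 'k) set" where
  "field_auts = {\<sigma>. bij \<sigma> \<and> (\<forall>x y. \<sigma> (x + y) = \<sigma> x + \<sigma> y) \<and> (\<forall>x y. \<sigma> (x * y) = \<sigma> x * \<sigma> y)}"

definition geom_gal :: "('f::field ffc \<Rightarrow> 'f ffc) set" where
  "geom_gal = {\<sigma> \<in> field_auts. \<sigma> coord = coord \<and> (\<forall>z. \<sigma> (cst z) = cst z)}"

text \<open>The lifts of the arithmetic Frobenius of the field of order \<open>q\<close> to elements of the
  arithmetic Galois group.\<close>

definition arith_frob_lifts :: "nat \<Rightarrow> ('f::field ffc \<Rightarrow> 'f ffc) set" where
  "arith_frob_lifts q = {\<sigma> \<in> field_auts. \<sigma> coord = coord \<and> (\<forall>z. \<sigma> (cst z) = cst (z ^ q))}"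

text \<open>The Krull topology is the topology of pointwise convergence for discrete \<open>'f ffc\<close>.\<close>

definition krull_top :: "('f::field ffc \<Rightarrow> 'f ffc) topology" where
  "krull_top = subtopology (product_topology (\<lambda>_. discrete_topology UNIV) UNIV) geom_gal"

text \<open>
  A place is given by its valuation ring \<open>W\<close>. It lies over a point of the affine line iff \<open>W\<close>
  contains the coordinate, and over infinity otherwise.
\<close>

definition places :: "'f::field ffc set set" where
  "places = {W. range cst \<subseteq> W \<and> (\<forall>x\<in>W. \<forall>y\<in>W. x - y \<in> W \<and> x * y \<in> W) \<and>
     (\<forall>x. x \<in> W \<or> inverse x \<in> W) \<and> W \<noteq> UNIV}"

definition finite_places :: "'f::field ffc set set" where
  "finite_places = {W \<in> places. coord \<in> W}"

definition infinite_places :: "'f::field ffc set set" where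
  "infinite_places = {W \<in> places. coord \<notin> W}"

definition max_ideal :: "'k::field set \<Rightarrow> 'k set" where
  "max_ideal W = {x \<in> W. x = 0 \<or> inverse x \<notin> W}"

definition inertia :: "'f::field ffc set \<Rightarrow> ('f ffc \<Rightarrow> 'f ffc) set" where
  "inertia W = {\<sigma> \<in> geom_gal. \<sigma> ` W = W \<and> (\<forall>x\<in>W. \<sigma> x - x \<in> max_ideal W)}"


section \<open>First cohomology with compact support of a rank-one sheaf on the affine line\<close>

text \<open>
  Let \<open>\<rho>\<close> be the character of the arithmetic Galois group attached to a smooth rank-one sheaf
  \<open>Q\<close> on the affine line, with \<open>j\<close> the inclusion into the projective line. Then
  \<open>H\<^sup>1\<^sub>c(Q) = H\<^sup>1(j\<^sub>! Q)\<close> classifies torsors under \<open>j\<^sub>! Q\<close>, that is, pairs of a \<open>Q\<close>-torsor on the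
  affine line and a section of it over the punctured (strictly henselian) neighbourhood of
  infinity. In terms of Galois theory such a pair is a pair \<open>(c, m)\<close>:
  \<^item> \<open>c\<close> is a continuous 1-cocycle of the geometric Galois group with values in \<open>\<rho>\<close>, trivial on
    all inertia groups over the affine line, i.e. a cocycle of the fundamental group; it takes
    its values in some finite-dimensional \<open>Ql\<close>-subspace (the coefficient field is the colimit
    of the finite extensions of \<open>Ql\<close>). It defines the torsor with Galois action
    \<open>x \<mapsto> c \<sigma> + \<rho> \<sigma> * x\<close>.
  \<^item> \<open>m\<close> is a Galois-equivariant map from the places over infinity to this torsor, i.e. after
    fixing one place a point of the torsor fixed by the decomposition group of that place.
  So this is the mapping fibre of the restriction from the cochains of the fundamental group to
  those of the inertia group at infinity, without the choice of a place over infinity.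
  Functions are only relevant on \<open>geom_gal\<close> and \<open>infinite_places\<close>; what they do elsewhere is
  divided out with the coboundaries.
\<close>

type_synonym ('f, 'l) cochain = "(('f ffc \<Rightarrow> 'f ffc) \<Rightarrow> 'l) \<times> ('f ffc set \<Rightarrow> 'l)"

definition H1c_cocycles ::
    "(('f::field ffc \<Rightarrow> 'f ffc) \<Rightarrow> 'l::{field_char_0, metric_space}) \<Rightarrow> ('f, 'l) cochain set" where
  "H1c_cocycles \<rho> = {(c, m).
     continuous_map krull_top euclidean c \<and>
     (\<exists>B. finite B \<and> (\<forall>\<sigma>\<in>geom_gal. \<exists>k. (\<forall>b\<in>B. k b \<in> Ql) \<and> c \<sigma> = (\<Sum>b\<in>B. k b * b))) \<and>
     (\<forall>\<sigma>\<in>geom_gal. \<forall>\<tau>\<in>geom_gal. c (\<sigma> \<circ> \<tau>) = c \<sigma> + \<rho> \<sigma> * c \<tau>) \<and>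
     (\<forall>W\<in>finite_places. \<forall>\<sigma>\<in>inertia W. c \<sigma> = 0) \<and>
     (\<forall>W\<in>infinite_places. \<forall>\<sigma>\<in>geom_gal. m (\<sigma> ` W) = c \<sigma> + \<rho> \<sigma> * m W)}"

definition H1c_coboundaries ::
    "(('f::field ffc \<Rightarrow> 'f ffc) \<Rightarrow> 'l::field) \<Rightarrow> ('f, 'l) cochain set" where
  "H1c_coboundaries \<rho> = {(c, m). \<exists>n.
     (\<forall>\<sigma>\<in>geom_gal. c \<sigma> = n - \<rho> \<sigma> * n) \<and> (\<forall>W\<in>infinite_places. m W = n)}"

definition cochain_diff_scaled ::
    "('f::field, 'l::field) cochain \<Rightarrow> 'l \<Rightarrow> ('f, 'l) cochain \<Rightarrow> ('f, 'l) cochain" where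
  "cochain_diff_scaled z k z' =
     ((\<lambda>\<sigma>. fst z \<sigma> - k * fst z' \<sigma>), (\<lambda>W. snd z W - k * snd z' W))"

definition H1c_one_dimensional ::
    "(('f::field ffc \<Rightarrow> 'f ffc) \<Rightarrow> 'l::{field_char_0, metric_space}) \<Rightarrow> bool" where
  "H1c_one_dimensional \<rho> \<longleftrightarrow>
     (\<exists>z \<in> H1c_cocycles \<rho> - H1c_coboundaries \<rho>.
        \<forall>z' \<in> H1c_cocycles \<rho>. \<exists>k. cochain_diff_scaled z' k z \<in> H1c_coboundaries \<rho>)"

text \<open>
  An element \<open>g\<close> of the arithmetic Galois group acts on cochains by
  \<open>(g c) \<sigma> = \<rho> g * c (g\<inverse> \<sigma> g)\<close> and \<open>(g m) W = \<rho> g * m (g\<inverse> W)\<close>. The geometric Frobenius acts as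
  \<open>g = \<phi>\<inverse>\<close> for any lift \<open>\<phi>\<close> of the arithmetic Frobenius; on cohomology classes the action does
  not depend on the lift.
\<close>

definition geom_frob ::
    "(('f::field ffc \<Rightarrow> 'f ffc) \<Rightarrow> 'l::field) \<Rightarrow> ('f ffc \<Rightarrow> 'f ffc) \<Rightarrow> ('f, 'l) cochain \<Rightarrow> ('f, 'l) cochain"
  where
  "geom_frob \<rho> \<phi> z = ((\<lambda>\<sigma>. inverse (\<rho> \<phi>) * fst z (\<phi> \<circ> \<sigma> \<circ> inv_into UNIV \<phi>)),
                      (\<lambda>W. inverse (\<rho> \<phi>) * snd z (\<phi> ` W)))"

definition is_frob_eigenvalue ::
    "nat \<Rightarrow> (('f::field ffc \<Rightarrow> 'f ffc) \<Rightarrow> 'l::{field_char_0, metric_space}) \<Rightarrow> 'l \<Rightarrow> bool" where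
  "is_frob_eigenvalue q \<rho> \<mu> \<longleftrightarrow>
     (\<forall>\<phi> \<in> arith_frob_lifts q. \<exists>z \<in> H1c_cocycles \<rho> - H1c_coboundaries \<rho>.
        cochain_diff_scaled (geom_frob \<rho> \<phi> z) \<mu> z \<in> H1c_coboundaries \<rho>)"

text \<open>The default value 0 in other dimensions is a convention; the sheaves to which this is
  applied have one-dimensional cohomology.\<close>

definition frob_eigenvalue ::
    "nat \<Rightarrow> (('f::field ffc \<Rightarrow> 'f ffc) \<Rightarrow> 'l::{field_char_0, metric_space}) \<Rightarrow> 'l" where
  "frob_eigenvalue q \<rho> =
     (if H1c_one_dimensional \<rho> then (THE \<mu>. is_frob_eigenvalue q \<rho> \<mu>) else 0)"


section \<open>The sheaf attached to a character of \<open>A\<close>\<close>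

text \<open>The points over the geometric generic point of the covering \<open>(x, y) \<mapsto> F(x)\<close> of the affine
  line by the curve \<open>y^p - y = x R(x)\<close>, and the right action of the Heisenberg group.\<close>

definition generic_fibre :: "nat \<Rightarrow> 'f::field poly \<Rightarrow> 'f poly \<Rightarrow> ('f ffc \<times> 'f ffc) set" where
  "generic_fibre p R F = {(x, y).
     y ^ p - y = x * poly (map_poly cst R) x \<and> poly (map_poly cst F) x = coord}"

definition heis_act ::
    "nat \<Rightarrow> nat \<Rightarrow> 'f::field poly \<Rightarrow> 'f ffc \<times> 'f ffc \<Rightarrow> 'f \<times> 'f \<Rightarrow> 'f ffc \<times> 'f ffc" where
  "heis_act p e R = (\<lambda>(x, y) (a, b).
     (x + cst a, y + cst b + heis_f p e (map_poly cst R) x (cst a)))"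

text \<open>
  The arithmetic Galois group acts on the generic fibre through the abelian group \<open>A\<close>, whose
  elements are rational over the field of constants. An arithmetic Frobenius element mapping \<open>P\<close>
  to \<open>P \<cdot> g\<close> has as inverse a geometric Frobenius element, which acts on the stalk by \<open>\<xi> g\<close>;
  therefore \<open>\<sigma>\<close> with \<open>\<sigma> P = P \<cdot> g\<close> acts by the inverse of \<open>\<xi> g\<close>.
\<close>

definition sheaf_char ::
    "nat \<Rightarrow> nat \<Rightarrow> 'f::field poly \<Rightarrow> 'f poly \<Rightarrow> ('f \<times> 'f) set \<Rightarrow> ('f \<times> 'f \<Rightarrow> 'l::field)
      \<Rightarrow> ('f ffc \<Rightarrow> 'f ffc) \<Rightarrow> 'l" where
  "sheaf_char p e R F A \<xi> \<sigma> = inverse (\<xi> (THE g. g \<in> A \<and>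
     (\<forall>P \<in> generic_fibre p R F. map_prod \<sigma> \<sigma> P = heis_act p e R P g)))"

definition tau ::
    "nat \<Rightarrow> nat \<Rightarrow> nat \<Rightarrow> 'f::field poly \<Rightarrow> 'f poly \<Rightarrow> ('f \<times> 'f) set
      \<Rightarrow> ('f \<times> 'f \<Rightarrow> 'l::{field_char_0, metric_space}) \<Rightarrow> 'l" where
  "tau p q e R F A \<xi> = frob_eigenvalue q (sheaf_char p e R F A \<xi>)"

end

theory Submission
  imports Defs
begin

text \<open>
  Put \<open>u = a\<^sub>W s\<close>, where \<open>s\<close> is the coordinate of the affine line. The isomorphism \<open>\<phi>\<close> identifies the sheaf
  \<open>Q\<^sub>\<xi>\<close> with the Artin--Schreier--Witt sheaf of \<open>(u, c u)\<close>: an element \<open>\<sigma>\<close> of the Galois group acts by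
  the inverse of \<open>\<xi>\<^sub>2(\<sigma> T - T)\<close>, where \<open>T\<close> is a Witt vector of length two with
  \<open>Frob(T) - T = (u, c u)\<close>. Passing to the twist by \<open>t\<close> replaces \<open>c\<close> by \<open>c + t\<close>. Since
  \<open>(u + t, c (u + t)) = (u, (c + t) u) + (t, c t)\<close> in \<open>W\<^sub>2\<close>, the translation \<open>u \<mapsto> u + t\<close> of the affine
  line carries the sheaf of \<open>(u, c u)\<close> to the twisted one tensored with the constant sheaf of
  \<open>(t, c t)\<close>. So the two Frobenius eigenvalues differ by the factor \<open>\<xi>\<^sub>q(t, c t)\<close>, whose inverse is
  \<open>\<xi>\<^sub>q(t, t\<^sup>2 + c t)\<close>.
\<close>

section \<open>Ring homomorphisms between types\<close>

text \<open>The square root in \<open>c\<close> arises as follows. The formula of the isomorphism,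
  evaluated at the generic point of the covering, gives a Witt vector whose p-Frobenius difference
  has terms in s^2 and s in its second component. The trace from F_p to F_2 turns this into a
  difference for squaring, and adding (0, d s), with d^2 the coefficient of s^2, trades the
  quadratic term for d s. The character of the complement of the Witt part contributes a further
  linear term, and the sum is c u. The twisting constant is an adjoint: modulo polynomials of the
  form E^p + E, the polynomial t F_A(x) is equivalent both to F^*(t) x and to (t^(1/p) + t) f_U(x).
  Squaring this equivalence gives the change of the equation that Delta_t solves. The twist also
  adds t^2 under the square root in \<open>c\<close>, which adds t to \<open>c\<close>. No
  cohomology group is computed. The translation is lifted to the algebraic closure of the function
  field, and conjugation by the lift acts on cochains. As the translation is by an element of F_q,
  this conjugation permutes the lifts of Frobenius.\<close>

locale ring_map =
  fixes h :: "'a::comm_ring_1 \<Rightarrow> 'b::comm_ring_1"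
  assumes add: "h (x + y) = h x + h y"
    and mult: "h (x * y) = h x * h y"
    and one: "h 1 = 1"
begin

lemma zero: "h 0 = 0"
  using add[of 0 0] by simp

lemma minus: "h (- x) = - h x"
  using add[of x "- x"] by (simp add: zero eq_neg_iff_add_eq_0 add.commute)

lemma diff: "h (x - y) = h x - h y"
  using add[of x "- y"] by (simp add: minus)

lemma power: "h (x ^ k) = h x ^ k"
  by (induction k) (simp_all add: one mult)

lemma sum: "h (sum f S) = (\<Sum>i\<in>S. h (f i))"
  by (induction S rule: infinite_finite_induct) (simp_all add: zero add)

lemma coeff_map: "Polynomial.coeff (map_poly h P) k = h (Polynomial.coeff P k)"
  by (simp add: coeff_map_poly zero)

lemma map_poly_add: "map_poly h (P + Q) = map_poly h P + map_poly h Q"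
  by (rule poly_eqI) (simp add: coeff_map add)

lemma map_poly_mult: "map_poly h (P * Q) = map_poly h P * map_poly h Q"
  by (rule poly_eqI) (simp add: coeff_map coeff_mult sum mult)

lemma map_poly_power: "map_poly h (P ^ k) = map_poly h P ^ k"
  by (induction k) (simp_all add: one map_poly_mult)

lemma map_poly_pcompose: "map_poly h (pcompose P Q) = pcompose (map_poly h P) (map_poly h Q)"
  by (induction P)
    (simp_all add: pcompose_pCons map_poly_add map_poly_mult map_poly_pCons zero)

lemma poly_map_poly: "poly (map_poly h P) (h x) = h (poly P x)"
  by (induction P) (simp_all add: map_poly_pCons zero add mult)

lemma ring_map_map_poly: "ring_map (map_poly h)"
  by standard (simp_all add: map_poly_add map_poly_mult one)

end

locale field_map = ring_map h for h :: "'a::field \<Rightarrow> 'b::field"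
begin

lemma eq_0_iff: "h x = 0 \<longleftrightarrow> x = 0"
proof
  assume "h x = 0"
  show "x = 0"
  proof (rule ccontr)
    assume "x \<noteq> 0"
    then have "h x * h (inverse x) = 1"
      by (simp flip: mult add: one)
    with \<open>h x = 0\<close> show False
      by simp
  qed
qed (simp add: zero)

lemma inj: "inj h"
proof (rule injI)
  fix x y assume "h x = h y"
  then have "h (x - y) = 0"
    by (simp add: diff)
  then show "x = y"
    by (simp add: eq_0_iff)
qed

lemma eq_iff: "h x = h y \<longleftrightarrow> x = y"
  using inj by (simp add: inj_eq)

lemma inverse: "h (inverse x) = inverse (h x)"
proof (cases "x = 0")
  case False
  then have "h x * h (inverse x) = 1"
    by (simp flip: mult add: one)
  then show ?thesis
    by (simp add: inverse_unique)
qed (simp add: zero)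

lemma divide: "h (x / y) = h x / h y"
  by (simp add: field_class.field_divide_inverse mult inverse)

end

lemma field_mapI: "ring_map h \<Longrightarrow> field_map h"
  by (simp add: field_map_def)

text \<open>An algebraically closed source already splits \<open>P\<close>, and the linear factors
  are carried over one at a time. Applied to \<open>cst\<close>, this makes an element that is
  algebraic over the constants a constant; applied to an endomorphism of the closure, it gives
  surjectivity.\<close>

lemma root_in_range:
  fixes h :: "'a::alg_closed_field \<Rightarrow> 'b::field"
  assumes "ring_map h" and "P \<noteq> 0" "poly (map_poly h P) x = 0"
  shows "x \<in> range h"
proof -
  interpret field_map h
    using assms(1) by (rule field_mapI)
  show ?thesis
    using assms(2,3)
  proof (induction "Polynomial.degree P" arbitrary: P rule: less_induct)
    case less
    show ?case
    proof (cases "Polynomial.degree P = 0")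
      case True
      then obtain c where "P = [:c:]"
        by (rule degree_eq_zeroE)
      with less.prems show ?thesis
        by (simp add: map_poly_pCons zero eq_0_iff)
    next
      case False
      then obtain a where "poly P a = 0"
        using alg_closed_imp_poly_has_root by blast
      then obtain Q where Q: "P = [:- a, 1:] * Q"
        by (auto simp: poly_eq_0_iff_dvd)
      with less.prems have "Q \<noteq> 0"
        by auto
      then have "Polynomial.degree Q < Polynomial.degree P"
        unfolding Q by (subst degree_mult_eq) auto
      moreover have "(x - h a) * poly (map_poly h Q) x = 0"
        using less.prems(2)
        by (simp only: Q map_poly_mult) (simp add: map_poly_pCons zero minus one disj_commute)
      moreover have "x \<in> range h" if "x = h a"
        using that by blast
      ultimately show ?thesis
        using less.hyps[of Q] \<open>Q \<noteq> 0\<close> by (metis mult_eq_0_iff right_minus_eq)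
    qed
  qed
qed


section \<open>Extension of homomorphisms to algebraic extensions\<close>

text \<open>The graphs of homomorphisms from subrings of one field to another field.\<close>

definition partial_hom :: "('a::field \<times> 'b::field) set \<Rightarrow> bool" where
  "partial_hom G \<longleftrightarrow> (1, 1) \<in> G \<and>
     (\<forall>x y x' y'. (x, y) \<in> G \<longrightarrow> (x', y') \<in> G \<longrightarrow> (x - x', y - y') \<in> G \<and> (x * x', y * y') \<in> G) \<and>
     (\<forall>y. (0, y) \<in> G \<longrightarrow> y = 0)"

context
  fixes G :: "('a::field \<times> 'b::field) set"
  assumes G: "partial_hom G"
begin

lemma partial_hom_one: "(1, 1) \<in> G"
  using G by (simp add: partial_hom_def)

lemma partial_hom_diff: "(x, y) \<in> G \<Longrightarrow> (x', y') \<in> G \<Longrightarrow> (x - x', y - y') \<in> G"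
  using G by (simp add: partial_hom_def)

lemma partial_hom_mult: "(x, y) \<in> G \<Longrightarrow> (x', y') \<in> G \<Longrightarrow> (x * x', y * y') \<in> G"
  using G by (simp add: partial_hom_def)

lemma partial_hom_zero: "(0, 0) \<in> G"
  using partial_hom_diff[OF partial_hom_one partial_hom_one] by simp

lemma partial_hom_add: "(x, y) \<in> G \<Longrightarrow> (x', y') \<in> G \<Longrightarrow> (x + x', y + y') \<in> G"
  using partial_hom_diff[OF _ partial_hom_diff[OF partial_hom_zero]] by fastforce

lemma partial_hom_sum:
  "(\<And>i. i \<in> S \<Longrightarrow> (f i, g i) \<in> G) \<Longrightarrow> (sum f S, sum g S) \<in> G"
  by (induction S rule: infinite_finite_induct) (simp_all add: partial_hom_zero partial_hom_add)

lemma partial_hom_eq: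
  assumes "(x, y) \<in> G" "(x, y') \<in> G"
  shows "y = y'"
proof -
  have "(0, y - y') \<in> G"
    using partial_hom_diff[OF assms] by simp
  then have "y - y' = 0"
    using G unfolding partial_hom_def by blast
  then show ?thesis
    by simp
qed

text \<open>A subring that contains a field over which \<open>x\<close> is algebraic also contains
  \<open>inverse x\<close>: strip factors of \<open>x\<close> from the equation, then solve it for
  the inverse by means of its nonzero constant term. Closure under differences and products is
  therefore enough in \<open>partial_hom\<close>.\<close>

lemma partial_hom_inverse:
  fixes i :: "'k::field \<Rightarrow> 'a"
  assumes i: "ring_map i" "range i \<subseteq> Domain G"
    and alg: "P \<noteq> 0" "poly (map_poly i P) x = 0"
    and x: "(x, y) \<in> G" "x \<noteq> 0"
  shows "(inverse x, inverse y) \<in> G" "y \<noteq> 0"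
proof -
  interpret field_map i
    using i(1) by (rule field_mapI)
  have dom: "poly (map_poly i Q) x \<in> Domain G" for Q
  proof (induction Q)
    case 0
    show ?case
      using partial_hom_zero by auto
  next
    case (pCons c Q)
    obtain u v where "(i c, u) \<in> G" "(poly (map_poly i Q) x, v) \<in> G"
      using i(2) pCons.IH by blast
    then have "(i c + x * poly (map_poly i Q) x, u + y * v) \<in> G"
      using x(1) by (intro partial_hom_add partial_hom_mult)
    then show ?case
      by (auto simp: map_poly_pCons zero)
  qed
  have "inverse x \<in> Domain G"
    using alg
  proof (induction P)
    case (pCons c Q)
    show ?case
    proof (cases "c = 0")
      case True
      then show ?thesis
        using pCons x(2) by (auto simp: map_poly_pCons zero)
    next
      case False
      define w where "w = poly (map_poly i (Polynomial.smult (- inverse c) Q)) x"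
      then have "w = - inverse (i c) * poly (map_poly i Q) x"
        by (simp only: map_poly_smult[of i, OF zero mult] poly_smult minus inverse)
      moreover have "x * poly (map_poly i Q) x = - i c"
        using pCons.prems by (simp add: map_poly_pCons zero eq_neg_iff_add_eq_0 add.commute)
      ultimately have "x * w = - inverse (i c) * - i c"
        by (metis mult.left_commute)
      then have "x * w = 1"
        using False by (simp add: eq_0_iff)
      then have "inverse x = w"
        by (rule inverse_unique)
      then show ?thesis
        using dom by (simp add: w_def)
    qed
  qed simp
  then obtain w where w: "(inverse x, w) \<in> G"
    by blast
  have "(1, y * w) \<in> G"
    using partial_hom_mult[OF x(1) w] x(2) by simp
  then have "y * w = 1"
    using partial_hom_eq partial_hom_one by blast
  then show "(inverse x, inverse y) \<in> G" "y \<noteq> 0"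
    using w by (auto simp: inverse_unique)
qed

end

text \<open>Adjunction of a single algebraic element: \<open>P\<close> has minimal degree among the
  nonzero polynomials over the domain that vanish at \<open>a\<close>, its image \<open>P'\<close>
  has a root \<open>b\<close>, and \<open>a\<close> is sent to \<open>b\<close>.\<close>

lemma partial_hom_extend_one:
  fixes G :: "('a::field \<times> 'b::alg_closed_field) set" and i :: "'k::field \<Rightarrow> 'a"
  assumes G: "partial_hom G" and i: "ring_map i" "range i \<subseteq> Domain G"
    and alg: "\<And>x. \<exists>P. P \<noteq> 0 \<and> poly (map_poly i P) x = 0"
  shows "\<exists>G'. partial_hom G' \<and> G \<subseteq> G' \<and> a \<in> Domain G'"
proof -
  interpret field_map i
    using i(1) by (rule field_mapI)
  note closed = partial_hom_one[OF G] partial_hom_zero[OF G] partial_hom_diff[OF G]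
    partial_hom_mult[OF G] partial_hom_sum[OF G] partial_hom_eq[OF G]
  have inv: "(inverse x, inverse y) \<in> G" "y \<noteq> 0" if "(x, y) \<in> G" "x \<noteq> 0" for x y
  proof -
    obtain P where P: "P \<noteq> 0" "poly (map_poly i P) x = 0"
      using alg by blast
    show "(inverse x, inverse y) \<in> G" "y \<noteq> 0"
      by (rule partial_hom_inverse[OF G i P that])+
  qed
  \<comment> \<open>The graph that \<open>G\<close> induces on polynomials, coefficient by
    coefficient.\<close>
  define T where
    "T = {(Q, Q'). \<forall>k. (Polynomial.coeff Q k, Polynomial.coeff Q' k) \<in> G}"
  have T_diff: "(Q - D, Q' - D') \<in> T" if "(Q, Q') \<in> T" "(D, D') \<in> T" for Q Q' D D'
    using that closed by (auto simp: T_def)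
  have T_mult: "(Q * D, Q' * D') \<in> T" if "(Q, Q') \<in> T" "(D, D') \<in> T" for Q Q' D D'
    using that closed(4) by (auto simp: T_def coeff_mult intro!: closed(5))
  have T_monom: "(Polynomial.monom x k, Polynomial.monom y k) \<in> T" if "(x, y) \<in> G" for x y k
    using that closed by (auto simp: T_def)
  define minimal where "minimal P \<longleftrightarrow> P \<noteq> 0 \<and> P \<in> Domain T \<and> poly P a = 0" for P
  obtain P0 where P0: "P0 \<noteq> 0" "poly (map_poly i P0) a = 0"
    using alg by blast
  have "map_poly i P0 \<in> Domain T"
  proof -
    have "\<exists>v. (i c, v) \<in> G" for c
      using i(2) by blast
    then obtain j where j: "\<And>c. (i c, j c) \<in> G"
      by metis
    \<comment> \<open>\<open>map_poly\<close> acts as expected on coefficients only for functions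
      that preserve 0.\<close>
    have "j 0 = 0"
      using j[of 0] closed(2,6) zero by metis
    then have "(map_poly i P0, map_poly j P0) \<in> T"
      using j by (auto simp: T_def coeff_map_poly zero)
    then show ?thesis
      by blast
  qed
  with P0 have "minimal (map_poly i P0)"
    by (simp add: minimal_def map_poly_eq_0_iff zero eq_0_iff)
  then obtain P where P: "minimal P" and
    P_min: "\<And>Q. minimal Q \<Longrightarrow> Polynomial.degree P \<le> Polynomial.degree Q"
    using exists_least_lemma[of "\<lambda>n. \<exists>Q. minimal Q \<and> Polynomial.degree Q = n"]
    by (metis arg_min_nat_lemma)
  obtain P' where P': "(P, P') \<in> T"
    using P by (auto simp: minimal_def)
  let ?n = "Polynomial.degree P"
  have n: "?n > 0"
  proof (rule ccontr)
    assume "\<not> ?n > 0"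
    then obtain c where "P = [:c:]"
      using degree_eq_zeroE by blast
    with P show False
      by (auto simp: minimal_def)
  qed
  have lc: "(Polynomial.lead_coeff P, Polynomial.coeff P' ?n) \<in> G"
    using P' by (auto simp: T_def)
  have lc0: "Polynomial.lead_coeff P \<noteq> 0"
    using P by (auto simp: minimal_def)
  have "Polynomial.coeff P' ?n \<noteq> 0"
    using inv(2)[OF lc lc0] .
  then have "Polynomial.degree P' \<ge> ?n"
    by (rule le_degree)
  with n have "Polynomial.degree P' > 0"
    by simp
  then obtain b where b: "poly P' b = 0"
    using alg_closed_imp_poly_has_root by blast
  \<comment> \<open>Evaluation at \<open>b\<close> is well defined: multiples of \<open>P\<close>
    remove leading terms of \<open>Q\<close>, whose degree cannot drop below that of
    \<open>P\<close> by minimality, until the zero polynomial is left.\<close>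
  have well: "poly Q' b = 0" if "(Q, Q') \<in> T" "poly Q a = 0" for Q Q'
    using that
  proof (induction "Polynomial.degree Q" arbitrary: Q Q' rule: less_induct)
    case less
    show ?case
    proof (cases "Q = 0")
      case True
      then have "\<forall>k. (0, Polynomial.coeff Q' k) \<in> G"
        using less.prems by (auto simp: T_def)
      then have "Q' = 0"
        using closed(2,6) by (intro poly_eqI) auto
      then show ?thesis
        by simp
    next
      case False
      let ?m = "Polynomial.degree Q"
      have nm: "?n \<le> ?m"
        using False less.prems by (intro P_min) (auto simp: minimal_def)
      let ?c = "Polynomial.lead_coeff Q * inverse (Polynomial.lead_coeff P)"
      let ?c' = "Polynomial.coeff Q' ?m * inverse (Polynomial.coeff P' ?n)"
      have "(Polynomial.lead_coeff Q, Polynomial.coeff Q' ?m) \<in> G"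
        using less.prems by (auto simp: T_def)
      then have "(?c, ?c') \<in> G"
        by (intro closed(4) inv lc lc0)
      define D where "D = Q - Polynomial.monom ?c (?m - ?n) * P"
      define D' where "D' = Q' - Polynomial.monom ?c' (?m - ?n) * P'"
      have DT: "(D, D') \<in> T"
        unfolding D_def D'_def
        by (intro T_diff T_mult T_monom \<open>(?c, ?c') \<in> G\<close> P' less.prems)
      have Da: "poly D a = 0"
        using less.prems P by (simp add: D_def minimal_def)
      have coeff_D: "Polynomial.coeff D ?m = 0"
        using nm lc0 by (simp add: D_def coeff_monom_mult)
      have "Polynomial.degree D \<le> ?m"
        unfolding D_def using nm
        by (intro degree_diff_le order_trans[OF degree_mult_le])
          (auto intro: order_trans[OF add_right_mono[OF degree_monom_le]])
      moreover have "Polynomial.degree D \<noteq> ?m"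
      proof
        assume "Polynomial.degree D = ?m"
        with coeff_D have "D = 0"
          by (metis leading_coeff_0_iff)
        with \<open>Polynomial.degree D = ?m\<close> nm n show False
          by simp
      qed
      ultimately have "poly D' b = 0"
        using less.hyps DT Da by force
      then show ?thesis
        using b by (simp add: D'_def)
    qed
  qed
  define G' where "G' = {(poly Q a, poly Q' b) |Q Q'. (Q, Q') \<in> T}"
  have G'I: "(poly Q a, poly Q' b) \<in> G'" if "(Q, Q') \<in> T" for Q Q'
    using that by (auto simp: G'_def)
  have "partial_hom G'"
    unfolding partial_hom_def
  proof (intro conjI allI impI)
    show "(1, 1) \<in> G'"
      using G'I[OF T_monom[OF closed(1), of 0]] by (simp add: poly_monom)
    fix x y x' y' assume "(x, y) \<in> G'" "(x', y') \<in> G'"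
    then obtain Q Q' D D' where Q: "x = poly Q a" "y = poly Q' b" "(Q, Q') \<in> T"
      and D: "x' = poly D a" "y' = poly D' b" "(D, D') \<in> T"
      unfolding G'_def by auto
    show "(x - x', y - y') \<in> G'"
      using G'I[OF T_diff[OF Q(3) D(3)]] Q D by simp
    show "(x * x', y * y') \<in> G'"
      using G'I[OF T_mult[OF Q(3) D(3)]] Q D by simp
  next
    show "y = 0" if "(0, y) \<in> G'" for y
      using that well unfolding G'_def by auto
  qed
  moreover have "G \<subseteq> G'"
  proof
    fix z assume "z \<in> G"
    then show "z \<in> G'"
      using G'I[OF T_monom[of "fst z" "snd z" 0]] by (simp add: poly_monom)
  qed
  moreover have "a \<in> Domain G'"
    using G'I[OF T_monom[OF closed(1), of 1]] by (auto simp: poly_monom)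
  ultimately show ?thesis
    by blast
qed

text \<open>Zorn's lemma for graphs ordered by inclusion; \<open>partial_hom_extend_one\<close>
  makes a maximal graph total. The base field stays fixed, so algebraicity over it is available at
  every stage.\<close>

theorem partial_hom_extend:
  fixes G :: "('a::field \<times> 'b::alg_closed_field) set" and i :: "'k::field \<Rightarrow> 'a"
  assumes G: "partial_hom G" and i: "ring_map i" "range i \<subseteq> Domain G"
    and alg: "\<And>x. \<exists>P. P \<noteq> 0 \<and> poly (map_poly i P) x = 0"
  shows "\<exists>h. ring_map h \<and> (\<forall>(x, y)\<in>G. h x = y)"
proof -
  define Z where "Z = {M. partial_hom M \<and> G \<subseteq> M}"
  have "\<exists>M\<in>Z. \<forall>N\<in>Z. M \<subseteq> N \<longrightarrow> N = M"
  proof (rule subset_Zorn_nonempty)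
    show "Z \<noteq> {}"
      using G by (auto simp: Z_def)
    fix \<C> assume "\<C> \<noteq> {}" and chain: "subset.chain Z \<C>"
    then have C: "partial_hom M \<and> G \<subseteq> M" if "M \<in> \<C>" for M
      using that by (auto simp: subset.chain_def Z_def)
    have two: "\<exists>M\<in>\<C>. u \<in> M \<and> v \<in> M" if "u \<in> \<Union>\<C>" "v \<in> \<Union>\<C>" for u v
      using that chain unfolding subset_chain_def by blast
    have "partial_hom (\<Union>\<C>)"
      unfolding partial_hom_def
    proof (intro conjI allI impI)
      show "(1, 1) \<in> \<Union>\<C>"
        using C \<open>\<C> \<noteq> {}\<close> partial_hom_one by blast
      show "(x - x', y - y') \<in> \<Union>\<C>" if "(x, y) \<in> \<Union>\<C>" "(x', y') \<in> \<Union>\<C>" for x y x' y'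
        using two[OF that] C partial_hom_diff by blast
      show "(x * x', y * y') \<in> \<Union>\<C>" if "(x, y) \<in> \<Union>\<C>" "(x', y') \<in> \<Union>\<C>" for x y x' y'
        using two[OF that] C partial_hom_mult by blast
      show "y = 0" if "(0, y) \<in> \<Union>\<C>" for y
        using that C unfolding partial_hom_def by blast
    qed
    then show "\<Union>\<C> \<in> Z"
      using C \<open>\<C> \<noteq> {}\<close> by (auto simp: Z_def)
  qed
  then obtain M where M: "partial_hom M" "G \<subseteq> M" and max: "\<And>N. partial_hom N \<Longrightarrow> M \<subseteq> N \<Longrightarrow> N = M"
    unfolding Z_def by (metis (mono_tags, lifting) mem_Collect_eq order_trans)
  have "x \<in> Domain M" for x
  proof -
    have "range i \<subseteq> Domain M"
      using i(2) M(2) by blast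
    then obtain N where "partial_hom N" "M \<subseteq> N" "x \<in> Domain N"
      using partial_hom_extend_one[OF M(1) i(1) _ alg] by blast
    then show ?thesis
      using max by blast
  qed
  then have "\<forall>x. \<exists>y. (x, y) \<in> M"
    by blast
  then obtain h where h: "\<And>x. (x, h x) \<in> M"
    using choice[of "\<lambda>x y. (x, y) \<in> M"] by blast
  have h_eq: "h x = y" if "(x, y) \<in> M" for x y
    using partial_hom_eq[OF M(1)] h that by blast
  have "ring_map h"
    by standard
      (auto intro!: h_eq partial_hom_add[OF M(1)] partial_hom_mult[OF M(1)] partial_hom_one[OF M(1)] h)
  then show ?thesis
    using h_eq M(2) by blast
qed


section \<open>Automorphisms of the algebraic closure of a rational function field\<close>

lemma ring_map_cst: "ring_map (cst :: 'f::field \<Rightarrow> 'f ffc)"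
proof
  fix x y :: 'f
  show "cst (x + y) = cst x + cst y" "cst (x * y) = cst x * cst y"
    unfolding cst_def by (simp_all flip: to_ac_add to_ac_mult add: mult.commute)
  show "cst (1::'f) = 1"
    by (simp add: cst_def One_fract_def one_pCons)
qed

global_interpretation cst: field_map cst
  by (rule field_mapI) (rule ring_map_cst)

text \<open>Constants and the coordinate generate the polynomial ring, so an endomorphism of
  \<open>'f ffc\<close> is controlled on the rational function field by its values on
  \<open>cst\<close> and \<open>coord\<close>.\<close>

lemma to_ac_Fract_poly:
  "to_ac (Fraction_Field.Fract P 1) = poly (map_poly cst P) (coord :: 'f::field ffc)"
proof (induction P)
  case 0
  then show ?case
    by (simp flip: Zero_fract_def)
next
  case (pCons c P)
  have "Fraction_Field.Fract (pCons c P) 1 =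
      Fraction_Field.Fract [:c:] 1 + Fraction_Field.Fract [:0, 1:] 1 * Fraction_Field.Fract P 1"
    by simp
  then have "to_ac (Fraction_Field.Fract (pCons c P) 1) =
      cst c + coord * to_ac (Fraction_Field.Fract P 1)"
    by (simp only: to_ac_add to_ac_mult cst_def coord_def)
  then show ?case
    by (simp only: pCons.IH map_poly_pCons cst.zero poly_pCons)
qed

text \<open>Injectivity lets the endomorphism pass to fractions; from there it extends along the
  algebraic extension \<open>to_ac\<close>.\<close>

lemma ffc_extend:
  fixes \<tau> :: "'f::field poly \<Rightarrow> 'f poly"
  assumes "ring_map \<tau>" and inj: "\<And>P. \<tau> P = 0 \<Longrightarrow> P = 0"
  shows "\<exists>\<sigma> :: 'f ffc \<Rightarrow> 'f ffc. ring_map \<sigma> \<and>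
    (\<forall>P. \<sigma> (to_ac (Fraction_Field.Fract P 1)) = to_ac (Fraction_Field.Fract (\<tau> P) 1))"
proof -
  interpret \<tau>: ring_map \<tau>
    by fact
  define g where "g P = to_ac (Fraction_Field.Fract P 1)" for P :: "'f poly"
  interpret g: ring_map g
    by standard (simp_all add: g_def One_fract_def flip: to_ac_add to_ac_mult)
  have g0: "g P = 0 \<longleftrightarrow> P = 0" for P
    by (simp add: g_def eq_fract Zero_fract_def)
  have \<tau>0: "\<tau> P = 0 \<longleftrightarrow> P = 0" for P
    using inj \<tau>.zero by auto
  have g_Fract: "to_ac (Fraction_Field.Fract P Q) = g P / g Q" if "Q \<noteq> 0" for P Q
    using that by (simp add: g_def flip: to_ac_divide)
  \<comment> \<open>All representations of a fraction enter at once; independence of the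
    representative is then the last clause of \<open>partial_hom\<close>.\<close>
  define G where "G = {(g P / g Q, g (\<tau> P) / g (\<tau> Q)) |P Q. Q \<noteq> 0}"
  have "partial_hom G"
    unfolding partial_hom_def
  proof (intro conjI allI impI)
    show "(1, 1) \<in> G"
      unfolding G_def by (rule CollectI, intro exI[of _ 1]) (simp add: g.one \<tau>.one)
    show "(x - x', y - y') \<in> G" "(x * x', y * y') \<in> G"
      if xy: "(x, y) \<in> G" "(x', y') \<in> G" for x y x' y'
    proof -
      obtain P Q where eq: "x = g P / g Q" "y = g (\<tau> P) / g (\<tau> Q)" "Q \<noteq> 0"
        using xy(1) unfolding G_def by auto
      obtain P' Q' where eq': "x' = g P' / g Q'" "y' = g (\<tau> P') / g (\<tau> Q')" "Q' \<noteq> 0"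
        using xy(2) unfolding G_def by auto
      note eq = eq eq'
      have "x - x' = g (P * Q' - P' * Q) / g (Q * Q')"
        "y - y' = g (\<tau> (P * Q' - P' * Q)) / g (\<tau> (Q * Q'))"
        using eq by (simp_all add: g.diff g.mult \<tau>.diff \<tau>.mult g0 \<tau>0 diff_frac_eq)
      with eq show "(x - x', y - y') \<in> G"
        unfolding G_def by (intro CollectI exI[of _ "P * Q' - P' * Q"] exI[of _ "Q * Q'"]) simp
      have "x * x' = g (P * P') / g (Q * Q')" "y * y' = g (\<tau> (P * P')) / g (\<tau> (Q * Q'))"
        using eq by (simp_all add: g.mult \<tau>.mult)
      with eq show "(x * x', y * y') \<in> G"
        unfolding G_def by (intro CollectI exI[of _ "P * P'"] exI[of _ "Q * Q'"]) simp
    qed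
    show "y = 0" if "(0, y) \<in> G" for y
      using that unfolding G_def by (auto simp: g0 \<tau>0)
  qed
  moreover have "ring_map (to_ac :: 'f poly fract \<Rightarrow> 'f ffc)"
    by standard simp_all
  moreover have "range (to_ac :: 'f poly fract \<Rightarrow> 'f ffc) \<subseteq> Domain G"
  proof
    fix x assume "x \<in> range (to_ac :: 'f poly fract \<Rightarrow> 'f ffc)"
    then obtain P Q where "x = to_ac (Fraction_Field.Fract P Q)" "Q \<noteq> 0"
      by (metis Fract_cases imageE)
    then show "x \<in> Domain G"
      unfolding G_def by (auto simp: g_Fract)
  qed
  moreover have "\<exists>P. P \<noteq> 0 \<and> poly (map_poly to_ac P) x = 0" for x :: "'f ffc"
    using alg_closure_algebraic by blast
  ultimately obtain \<sigma> :: "'f ffc \<Rightarrow> 'f ffc" where \<sigma>: "ring_map \<sigma>" "\<forall>(x, y)\<in>G. \<sigma> x = y"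
    using partial_hom_extend[where i = to_ac and G = G] by blast
  have "(g P, g (\<tau> P)) \<in> G" for P
    unfolding G_def by (rule CollectI, intro exI[of _ P] exI[of _ 1]) (simp add: g.one \<tau>.one)
  then show ?thesis
    using \<sigma> unfolding g_def by fast
qed

text \<open>Injectivity is automatic. The range is an algebraically closed field containing the
  rational function field, over which every element is algebraic.\<close>

lemma ring_map_bij_ffc:
  fixes \<sigma> :: "'f::field ffc \<Rightarrow> 'f ffc"
  assumes "ring_map \<sigma>" and "range cst \<subseteq> range \<sigma>" "coord \<in> range \<sigma>"
  shows "\<sigma> \<in> field_auts"
proof -
  interpret \<sigma>: field_map \<sigma>
    using assms(1) by (rule field_mapI)
  have closed: "x + y \<in> range \<sigma>" "x * y \<in> range \<sigma>" "x / y \<in> range \<sigma>"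
    if "x \<in> range \<sigma>" "y \<in> range \<sigma>" for x y
    using that by (auto simp flip: \<sigma>.add \<sigma>.mult \<sigma>.divide)
  have P: "to_ac (Fraction_Field.Fract P 1) \<in> range \<sigma>" for P
    unfolding to_ac_Fract_poly
  proof (induction P)
    case 0
    then show ?case
      by (auto intro: range_eqI[of _ _ 0] simp: \<sigma>.zero)
  next
    case (pCons c P)
    then show ?case
      using assms(2,3) by (auto simp: map_poly_pCons cst.zero intro!: closed)
  qed
  have base: "to_ac x \<in> range \<sigma>" for x :: "'f poly fract"
  proof -
    obtain P Q where "x = Fraction_Field.Fract P Q" "Q \<noteq> 0"
      by (metis Fract_cases)
    then have "to_ac x = to_ac (Fraction_Field.Fract P 1) / to_ac (Fraction_Field.Fract Q 1)"
      by (simp flip: to_ac_divide)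
    then show ?thesis
      using closed(3) P by metis
  qed
  have "y \<in> range \<sigma>" for y
  proof -
    obtain P :: "'f poly fract poly" where P: "P \<noteq> 0" "poly (map_poly to_ac P) y = 0"
      using alg_closure_algebraic by blast
    \<comment> \<open>A section of the map over the base field. It lifts the coefficients of
      \<open>P\<close> to the source, which is the form that \<open>root_in_range\<close>
      takes.\<close>
    define s where "s x = inv_into UNIV \<sigma> (to_ac x)" for x
    have s: "\<sigma> (s x) = to_ac x" for x
      using base by (simp add: s_def f_inv_into_f)
    have "s 0 = 0"
      using s[of 0] by (simp add: \<sigma>.eq_0_iff)
    then have "map_poly to_ac P = map_poly \<sigma> (map_poly s P)"
      by (intro poly_eqI) (simp add: coeff_map_poly \<sigma>.coeff_map s)
    moreover have "map_poly s P \<noteq> 0"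
      using calculation P(1) map_poly_eq_0_iff[of to_ac P] by auto
    ultimately show ?thesis
      using root_in_range[OF assms(1)] P(2) by metis
  qed
  then show ?thesis
    using \<sigma>.inj by (auto simp: field_auts_def bij_def \<sigma>.add \<sigma>.mult)
qed

text \<open>Raise the coefficients of a polynomial to the power \<open>q\<close>, keep the variable,
  and extend to the closure. If there were no lift, \<open>is_frob_eigenvalue\<close> would hold
  vacuously for every number.\<close>

lemma arith_frob_lifts_nonempty:
  fixes q :: nat
  assumes hom: "\<And>x y :: 'f. (x + y) ^ q = x ^ q + y ^ q" and "q > 0"
  shows "arith_frob_lifts q \<noteq> ({} :: ('f::alg_closed_field ffc \<Rightarrow> 'f ffc) set)"
proof -
  define \<tau> where "\<tau> = map_poly (\<lambda>x::'f. x ^ q)"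
  have "ring_map (\<lambda>x::'f. x ^ q)"
    by standard (simp_all add: hom power_mult_distrib)
  then have "ring_map \<tau>"
    unfolding \<tau>_def by (rule ring_map.ring_map_map_poly)
  moreover have "P = 0" if "\<tau> P = 0" for P
    using that \<open>q > 0\<close> by (simp add: \<tau>_def map_poly_eq_0_iff)
  ultimately have "\<exists>\<sigma> :: 'f ffc \<Rightarrow> 'f ffc. ring_map \<sigma> \<and>
      (\<forall>P. \<sigma> (to_ac (Fraction_Field.Fract P 1)) = to_ac (Fraction_Field.Fract (\<tau> P) 1))"
    by (rule ffc_extend)
  then obtain \<sigma> :: "'f ffc \<Rightarrow> 'f ffc" where \<sigma>: "ring_map \<sigma>"
    "\<And>P. \<sigma> (to_ac (Fraction_Field.Fract P 1)) = to_ac (Fraction_Field.Fract (\<tau> P) 1)"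
    by blast
  have cst: "\<sigma> (cst z) = cst (z ^ q)" for z
    using \<sigma>(2)[of "[:z:]"] \<open>q > 0\<close> by (simp add: cst_def \<tau>_def map_poly_pCons)
  have coord: "\<sigma> coord = coord"
    using \<sigma>(2)[of "[:0, 1:]"] \<open>q > 0\<close>
    by (simp add: coord_def \<tau>_def map_poly_pCons zero_power)
  have "cst z \<in> range \<sigma>" for z
  proof -
    obtain w where "w ^ q = z"
      using nth_root_exists \<open>q > 0\<close> by blast
    then show ?thesis
      using cst[of w] by (metis rangeI)
  qed
  then have "\<sigma> \<in> field_auts"
    using coord by (intro ring_map_bij_ffc \<sigma>(1)) (auto intro: range_eqI[OF sym])
  with cst coord show ?thesis
    by (auto simp: arith_frob_lifts_def)
qed

text \<open>Substitution of \<open>s + k\<close> for \<open>s\<close>, extended to the closure. Two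
  such extensions differ by an element of \<open>geom_gal\<close>.\<close>

lemma translation_automorphism:
  fixes k :: "'f::field"
  shows "\<exists>\<sigma> :: 'f ffc \<Rightarrow> 'f ffc. \<sigma> \<in> field_auts \<and> (\<forall>z. \<sigma> (cst z) = cst z) \<and> \<sigma> coord = coord + cst k"
proof -
  define \<tau> where "\<tau> = (\<lambda>P. pcompose P [:k, 1:])"
  have "ring_map \<tau>"
    by standard (simp_all add: \<tau>_def pcompose_add pcompose_mult pcompose_1)
  moreover have "P = 0" if "\<tau> P = 0" for P
    using that pcompose_eq_0 by (force simp: \<tau>_def)
  ultimately have "\<exists>\<sigma> :: 'f ffc \<Rightarrow> 'f ffc. ring_map \<sigma> \<and>
      (\<forall>P. \<sigma> (to_ac (Fraction_Field.Fract P 1)) = to_ac (Fraction_Field.Fract (\<tau> P) 1))"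
    by (rule ffc_extend)
  then obtain \<sigma> :: "'f ffc \<Rightarrow> 'f ffc" where \<sigma>: "ring_map \<sigma>"
    "\<And>P. \<sigma> (to_ac (Fraction_Field.Fract P 1)) = to_ac (Fraction_Field.Fract (\<tau> P) 1)"
    by blast
  interpret ring_map \<sigma>
    by (rule \<sigma>(1))
  have cst: "\<sigma> (cst z) = cst z" for z
    using \<sigma>(2)[of "[:z:]"] by (simp add: cst_def \<tau>_def)
  have "\<sigma> coord = to_ac (Fraction_Field.Fract [:k, 1:] 1)"
    using \<sigma>(2)[of "[:0, 1:]"] by (simp add: coord_def \<tau>_def pcompose_pCons)
  also have "\<dots> = coord + cst k"
    by (simp add: to_ac_Fract_poly map_poly_pCons cst.zero cst.one)
  finally have coord: "\<sigma> coord = coord + cst k" .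
  have "\<sigma> (coord - cst k) = coord"
    by (simp add: diff cst coord)
  then have "\<sigma> \<in> field_auts"
    using cst by (intro ring_map_bij_ffc \<sigma>(1)) (auto intro: range_eqI[OF sym])
  with cst coord show ?thesis
    by blast
qed


section \<open>Galois groups and places\<close>

text \<open>\<open>field_auts\<close> does not list preservation of 1; it follows from
  surjectivity.\<close>

lemma field_auts_field_map:
  assumes "\<sigma> \<in> field_auts"
  shows "field_map \<sigma>"
proof -
  have "bij \<sigma>" and add: "\<And>x y. \<sigma> (x + y) = \<sigma> x + \<sigma> y" and mult: "\<And>x y. \<sigma> (x * y) = \<sigma> x * \<sigma> y"
    using assms by (auto simp: field_auts_def)
  then obtain u where "\<sigma> u = 1"
    by (metis bij_pointE)
  then have "\<sigma> 1 = 1"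
    using mult[of u 1] by simp
  then show ?thesis
    by (intro field_mapI) (standard, simp_all add: add mult)
qed

lemma field_auts_bij: "\<sigma> \<in> field_auts \<Longrightarrow> bij \<sigma>"
  by (simp add: field_auts_def)

lemma field_auts_inv_apply:
  assumes "\<sigma> \<in> field_auts"
  shows "\<sigma> (inv_into UNIV \<sigma> x) = x" "inv_into UNIV \<sigma> (\<sigma> x) = x"
  using field_auts_bij[OF assms] by (simp_all add: bij_is_inj bij_is_surj surj_f_inv_f)

lemma field_auts_comp: "\<sigma> \<in> field_auts \<Longrightarrow> \<tau> \<in> field_auts \<Longrightarrow> \<sigma> \<circ> \<tau> \<in> field_auts"
  by (auto simp: field_auts_def intro: bij_comp)

lemma field_auts_inv:
  assumes "\<sigma> \<in> field_auts"
  shows "inv_into UNIV \<sigma> \<in> field_auts"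
proof -
  interpret field_map \<sigma>
    by (rule field_auts_field_map[OF assms])
  note inv = field_auts_inv_apply[OF assms]
  have "inv_into UNIV \<sigma> (x + y) = inv_into UNIV \<sigma> x + inv_into UNIV \<sigma> y"
    "inv_into UNIV \<sigma> (x * y) = inv_into UNIV \<sigma> x * inv_into UNIV \<sigma> y" for x y
    by (metis inv add) (metis inv mult)
  then show ?thesis
    using assms by (simp add: field_auts_def bij_imp_bij_inv)
qed

lemma field_auts_conj:
  "\<nu> \<in> field_auts \<Longrightarrow> \<sigma> \<in> field_auts \<Longrightarrow> \<nu> \<circ> \<sigma> \<circ> inv_into UNIV \<nu> \<in> field_auts"
  by (intro field_auts_comp field_auts_inv)

text \<open>Automorphisms of the algebraic closure over automorphisms of the affine line.\<close>

definition line_auts :: "('f::field ffc \<Rightarrow> 'f ffc) set" where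
  "line_auts = {\<nu> \<in> field_auts. \<nu> ` range cst = range cst \<and> \<nu> coord - coord \<in> range cst}"

text \<open>The constants may be moved by any automorphism that fixes the field of order
  \<open>q\<close>. Thus the geometric elements and all lifts of Frobenius lie in one group, on
  which the character of a sheaf is multiplicative.\<close>

definition arith_gal :: "nat \<Rightarrow> ('f::field ffc \<Rightarrow> 'f ffc) set" where
  "arith_gal q = {\<sigma> \<in> field_auts. \<sigma> ` range cst = range cst \<and> \<sigma> coord = coord \<and>
     (\<forall>z\<in>Fin q. \<sigma> (cst z) = cst z)}"

lemma cst_diff_range: "x \<in> range cst \<Longrightarrow> y \<in> range cst \<Longrightarrow> x - y \<in> range cst"
  by (auto simp flip: cst.diff)

lemma line_auts_field_auts: "\<nu> \<in> line_auts \<Longrightarrow> \<nu> \<in> field_auts"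
  by (simp add: line_auts_def)

lemma line_auts_inv:
  assumes "\<nu> \<in> line_auts"
  shows "inv_into UNIV \<nu> \<in> line_auts"
proof -
  have \<nu>: "\<nu> \<in> field_auts"
    using assms by (rule line_auts_field_auts)
  note inv = field_auts_inv_apply[OF \<nu>]
  interpret i: field_map "inv_into UNIV \<nu>"
    by (intro field_auts_field_map field_auts_inv \<nu>)
  have "inv_into UNIV \<nu> ` range cst = inv_into UNIV \<nu> ` (\<nu> ` range cst)"
    using assms by (simp add: line_auts_def)
  then have cst: "inv_into UNIV \<nu> ` range cst = range cst"
    by (simp add: image_image inv)
  have "inv_into UNIV \<nu> (\<nu> coord - coord) \<in> range cst"
    using assms cst by (auto simp: line_auts_def)
  then have "coord - inv_into UNIV \<nu> coord \<in> range cst"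
    by (simp add: i.diff inv)
  then have "0 - (coord - inv_into UNIV \<nu> coord) \<in> range cst"
    by (rule cst_diff_range[rotated]) (rule range_eqI[of _ _ 0], simp add: cst.zero)
  then show ?thesis
    using cst field_auts_inv[OF \<nu>] by (simp add: line_auts_def)
qed

lemma geom_gal_comp: "\<sigma> \<in> geom_gal \<Longrightarrow> \<tau> \<in> geom_gal \<Longrightarrow> \<sigma> \<circ> \<tau> \<in> geom_gal"
  by (auto simp: geom_gal_def field_auts_comp)

lemma geom_gal_inv: "\<sigma> \<in> geom_gal \<Longrightarrow> inv_into UNIV \<sigma> \<in> geom_gal"
  unfolding geom_gal_def by (auto simp: field_auts_inv) (metis field_auts_inv_apply(2))+

text \<open>An element of \<open>geom_gal\<close> fixes the constants and \<open>coord\<close>,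
  hence also \<open>inv_into UNIV \<nu> coord\<close>, which differs from \<open>coord\<close> by a
  constant.\<close>

lemma geom_gal_conj:
  assumes "\<nu> \<in> line_auts" "\<sigma> \<in> geom_gal"
  shows "\<nu> \<circ> \<sigma> \<circ> inv_into UNIV \<nu> \<in> geom_gal"
proof -
  have \<nu>: "\<nu> \<in> field_auts" and \<sigma>: "\<sigma> \<in> field_auts"
    using assms by (simp_all add: line_auts_def geom_gal_def)
  interpret \<nu>: field_map \<nu>
    by (rule field_auts_field_map[OF \<nu>])
  interpret \<sigma>: field_map \<sigma>
    by (rule field_auts_field_map[OF \<sigma>])
  note inv = field_auts_inv_apply[OF \<nu>]
  have i: "inv_into UNIV \<nu> \<in> line_auts"
    by (rule line_auts_inv[OF assms(1)])
  have fixed: "\<sigma> x = x" if "x \<in> range cst" for x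
    using assms(2) that by (auto simp: geom_gal_def)
  have "\<nu> (\<sigma> (inv_into UNIV \<nu> (cst z))) = cst z" for z
  proof -
    have "inv_into UNIV \<nu> (cst z) \<in> range cst"
      using i by (auto simp: line_auts_def)
    then show ?thesis
      by (simp add: fixed inv)
  qed
  moreover have "\<nu> (\<sigma> (inv_into UNIV \<nu> coord)) = coord"
  proof -
    have "\<sigma> (inv_into UNIV \<nu> coord - coord) = inv_into UNIV \<nu> coord - coord"
      using i by (intro fixed) (simp add: line_auts_def)
    moreover have "\<sigma> coord = coord"
      using assms(2) by (simp add: geom_gal_def)
    ultimately have "\<sigma> (inv_into UNIV \<nu> coord) = inv_into UNIV \<nu> coord"
      by (simp add: \<sigma>.diff)
    then show ?thesis
      by (simp add: inv)
  qed
  ultimately show ?thesis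
    using field_auts_conj[OF \<nu> \<sigma>] by (simp add: geom_gal_def)
qed

lemma geom_gal_arith_gal: "\<sigma> \<in> geom_gal \<Longrightarrow> \<sigma> \<in> arith_gal q"
  by (force simp: geom_gal_def arith_gal_def)

lemma arith_gal_line_auts: "\<sigma> \<in> arith_gal q \<Longrightarrow> \<sigma> \<in> line_auts"
  by (auto simp: arith_gal_def line_auts_def intro: range_eqI[of _ _ 0] simp: cst.zero)

lemma arith_gal_comp: "\<sigma> \<in> arith_gal q \<Longrightarrow> \<tau> \<in> arith_gal q \<Longrightarrow> \<sigma> \<circ> \<tau> \<in> arith_gal q"
  by (auto simp: arith_gal_def field_auts_comp simp flip: image_image image_comp)

lemma arith_gal_inv:
  assumes "\<sigma> \<in> arith_gal q"
  shows "inv_into UNIV \<sigma> \<in> arith_gal q"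
proof -
  have "\<sigma> \<in> field_auts"
    using assms by (simp add: arith_gal_def)
  note inv = field_auts_inv_apply(2)[OF this]
  have "inv_into UNIV \<sigma> coord = coord"
    using assms inv[of coord] by (simp add: arith_gal_def)
  moreover have "inv_into UNIV \<sigma> (cst z) = cst z" if "z \<in> Fin q" for z
    using assms inv[of "cst z"] that by (simp add: arith_gal_def)
  ultimately show ?thesis
    using line_auts_inv[OF arith_gal_line_auts[OF assms]]
    by (simp add: arith_gal_def line_auts_def)
qed

lemma arith_frob_lifts_arith_gal:
  fixes \<phi> :: "'f::alg_closed_field ffc \<Rightarrow> 'f ffc"
  assumes "\<phi> \<in> arith_frob_lifts q" "q > 0"
  shows "\<phi> \<in> arith_gal q"
proof -
  have \<phi>: "\<phi> (cst z) = cst (z ^ q)" for z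
    using assms by (simp add: arith_frob_lifts_def)
  have "\<phi> ` range cst = range cst"
  proof
    show "range cst \<subseteq> \<phi> ` range cst"
    proof
      fix x :: "'f ffc" assume "x \<in> range cst"
      then obtain z where "x = cst z"
        by blast
      moreover obtain w where "w ^ q = z"
        using nth_root_exists \<open>q > 0\<close> by blast
      ultimately show "x \<in> \<phi> ` range cst"
        using \<phi>[of w] by (metis image_eqI rangeI)
    qed
  qed (auto simp: \<phi>)
  then show ?thesis
    using assms by (auto simp: arith_gal_def arith_frob_lifts_def Fin_def)
qed

text \<open>Both lifts are prescribed on the constants and on the coordinate, so their quotient is
  the identity there.\<close>

lemma arith_frob_lifts_diff:
  assumes "\<phi> \<in> arith_frob_lifts q" "\<phi>' \<in> arith_frob_lifts q"
  shows "inv_into UNIV \<phi> \<circ> \<phi>' \<in> geom_gal"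
proof -
  have "\<phi> \<in> field_auts" "\<phi>' \<in> field_auts"
    using assms by (simp_all add: arith_frob_lifts_def)
  moreover have "\<phi> (cst z) = \<phi>' (cst z)" "\<phi> coord = \<phi>' coord" for z
    using assms by (simp_all add: arith_frob_lifts_def)
  ultimately show ?thesis
    by (simp add: geom_gal_def field_auts_comp field_auts_inv field_auts_inv_apply flip: \<open>\<phi> coord = _\<close>)
      (metis field_auts_inv_apply(2))
qed

section \<open>Action of line automorphisms on places, inertia groups and the Krull topology\<close>

lemma places_cst: "W \<in> places \<Longrightarrow> range cst \<subseteq> W"
  by (simp add: places_def)

lemma places_diff: "W \<in> places \<Longrightarrow> x \<in> W \<Longrightarrow> y \<in> W \<Longrightarrow> x - y \<in> W"
  by (simp add: places_def)

context
  fixes \<nu> :: "'f::field ffc \<Rightarrow> 'f ffc"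
  assumes \<nu>: "\<nu> \<in> line_auts"
begin

interpretation \<nu>: field_map \<nu>
  by (rule field_auts_field_map[OF line_auts_field_auts[OF \<nu>]])

private lemma inj: "\<nu> x \<in> \<nu> ` W \<longleftrightarrow> x \<in> W"
  using \<nu>.inj by (simp add: inj_image_mem_iff)

private lemma surj: "\<exists>y. x = \<nu> y"
  using \<nu> by (metis field_auts_inv_apply(1) line_auts_field_auts)

lemma places_image:
  assumes "W \<in> places"
  shows "\<nu> ` W \<in> places"
proof -
  have "range cst \<subseteq> \<nu> ` W"
    using assms \<nu> image_mono[of "range cst" W \<nu>] by (simp add: places_def line_auts_def)
  moreover have "x - y \<in> \<nu> ` W \<and> x * y \<in> \<nu> ` W" if "x \<in> \<nu> ` W" "y \<in> \<nu> ` W" for x y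
  proof -
    obtain x' y' where "x = \<nu> x'" "y = \<nu> y'" "x' \<in> W" "y' \<in> W"
      using \<open>x \<in> \<nu> ` W\<close> \<open>y \<in> \<nu> ` W\<close> by blast
    then show ?thesis
      using assms by (simp add: places_def inj flip: \<nu>.diff \<nu>.mult)
  qed
  moreover have "x \<in> \<nu> ` W \<or> inverse x \<in> \<nu> ` W" for x
  proof -
    obtain y where "x = \<nu> y"
      using surj by blast
    then show ?thesis
      using assms by (simp add: places_def inj flip: \<nu>.inverse)
  qed
  moreover have "\<nu> ` W \<noteq> UNIV"
  proof
    assume "\<nu> ` W = UNIV"
    then have "W = UNIV"
      using inj by blast
    then show False
      using assms by (simp add: places_def)
  qed
  ultimately show ?thesis
    by (simp add: places_def)
qed

text \<open>A place contains all constants, and \<open>\<nu>\<close> moves \<open>coord\<close> by a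
  constant: translations fix the point at infinity.\<close>

lemma coord_mem_image_iff:
  assumes "W \<in> places"
  shows "coord \<in> \<nu> ` W \<longleftrightarrow> coord \<in> W"
proof -
  have image: "\<nu> ` W \<in> places"
    by (rule places_image[OF assms])
  have k: "\<nu> coord - coord \<in> \<nu> ` W"
    using \<nu> places_cst[OF image] by (auto simp: line_auts_def)
  have diff: "x - y \<in> \<nu> ` W" if "x \<in> \<nu> ` W" "y \<in> \<nu> ` W" for x y
    using places_diff[OF image that] .
  have "0 \<in> \<nu> ` W"
    using diff[OF k k] by simp
  have "coord \<in> \<nu> ` W \<longleftrightarrow> \<nu> coord \<in> \<nu> ` W"
  proof
    assume "\<nu> coord \<in> \<nu> ` W"
    then show "coord \<in> \<nu> ` W"
      using diff[OF _ k, of "\<nu> coord"] by simp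
  next
    assume "coord \<in> \<nu> ` W"
    then have "(\<nu> coord - coord) - (0 - coord) \<in> \<nu> ` W"
      by (intro diff k \<open>0 \<in> \<nu> ` W\<close>)
    then show "\<nu> coord \<in> \<nu> ` W"
      by simp
  qed
  then show ?thesis
    by (simp add: inj)
qed

lemma finite_places_image: "W \<in> finite_places \<Longrightarrow> \<nu> ` W \<in> finite_places"
  by (auto simp: finite_places_def places_image coord_mem_image_iff)

lemma infinite_places_image: "W \<in> infinite_places \<Longrightarrow> \<nu> ` W \<in> infinite_places"
  by (simp add: infinite_places_def places_image coord_mem_image_iff)

lemma max_ideal_image: "max_ideal (\<nu> ` W) = \<nu> ` max_ideal W"
proof -
  have "\<nu> x \<in> max_ideal (\<nu> ` W) \<longleftrightarrow> \<nu> x \<in> \<nu> ` max_ideal W" for x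
    by (simp add: max_ideal_def inj \<nu>.eq_0_iff flip: \<nu>.inverse)
  then show ?thesis
    using surj by (metis (no_types) subsetI subset_antisym)
qed

lemma inertia_conj:
  assumes "\<sigma> \<in> inertia W"
  shows "\<nu> \<circ> \<sigma> \<circ> inv_into UNIV \<nu> \<in> inertia (\<nu> ` W)"
proof -
  note inv = field_auts_inv_apply[OF line_auts_field_auts[OF \<nu>]]
  have \<sigma>: "\<sigma> \<in> geom_gal" "\<sigma> ` W = W" "\<And>x. x \<in> W \<Longrightarrow> \<sigma> x - x \<in> max_ideal W"
    using assms by (simp_all add: inertia_def)
  have "(\<nu> \<circ> \<sigma> \<circ> inv_into UNIV \<nu>) ` \<nu> ` W = \<nu> ` \<sigma> ` W"
    by (simp add: image_image inv)
  moreover have "\<nu> (\<sigma> (inv_into UNIV \<nu> (\<nu> x))) - \<nu> x \<in> max_ideal (\<nu> ` W)" if "x \<in> W" for x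
    using \<sigma>(3)[OF that] by (simp add: inv max_ideal_image flip: \<nu>.diff)
  ultimately show ?thesis
    using geom_gal_conj[OF \<nu> \<sigma>(1)] \<sigma>(2) by (auto simp: inertia_def)
qed

text \<open>In the topology of pointwise convergence one coordinate is treated at a time, and the
  value of the conjugate at \<open>x\<close> depends on \<open>\<sigma>\<close> only through its
  value at \<open>inv_into UNIV \<nu> x\<close>.\<close>

lemma continuous_map_conj:
  "continuous_map krull_top krull_top (\<lambda>\<sigma>. \<nu> \<circ> \<sigma> \<circ> inv_into UNIV \<nu>)"
proof -
  let ?P = "product_topology (\<lambda>_::'f ffc. discrete_topology (UNIV :: 'f ffc set)) UNIV"
  have "continuous_map krull_top (discrete_topology UNIV) (\<lambda>\<sigma>. \<nu> (\<sigma> (inv_into UNIV \<nu> x)))" for x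
  proof -
    have "continuous_map krull_top (discrete_topology UNIV) (\<lambda>\<sigma>. \<sigma> (inv_into UNIV \<nu> x))"
      unfolding krull_top_def
      by (intro continuous_map_from_subtopology continuous_map_product_projection) simp
    moreover have "continuous_map (discrete_topology UNIV) (discrete_topology UNIV) \<nu>"
      by simp
    ultimately show ?thesis
      using continuous_map_compose unfolding comp_def by blast
  qed
  then have "continuous_map krull_top ?P (\<lambda>\<sigma>. \<nu> \<circ> \<sigma> \<circ> inv_into UNIV \<nu>)"
    by (simp add: continuous_map_componentwise_UNIV)
  moreover have "topspace krull_top = (geom_gal :: ('f ffc \<Rightarrow> 'f ffc) set)"
    by (simp add: krull_top_def)
  ultimately show ?thesis
    using geom_gal_conj[OF \<nu>]
    by (subst (2) krull_top_def) (auto simp: continuous_map_in_subtopology)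
qed

end


section \<open>Functoriality of the compactly supported cohomology\<close>

text \<open>One operation for two uses: with a Frobenius lift for \<open>\<nu>\<close> and the
  inverse of its character value for \<open>k\<close> it is \<open>geom_frob\<close>; with the
  lifted translation and \<open>k = 1\<close> it compares the cohomology of two sheaves.\<close>

definition pull ::
    "('f::field ffc \<Rightarrow> 'f ffc) \<Rightarrow> 'l \<Rightarrow> ('f, 'l::field) cochain \<Rightarrow> ('f, 'l) cochain" where
  "pull \<nu> k z = ((\<lambda>\<sigma>. k * fst z (\<nu> \<circ> \<sigma> \<circ> inv_into UNIV \<nu>)), (\<lambda>W. k * snd z (\<nu> ` W)))"

lemma geom_frob_eq_pull: "geom_frob \<rho> \<phi> z = pull \<phi> (inverse (\<rho> \<phi>)) z"
  by (simp add: geom_frob_def pull_def)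

lemma pull_pull:
  assumes "\<nu> \<in> field_auts" "\<mu> \<in> field_auts"
  shows "pull \<mu> j (pull \<nu> k z) = pull (\<nu> \<circ> \<mu>) (j * k) z"
proof -
  have "inv_into UNIV (\<nu> \<circ> \<mu>) = inv_into UNIV \<mu> \<circ> inv_into UNIV \<nu>"
    using assms by (simp add: o_inv_distrib field_auts_bij)
  then show ?thesis
    by (simp add: pull_def image_image comp_assoc mult.assoc)
qed

lemma pull_inv:
  assumes "\<nu> \<in> field_auts"
  shows "pull (inv_into UNIV \<nu>) 1 (pull \<nu> 1 z) = z"
proof -
  have "\<nu> \<circ> inv_into UNIV \<nu> = id"
    using field_auts_inv_apply[OF assms] by auto
  then show ?thesis
    using assms by (simp add: pull_pull field_auts_inv) (simp add: pull_def)
qed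

lemma pull_cochain_diff_scaled:
  "pull \<nu> j (cochain_diff_scaled z k z') = cochain_diff_scaled (pull \<nu> j z) k (pull \<nu> j z')"
  by (simp add: pull_def cochain_diff_scaled_def algebra_simps)

lemma H1c_coboundaries_diff_scaled:
  assumes "z \<in> H1c_coboundaries \<rho>" "z' \<in> H1c_coboundaries \<rho>"
  shows "cochain_diff_scaled z k z' \<in> H1c_coboundaries \<rho>"
proof -
  obtain n n' where
    n: "\<And>\<sigma>. \<sigma> \<in> geom_gal \<Longrightarrow> fst z \<sigma> = n - \<rho> \<sigma> * n" "\<And>W. W \<in> infinite_places \<Longrightarrow> snd z W = n"
    and n': "\<And>\<sigma>. \<sigma> \<in> geom_gal \<Longrightarrow> fst z' \<sigma> = n' - \<rho> \<sigma> * n'" "\<And>W. W \<in> infinite_places \<Longrightarrow> snd z' W = n'"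
    using assms by (auto simp: H1c_coboundaries_def)
  show ?thesis
    unfolding H1c_coboundaries_def cochain_diff_scaled_def
    by (auto simp: n n' algebra_simps intro!: exI[of _ "n - k * n'"])
qed

lemma H1c_coboundaries_diff_trans:
  assumes "cochain_diff_scaled x 1 y \<in> H1c_coboundaries \<rho>" "cochain_diff_scaled y k z \<in> H1c_coboundaries \<rho>"
  shows "cochain_diff_scaled x k z \<in> H1c_coboundaries \<rho>"
proof -
  have "cochain_diff_scaled x k z =
      cochain_diff_scaled (cochain_diff_scaled x 1 y) (- 1) (cochain_diff_scaled y k z)"
    by (simp add: cochain_diff_scaled_def)
  then show ?thesis
    using H1c_coboundaries_diff_scaled[OF assms] by simp
qed

lemma pull_H1c_coboundaries:
  assumes "\<nu> \<in> line_auts" and \<rho>': "\<And>\<sigma>. \<sigma> \<in> geom_gal \<Longrightarrow> \<rho>' \<sigma> = \<rho> (\<nu> \<circ> \<sigma> \<circ> inv_into UNIV \<nu>)"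
    and "z \<in> H1c_coboundaries \<rho>"
  shows "pull \<nu> k z \<in> H1c_coboundaries \<rho>'"
proof -
  obtain n where
    n: "\<And>\<sigma>. \<sigma> \<in> geom_gal \<Longrightarrow> fst z \<sigma> = n - \<rho> \<sigma> * n" "\<And>W. W \<in> infinite_places \<Longrightarrow> snd z W = n"
    using assms(3) by (auto simp: H1c_coboundaries_def)
  show ?thesis
    unfolding H1c_coboundaries_def pull_def
    by (auto simp: n geom_gal_conj[OF assms(1)] infinite_places_image[OF assms(1)] \<rho>' algebra_simps
        intro!: exI[of _ "k * n"])
qed

text \<open>The type class of \<open>'l\<close> does not relate the metric to the field operations.
  Translation invariance and multiplicativity, both from \<open>is_closure_of_Ql\<close>, make
  scaling Lipschitz with constant the absolute value of \<open>k\<close>.\<close>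

lemma continuous_scale:
  fixes k :: "'l::{field_char_0, alg_closed_field, metric_space}"
  assumes "is_closure_of_Ql l TYPE('l)"
  shows "continuous_map euclidean euclidean (\<lambda>x. k * x)"
proof -
  have translate: "dist (x + z) (y + z) = dist x y"
    and mult: "dist (x * y) 0 = dist x 0 * dist y (0::'l)" for x y z :: 'l
    using assms by (simp_all add: is_closure_of_Ql_def)
  have diff: "dist x y = dist (x - y) 0" for x y :: 'l
    using translate[of x "- y" y] by simp
  have "dist (k * x) (k * y) = dist k 0 * dist x y" for x y
    unfolding diff[of "k * x"] diff[of x] by (simp flip: right_diff_distrib add: mult)
  then have "(dist k 0)-lipschitz_on UNIV (\<lambda>x. k * x)"
    by (intro lipschitz_onI) simp_all
  then have "continuous_on UNIV (\<lambda>x. k * x)"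
    by (rule lipschitz_on_continuous_on)
  then show ?thesis
    by simp
qed

lemma pull_H1c_cocycles:
  fixes \<rho> :: "('f::field ffc \<Rightarrow> 'f ffc) \<Rightarrow> 'l::{field_char_0, alg_closed_field, metric_space}"
  assumes "is_closure_of_Ql l TYPE('l)"
    and \<nu>: "\<nu> \<in> line_auts" and \<rho>': "\<And>\<sigma>. \<sigma> \<in> geom_gal \<Longrightarrow> \<rho>' \<sigma> = \<rho> (\<nu> \<circ> \<sigma> \<circ> inv_into UNIV \<nu>)"
    and "k \<noteq> 0" and z: "z \<in> H1c_cocycles \<rho>"
  shows "pull \<nu> k z \<in> H1c_cocycles \<rho>'"
proof -
  obtain c m where cm: "z = (c, m)"
    by (cases z)
  have cont: "continuous_map krull_top euclidean c"
    and fin: "\<exists>B. finite B \<and> (\<forall>\<sigma>\<in>geom_gal. \<exists>k. (\<forall>b\<in>B. k b \<in> Ql) \<and> c \<sigma> = (\<Sum>b\<in>B. k b * b))"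
    and coc: "\<And>\<sigma> \<tau>. \<sigma> \<in> geom_gal \<Longrightarrow> \<tau> \<in> geom_gal \<Longrightarrow> c (\<sigma> \<circ> \<tau>) = c \<sigma> + \<rho> \<sigma> * c \<tau>"
    and inert: "\<And>W \<sigma>. W \<in> finite_places \<Longrightarrow> \<sigma> \<in> inertia W \<Longrightarrow> c \<sigma> = 0"
    and m: "\<And>W \<sigma>. W \<in> infinite_places \<Longrightarrow> \<sigma> \<in> geom_gal \<Longrightarrow> m (\<sigma> ` W) = c \<sigma> + \<rho> \<sigma> * m W"
    using z unfolding cm H1c_cocycles_def by auto
  let ?conj = "\<lambda>\<sigma>. \<nu> \<circ> \<sigma> \<circ> inv_into UNIV \<nu>"
  note inv = field_auts_inv_apply[OF line_auts_field_auts[OF \<nu>]]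
  have conj_comp: "?conj (\<sigma> \<circ> \<tau>) = ?conj \<sigma> \<circ> ?conj \<tau>" for \<sigma> \<tau>
    by (simp add: fun_eq_iff inv)
  have conj_image: "\<nu> ` \<sigma> ` W = ?conj \<sigma> ` \<nu> ` W" for \<sigma> W
    by (simp add: image_image inv)
  have "continuous_map krull_top euclidean (c \<circ> ?conj)"
    using continuous_map_compose[OF continuous_map_conj[OF \<nu>] cont] .
  then have "continuous_map krull_top euclidean (\<lambda>\<sigma>. k * c (?conj \<sigma>))"
    using continuous_map_compose[OF _ continuous_scale[OF assms(1)]] by (force simp: comp_def)
  moreover have "\<exists>B. finite B \<and>
      (\<forall>\<sigma>\<in>geom_gal. \<exists>j. (\<forall>b\<in>B. j b \<in> Ql) \<and> k * c (?conj \<sigma>) = (\<Sum>b\<in>B. j b * b))"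
  proof -
    obtain B where B: "finite B"
      "\<And>\<sigma>. \<sigma> \<in> geom_gal \<Longrightarrow> \<exists>k. (\<forall>b\<in>B. k b \<in> Ql) \<and> c \<sigma> = (\<Sum>b\<in>B. k b * b)"
      using fin by blast
    \<comment> \<open>Scaling the values by \<open>k\<close> scales the finite spanning set, while
      the coefficients remain the same elements of \<open>Ql\<close>.\<close>
    have "\<exists>j. (\<forall>b\<in>(*) k ` B. j b \<in> Ql) \<and> k * c (?conj \<sigma>) = (\<Sum>b\<in>(*) k ` B. j b * b)"
      if \<sigma>: "\<sigma> \<in> geom_gal" for \<sigma>
    proof -
      obtain j where j: "\<forall>b\<in>B. j b \<in> Ql" "c (?conj \<sigma>) = (\<Sum>b\<in>B. j b * b)"
        using B(2)[OF geom_gal_conj[OF \<nu> \<sigma>]] by blast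
      have "inj_on ((*) k) B"
        using \<open>k \<noteq> 0\<close> by (simp add: inj_on_def)
      then have "(\<Sum>b\<in>(*) k ` B. j (b / k) * b) = (\<Sum>b\<in>B. j b * (k * b))"
        using \<open>k \<noteq> 0\<close> by (simp add: sum.reindex)
      then have "k * c (?conj \<sigma>) = (\<Sum>b\<in>(*) k ` B. j (b / k) * b)"
        by (simp add: j(2) sum_distrib_left mult.left_commute)
      moreover have "\<forall>b\<in>(*) k ` B. j (b / k) \<in> Ql"
        using j(1) \<open>k \<noteq> 0\<close> by simp
      ultimately show ?thesis
        by (intro exI[of _ "\<lambda>b. j (b / k)"]) simp
    qed
    then show ?thesis
      using B(1) by blast
  qed
  moreover have "k * c (?conj (\<sigma> \<circ> \<tau>)) = k * c (?conj \<sigma>) + \<rho>' \<sigma> * (k * c (?conj \<tau>))"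
    if "\<sigma> \<in> geom_gal" "\<tau> \<in> geom_gal" for \<sigma> \<tau>
    unfolding conj_comp using that by (simp add: coc geom_gal_conj[OF \<nu>] \<rho>' algebra_simps)
  moreover have "k * c (?conj \<sigma>) = 0" if "W \<in> finite_places" "\<sigma> \<in> inertia W" for W \<sigma>
    using inert[OF finite_places_image[OF \<nu>] inertia_conj[OF \<nu>]] that by simp
  moreover have "k * m (\<nu> ` \<sigma> ` W) = k * c (?conj \<sigma>) + \<rho>' \<sigma> * (k * m (\<nu> ` W))"
    if "W \<in> infinite_places" "\<sigma> \<in> geom_gal" for W \<sigma>
    unfolding conj_image
    using m[OF infinite_places_image[OF \<nu> that(1)] geom_gal_conj[OF \<nu> that(2)]] that
    by (simp add: \<rho>' algebra_simps)
  ultimately show ?thesis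
    unfolding cm pull_def H1c_cocycles_def by simp
qed

text \<open>The character of the arithmetic Galois group attached to a smooth sheaf of rank one.\<close>

locale rank_one =
  fixes l q :: nat
    and \<rho> :: "('f::alg_closed_field ffc \<Rightarrow> 'f ffc) \<Rightarrow> 'l::{field_char_0, alg_closed_field, metric_space}"
  assumes Ql: "is_closure_of_Ql l TYPE('l)"
    and q: "q > 0"
    and \<rho>_nz: "\<sigma> \<in> arith_gal q \<Longrightarrow> \<rho> \<sigma> \<noteq> 0"
    and \<rho>_comp: "\<sigma> \<in> arith_gal q \<Longrightarrow> \<tau> \<in> arith_gal q \<Longrightarrow> \<rho> (\<sigma> \<circ> \<tau>) = \<rho> \<sigma> * \<rho> \<tau>"
begin

lemma \<rho>_conj:
  assumes "\<phi> \<in> arith_gal q" "\<sigma> \<in> arith_gal q"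
  shows "\<rho> (\<phi> \<circ> \<sigma> \<circ> inv_into UNIV \<phi>) = \<rho> \<sigma>"
proof -
  have "(\<phi> \<circ> \<sigma> \<circ> inv_into UNIV \<phi>) \<circ> \<phi> = \<phi> \<circ> \<sigma>"
    using assms field_auts_inv_apply(2)[of \<phi>] by (auto simp: arith_gal_def)
  moreover have "\<phi> \<circ> \<sigma> \<circ> inv_into UNIV \<phi> \<in> arith_gal q"
    using assms by (intro arith_gal_comp arith_gal_inv)
  ultimately have "\<rho> (\<phi> \<circ> \<sigma> \<circ> inv_into UNIV \<phi>) * \<rho> \<phi> = \<rho> \<phi> * \<rho> \<sigma>"
    using \<rho>_comp assms by metis
  then show ?thesis
    using \<rho>_nz[OF assms(1)] by simp
qed

lemma pull_arith_gal:
  assumes "\<phi> \<in> arith_gal q" "k \<noteq> 0"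
  shows "z \<in> H1c_cocycles \<rho> \<Longrightarrow> pull \<phi> k z \<in> H1c_cocycles \<rho>"
    and "z \<in> H1c_coboundaries \<rho> \<Longrightarrow> pull \<phi> k z \<in> H1c_coboundaries \<rho>"
  using assms
  by (auto intro!: pull_H1c_cocycles[OF Ql] pull_H1c_coboundaries arith_gal_line_auts
      simp: \<rho>_conj geom_gal_arith_gal)

text \<open>Inner automorphisms act trivially on group cohomology; the difference is the coboundary
  of \<open>inverse (\<rho> g) * fst z g\<close>. Hence the class of
  \<open>geom_frob \<rho> \<phi> z\<close> does not depend on the lift
  \<open>\<phi>\<close>.\<close>

lemma pull_geom_gal:
  assumes g: "g \<in> geom_gal" and z: "z \<in> H1c_cocycles \<rho>"
  shows "cochain_diff_scaled (pull g (inverse (\<rho> g)) z) 1 z \<in> H1c_coboundaries \<rho>"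
proof -
  have coc: "fst z (\<sigma> \<circ> \<tau>) = fst z \<sigma> + \<rho> \<sigma> * fst z \<tau>" if "\<sigma> \<in> geom_gal" "\<tau> \<in> geom_gal" for \<sigma> \<tau>
    using z that by (auto simp: H1c_cocycles_def)
  have m: "snd z (\<sigma> ` W) = fst z \<sigma> + \<rho> \<sigma> * snd z W" if "W \<in> infinite_places" "\<sigma> \<in> geom_gal" for W \<sigma>
    using z that by (auto simp: H1c_cocycles_def)
  let ?i = "inv_into UNIV g"
  have g_arith: "g \<in> arith_gal q" and i: "?i \<in> geom_gal"
    using g by (auto intro: geom_gal_arith_gal geom_gal_inv)
  have nz: "\<rho> g \<noteq> 0"
    by (rule \<rho>_nz[OF g_arith])
  have id: "g \<circ> ?i = id"
    using g field_auts_inv_apply(1)[of g] by (auto simp: geom_gal_def)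
  have id_geom: "(id :: 'f ffc \<Rightarrow> 'f ffc) \<in> geom_gal"
    using geom_gal_comp[OF g i] id by simp
  have "\<rho> g = \<rho> g * \<rho> id"
    using \<rho>_comp[OF g_arith geom_gal_arith_gal[OF id_geom]] by simp
  then have "fst z id = 0"
    using coc[OF id_geom id_geom] nz by simp
  then have ci: "\<rho> g * fst z ?i = - fst z g"
    using coc[OF g i] id by (simp add: eq_neg_iff_add_eq_0 add.commute)
  define n where "n = inverse (\<rho> g) * fst z g"
  have "inverse (\<rho> g) * fst z (g \<circ> \<sigma> \<circ> ?i) - 1 * fst z \<sigma> = n - \<rho> \<sigma> * n" if \<sigma>: "\<sigma> \<in> geom_gal" for \<sigma>
  proof -
    have "fst z (g \<circ> \<sigma> \<circ> ?i) = fst z g + \<rho> g * (fst z \<sigma> + \<rho> \<sigma> * fst z ?i)"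
      using coc[OF g geom_gal_comp[OF \<sigma> i]] coc[OF \<sigma> i] by (simp add: comp_assoc)
    also have "\<dots> = fst z g + \<rho> g * fst z \<sigma> + \<rho> \<sigma> * (\<rho> g * fst z ?i)"
      by (simp add: algebra_simps)
    also have "\<dots> = fst z g + \<rho> g * fst z \<sigma> - \<rho> \<sigma> * fst z g"
      by (simp add: ci)
    finally show ?thesis
      using nz by (simp add: n_def field_simps)
  qed
  moreover have "inverse (\<rho> g) * snd z (g ` W) - 1 * snd z W = n" if "W \<in> infinite_places" for W
    using m[OF that g] nz by (simp add: n_def field_simps)
  ultimately show ?thesis
    unfolding H1c_coboundaries_def pull_def cochain_diff_scaled_def by auto
qed

text \<open>On a one-dimensional space Frobenius is a scalar, and by \<open>pull_geom_gal\<close> it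
  is the same scalar for every lift. This gives meaning to the definite description in
  \<open>frob_eigenvalue\<close>.\<close>

lemma ex1_frob_eigenvalue:
  assumes dim: "H1c_one_dimensional \<rho>" and ne: "arith_frob_lifts q \<noteq> ({} :: ('f ffc \<Rightarrow> 'f ffc) set)"
  shows "\<exists>!\<mu>. is_frob_eigenvalue q \<rho> \<mu>"
proof -
  let ?Z = "H1c_cocycles \<rho>" and ?B = "H1c_coboundaries \<rho>"
  obtain z where z: "z \<in> ?Z" "z \<notin> ?B"
    and gen: "\<And>z'. z' \<in> ?Z \<Longrightarrow> \<exists>k. cochain_diff_scaled z' k z \<in> ?B"
    using dim by (auto simp: H1c_one_dimensional_def)
  obtain \<phi>0 :: "'f ffc \<Rightarrow> 'f ffc" where \<phi>0: "\<phi>0 \<in> arith_frob_lifts q"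
    using ne by blast
  have arith: "\<phi> \<in> arith_gal q" if "\<phi> \<in> arith_frob_lifts q" for \<phi> :: "'f ffc \<Rightarrow> 'f ffc"
    using arith_frob_lifts_arith_gal that q by blast
  have frob_Z: "geom_frob \<rho> \<phi> w \<in> ?Z" if "w \<in> ?Z" "\<phi> \<in> arith_frob_lifts q" for w \<phi>
    unfolding geom_frob_eq_pull using that arith \<rho>_nz by (intro pull_arith_gal) auto
  obtain \<mu> where \<mu>: "cochain_diff_scaled (geom_frob \<rho> \<phi>0 z) \<mu> z \<in> ?B"
    using gen[OF frob_Z[OF z(1) \<phi>0]] by blast
  have all: "cochain_diff_scaled (geom_frob \<rho> \<phi> z) \<mu> z \<in> ?B" if \<phi>: "\<phi> \<in> arith_frob_lifts q" for \<phi>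
  proof -
    define g where "g = inv_into UNIV \<phi>0 \<circ> \<phi>"
    have g: "g \<in> geom_gal"
      unfolding g_def by (rule arith_frob_lifts_diff[OF \<phi>0 \<phi>])
    have aut: "\<phi>0 \<in> field_auts" "g \<in> field_auts"
      using \<phi>0 g by (simp_all add: arith_frob_lifts_def geom_gal_def)
    have \<phi>_eq: "\<phi> = \<phi>0 \<circ> g"
      using field_auts_inv_apply(1)[OF aut(1)] by (auto simp: g_def)
    have "geom_frob \<rho> \<phi> z = pull g (inverse (\<rho> g)) (geom_frob \<rho> \<phi>0 z)"
      using \<rho>_comp[OF arith[OF \<phi>0] geom_gal_arith_gal[OF g]]
      by (simp add: geom_frob_eq_pull pull_pull aut \<phi>_eq mult.commute)
    then have "cochain_diff_scaled (geom_frob \<rho> \<phi> z) 1 (geom_frob \<rho> \<phi>0 z) \<in> ?B"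
      using pull_geom_gal[OF g frob_Z[OF z(1) \<phi>0]] by simp
    then show ?thesis
      using \<mu> by (rule H1c_coboundaries_diff_trans)
  qed
  show ?thesis
  proof (rule ex1I)
    show "is_frob_eigenvalue q \<rho> \<mu>"
      using z all unfolding is_frob_eigenvalue_def by blast
  next
    fix \<mu>' assume "is_frob_eigenvalue q \<rho> \<mu>'"
    then obtain z' where z': "z' \<in> ?Z" "z' \<notin> ?B"
      and \<mu>': "cochain_diff_scaled (geom_frob \<rho> \<phi>0 z') \<mu>' z' \<in> ?B"
      using \<phi>0 by (auto simp: is_frob_eigenvalue_def)
    obtain k where k: "cochain_diff_scaled z' k z \<in> ?B"
      using gen z'(1) by blast
    have "cochain_diff_scaled (geom_frob \<rho> \<phi>0 z') k (geom_frob \<rho> \<phi>0 z) \<in> ?B"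
      unfolding geom_frob_eq_pull pull_cochain_diff_scaled[symmetric]
      using k arith[OF \<phi>0] \<rho>_nz by (intro pull_arith_gal) auto
    note rel = k \<mu> \<mu>' this
    \<comment> \<open>Modulo coboundaries, Frobenius multiplies \<open>z\<close> by
      \<open>\<mu>\<close> and \<open>z'\<close> by \<open>\<mu>'\<close>, and \<open>z'\<close> is
      \<open>k\<close> times \<open>z\<close>. The combination of \<open>x1\<close> to
      \<open>x4\<close> below collects these relations into \<open>d\<close> times \<open>z\<close>,
      so \<open>d\<close> must vanish.\<close>
    define d where "d = k * (\<mu>' - \<mu>)"
    define x1 where "x1 = cochain_diff_scaled (geom_frob \<rho> \<phi>0 z') k (geom_frob \<rho> \<phi>0 z)"
    define x2 where "x2 = cochain_diff_scaled (geom_frob \<rho> \<phi>0 z') \<mu>' z'"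
    define x3 where "x3 = cochain_diff_scaled z' k z"
    define x4 where "x4 = cochain_diff_scaled (geom_frob \<rho> \<phi>0 z) \<mu> z"
    have x: "cochain_diff_scaled (cochain_diff_scaled (cochain_diff_scaled x1 1 x2) \<mu>' x3) (- k) x4 =
        ((\<lambda>\<sigma>. d * fst z \<sigma>), (\<lambda>W. d * snd z W))"
      unfolding x1_def x2_def x3_def x4_def d_def cochain_diff_scaled_def by (simp add: algebra_simps)
    have "cochain_diff_scaled (cochain_diff_scaled (cochain_diff_scaled x1 1 x2) \<mu>' x3) (- k) x4 \<in> ?B"
      by (intro H1c_coboundaries_diff_scaled) (use rel in \<open>simp_all add: x1_def x2_def x3_def x4_def\<close>)
    then have dz: "((\<lambda>\<sigma>. d * fst z \<sigma>), (\<lambda>W. d * snd z W)) \<in> ?B"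
      unfolding x .
    have "d = 0"
    proof (rule ccontr)
      assume "d \<noteq> 0"
      have zero: "((\<lambda>_. 0), (\<lambda>_. 0)) \<in> ?B"
        by (auto simp: H1c_coboundaries_def intro!: exI[of _ 0])
      have "cochain_diff_scaled ((\<lambda>_. 0), (\<lambda>_. 0)) (- inverse d) ((\<lambda>\<sigma>. d * fst z \<sigma>), (\<lambda>W. d * snd z W)) = z"
        using \<open>d \<noteq> 0\<close> by (simp add: cochain_diff_scaled_def flip: mult.assoc)
      with H1c_coboundaries_diff_scaled[OF zero dz] have "z \<in> ?B"
        by metis
      with z(2) show False ..
    qed
    moreover have "k \<noteq> 0"
    proof
      assume "k = 0"
      then have "cochain_diff_scaled z' k z = z'"
        by (simp add: cochain_diff_scaled_def)
      with k z'(2) show False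
        by simp
    qed
    ultimately show "\<mu>' = \<mu>"
      by (simp add: d_def)
  qed
qed

end

text \<open>\<open>\<Theta>\<close> covers an automorphism of the line that matches the two sheaves
  geometrically; on lifts of Frobenius their characters differ by \<open>\<kappa>\<close>, the
  contribution of a constant sheaf. The conditions \<open>lifts\<close> and \<open>lifts_inv\<close>
  express that the automorphism is defined over the field of order \<open>q\<close>.\<close>

locale rank_one_transport = r: rank_one l q \<rho> + r': rank_one l q \<rho>'
  for l q :: nat
    and \<rho> \<rho>' :: "('f::alg_closed_field ffc \<Rightarrow> 'f ffc) \<Rightarrow> 'l::{field_char_0, alg_closed_field, metric_space}" +
  fixes \<Theta> :: "'f ffc \<Rightarrow> 'f ffc" and \<kappa> :: 'l
  assumes \<Theta>: "\<Theta> \<in> line_auts"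
    and geom: "\<sigma> \<in> geom_gal \<Longrightarrow> \<rho>' \<sigma> = \<rho> (\<Theta> \<circ> \<sigma> \<circ> inv_into UNIV \<Theta>)"
    and frob: "\<phi> \<in> arith_frob_lifts q \<Longrightarrow> \<rho> (\<Theta> \<circ> \<phi> \<circ> inv_into UNIV \<Theta>) = \<kappa> * \<rho>' \<phi>"
    and lifts: "\<phi> \<in> arith_frob_lifts q \<Longrightarrow> \<Theta> \<circ> \<phi> \<circ> inv_into UNIV \<Theta> \<in> arith_frob_lifts q"
    and lifts_inv: "\<phi> \<in> arith_frob_lifts q \<Longrightarrow> inv_into UNIV \<Theta> \<circ> \<phi> \<circ> \<Theta> \<in> arith_frob_lifts q"
    and \<kappa>: "\<kappa> \<noteq> 0"
begin

lemma \<Theta>_aut: "\<Theta> \<in> field_auts"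
  by (rule line_auts_field_auts[OF \<Theta>])

lemma inv_inv_\<Theta>: "inv_into UNIV (inv_into UNIV \<Theta>) = \<Theta>"
  by (simp add: inv_inv_eq field_auts_bij \<Theta>_aut)

lemma conj_inv: "\<Theta> \<circ> (inv_into UNIV \<Theta> \<circ> \<sigma> \<circ> \<Theta>) \<circ> inv_into UNIV \<Theta> = \<sigma>"
  by (simp add: fun_eq_iff field_auts_inv_apply[OF \<Theta>_aut])

text \<open>Makes the situation symmetric, so that each transfer statement has to be shown in one
  direction only.\<close>

lemma inverse_transport: "rank_one_transport l q \<rho>' \<rho> (inv_into UNIV \<Theta>) (inverse \<kappa>)"
proof
  show "inv_into UNIV \<Theta> \<in> line_auts"
    by (rule line_auts_inv[OF \<Theta>])
  show "inverse \<kappa> \<noteq> 0"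
    using \<kappa> by simp
next
  fix \<sigma> :: "'f ffc \<Rightarrow> 'f ffc" assume "\<sigma> \<in> geom_gal"
  then have "inv_into UNIV \<Theta> \<circ> \<sigma> \<circ> \<Theta> \<in> geom_gal"
    using geom_gal_conj[OF line_auts_inv[OF \<Theta>]] by (simp add: inv_inv_\<Theta>)
  from geom[OF this] show "\<rho> \<sigma> = \<rho>' (inv_into UNIV \<Theta> \<circ> \<sigma> \<circ> inv_into UNIV (inv_into UNIV \<Theta>))"
    by (simp add: conj_inv inv_inv_\<Theta>)
next
  fix \<phi> :: "'f ffc \<Rightarrow> 'f ffc" assume \<phi>: "\<phi> \<in> arith_frob_lifts q"
  show "\<rho>' (inv_into UNIV \<Theta> \<circ> \<phi> \<circ> inv_into UNIV (inv_into UNIV \<Theta>)) = inverse \<kappa> * \<rho> \<phi>"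
    using frob[OF lifts_inv[OF \<phi>]] \<kappa> by (simp add: conj_inv inv_inv_\<Theta>)
  show "inv_into UNIV \<Theta> \<circ> \<phi> \<circ> inv_into UNIV (inv_into UNIV \<Theta>) \<in> arith_frob_lifts q"
    using lifts_inv[OF \<phi>] by (simp add: inv_inv_\<Theta>)
  show "inv_into UNIV (inv_into UNIV \<Theta>) \<circ> \<phi> \<circ> inv_into UNIV \<Theta> \<in> arith_frob_lifts q"
    using lifts[OF \<phi>] by (simp add: inv_inv_\<Theta>)
qed

lemma pull_transport:
  "z \<in> H1c_cocycles \<rho> \<Longrightarrow> pull \<Theta> 1 z \<in> H1c_cocycles \<rho>'"
  "z \<in> H1c_coboundaries \<rho> \<Longrightarrow> pull \<Theta> k z \<in> H1c_coboundaries \<rho>'"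
  by (auto intro!: pull_H1c_cocycles[OF r.Ql \<Theta>] pull_H1c_coboundaries[OF \<Theta>] geom)

lemma pull_transport_iff: "pull \<Theta> 1 z \<in> H1c_coboundaries \<rho>' \<longleftrightarrow> z \<in> H1c_coboundaries \<rho>"
  using pull_transport(2)[of z 1]
    rank_one_transport.pull_transport(2)[OF inverse_transport, of "pull \<Theta> 1 z" 1]
  by (auto simp: pull_inv[OF \<Theta>_aut])

lemma H1c_one_dimensional_transport:
  assumes "H1c_one_dimensional \<rho>"
  shows "H1c_one_dimensional \<rho>'"
proof -
  obtain z where z: "z \<in> H1c_cocycles \<rho>" "z \<notin> H1c_coboundaries \<rho>"
    and gen: "\<And>z'. z' \<in> H1c_cocycles \<rho> \<Longrightarrow> \<exists>k. cochain_diff_scaled z' k z \<in> H1c_coboundaries \<rho>"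
    using assms by (auto simp: H1c_one_dimensional_def)
  have "\<exists>k. cochain_diff_scaled z' k (pull \<Theta> 1 z) \<in> H1c_coboundaries \<rho>'"
    if z': "z' \<in> H1c_cocycles \<rho>'" for z'
  proof -
    obtain k where "cochain_diff_scaled (pull (inv_into UNIV \<Theta>) 1 z') k z \<in> H1c_coboundaries \<rho>"
      using gen rank_one_transport.pull_transport(1)[OF inverse_transport z'] by blast
    then have "pull \<Theta> 1 (cochain_diff_scaled (pull (inv_into UNIV \<Theta>) 1 z') k z) \<in> H1c_coboundaries \<rho>'"
      by (rule pull_transport(2))
    moreover have "pull \<Theta> 1 (pull (inv_into UNIV \<Theta>) 1 z') = z'"
      using pull_inv[OF field_auts_inv[OF \<Theta>_aut]] by (simp add: inv_inv_\<Theta>)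
    ultimately show ?thesis
      by (auto simp: pull_cochain_diff_scaled)
  qed
  moreover have "pull \<Theta> 1 z \<in> H1c_cocycles \<rho>' - H1c_coboundaries \<rho>'"
    using pull_transport(1)[OF z(1)] z(2) by (simp add: pull_transport_iff)
  ultimately show ?thesis
    unfolding H1c_one_dimensional_def by blast
qed

lemma is_frob_eigenvalue_transport:
  assumes "is_frob_eigenvalue q \<rho> \<mu>"
  shows "is_frob_eigenvalue q \<rho>' (\<kappa> * \<mu>)"
  unfolding is_frob_eigenvalue_def
proof
  fix \<phi> :: "'f ffc \<Rightarrow> 'f ffc" assume \<phi>: "\<phi> \<in> arith_frob_lifts q"
  let ?\<phi> = "\<Theta> \<circ> \<phi> \<circ> inv_into UNIV \<Theta>"
  have aut: "\<phi> \<in> field_auts" "?\<phi> \<in> field_auts"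
    using \<phi> lifts[OF \<phi>] by (simp_all add: arith_frob_lifts_def)
  have nz: "\<rho>' \<phi> \<noteq> 0"
    using r'.\<rho>_nz arith_frob_lifts_arith_gal[OF \<phi> r.q] by blast
  obtain z where z: "z \<in> H1c_cocycles \<rho>" "z \<notin> H1c_coboundaries \<rho>"
    and \<mu>: "cochain_diff_scaled (geom_frob \<rho> ?\<phi> z) \<mu> z \<in> H1c_coboundaries \<rho>"
    using assms lifts[OF \<phi>] unfolding is_frob_eigenvalue_def by blast
  \<comment> \<open>Pulling back along \<open>\<Theta>\<close> intertwines a lift with its
    conjugate, which is again a lift. The character values in the two Frobenius actions then account
    for \<open>\<kappa>\<close>.\<close>
  have "\<Theta> \<circ> \<phi> = ?\<phi> \<circ> \<Theta>"
    by (simp add: fun_eq_iff field_auts_inv_apply[OF \<Theta>_aut])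
  moreover have "inverse (\<rho>' \<phi>) = \<kappa> * inverse (\<rho> ?\<phi>)"
    using frob[OF \<phi>] \<kappa> nz by (simp add: field_simps)
  ultimately have "geom_frob \<rho>' \<phi> (pull \<Theta> 1 z) = pull \<Theta> \<kappa> (geom_frob \<rho> ?\<phi> z)"
    using aut \<Theta>_aut by (simp add: geom_frob_eq_pull pull_pull)
  then have "cochain_diff_scaled (geom_frob \<rho>' \<phi> (pull \<Theta> 1 z)) (\<kappa> * \<mu>) (pull \<Theta> 1 z) =
      pull \<Theta> \<kappa> (cochain_diff_scaled (geom_frob \<rho> ?\<phi> z) \<mu> z)"
    by (simp add: pull_cochain_diff_scaled) (simp add: pull_def cochain_diff_scaled_def mult_ac)
  then have "cochain_diff_scaled (geom_frob \<rho>' \<phi> (pull \<Theta> 1 z)) (\<kappa> * \<mu>) (pull \<Theta> 1 z) \<in> H1c_coboundaries \<rho>'"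
    using pull_transport(2)[OF \<mu>] by simp
  moreover have "pull \<Theta> 1 z \<in> H1c_cocycles \<rho>' - H1c_coboundaries \<rho>'"
    using pull_transport(1)[OF z(1)] z(2) by (simp add: pull_transport_iff)
  ultimately show "\<exists>z\<in>H1c_cocycles \<rho>' - H1c_coboundaries \<rho>'.
      cochain_diff_scaled (geom_frob \<rho>' \<phi> z) (\<kappa> * \<mu>) z \<in> H1c_coboundaries \<rho>'"
    by blast
qed

theorem frob_eigenvalue_transport:
  assumes "arith_frob_lifts q \<noteq> ({} :: ('f ffc \<Rightarrow> 'f ffc) set)"
  shows "frob_eigenvalue q \<rho>' = \<kappa> * frob_eigenvalue q \<rho>"
proof (cases "H1c_one_dimensional \<rho>")
  case True
  then have True': "H1c_one_dimensional \<rho>'"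
    by (rule H1c_one_dimensional_transport)
  have "is_frob_eigenvalue q \<rho> (THE \<mu>. is_frob_eigenvalue q \<rho> \<mu>)"
    using r.ex1_frob_eigenvalue[OF True assms] by (rule theI')
  then have "is_frob_eigenvalue q \<rho>' (\<kappa> * (THE \<mu>. is_frob_eigenvalue q \<rho> \<mu>))"
    by (rule is_frob_eigenvalue_transport)
  then have "(THE \<mu>. is_frob_eigenvalue q \<rho>' \<mu>) = \<kappa> * (THE \<mu>. is_frob_eigenvalue q \<rho> \<mu>)"
    using r'.ex1_frob_eigenvalue[OF True' assms] by (simp add: the1_equality)
  then show ?thesis
    using True True' by (simp add: frob_eigenvalue_def)
next
  \<comment> \<open>Neither cohomology is one-dimensional, by \<open>inverse_transport\<close>, and
    both eigenvalues take the default value 0.\<close>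
  case False
  then have "\<not> H1c_one_dimensional \<rho>'"
    using rank_one_transport.H1c_one_dimensional_transport[OF inverse_transport] by blast
  with False show ?thesis
    by (simp add: frob_eigenvalue_def)
qed

end


section \<open>Fields of characteristic two\<close>

text \<open>As rewrite rules these remove all signs and cancel equal summands once sums are sorted,
  so that identities in characteristic two fall to \<open>algebra_simps\<close>.\<close>

lemma two_eq_0_simps:
  fixes x y :: "'a::comm_ring_1"
  assumes "CHAR('a) = 2"
  shows "x + x = 0" "x + (x + y) = y" "- x = x" "x - y = x + y" "(2::'a) = 0"
proof -
  have "of_nat CHAR('a) = (0 :: 'a)"
    by (rule of_nat_CHAR)
  then show two: "(2::'a) = 0"
    by (simp add: assms)
  have self: "z + z = 0" for z :: 'a
    using two by (metis mult_2 mult_zero_left)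
  show "x + x = 0" "x + (x + y) = y"
    by (simp_all add: self flip: add.assoc)
  show minus: "- x = x" for x :: 'a
    using self[of x] by (simp add: eq_neg_iff_add_eq_0 minus_equation_iff)
  show "x - y = x + y"
    using minus[of y] by (simp only: diff_conv_add_uminus)
qed

lemma artin_schreier_solution:
  fixes c :: "'a::alg_closed_field"
  assumes "k \<ge> 2"
  shows "\<exists>x. x ^ k + x = c"
proof -
  let ?P = "Polynomial.monom 1 k + [:- c, 1:]"
  have "Polynomial.degree ?P = k"
    using assms by (subst degree_add_eq_left) (simp_all add: degree_monom_eq)
  then obtain x where "poly ?P x = 0"
    using alg_closed_imp_poly_has_root[of ?P] assms by auto
  then have "x ^ k + x = c"
    by (simp add: poly_monom algebra_simps eq_neg_iff_add_eq_0 add_eq_0_iff)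
  then show ?thesis
    by blast
qed

text \<open>The closure rules below certify that a function is polynomial without exhibiting the
  polynomial, as is wanted for \<open>heis_f\<close> in its left argument.\<close>

definition poly_fun :: "('a::comm_ring_1 \<Rightarrow> 'a) \<Rightarrow> bool" where
  "poly_fun f \<longleftrightarrow> (\<exists>Q. \<forall>x. f x = poly Q x)"

lemma poly_fun_poly: "poly_fun (poly Q)"
  by (auto simp: poly_fun_def)

lemma poly_fun_const: "poly_fun (\<lambda>_. c)"
  using poly_fun_poly[of "[:c:]"] by (simp add: poly_fun_def)

lemma poly_fun_id: "poly_fun (\<lambda>x. x)"
  using poly_fun_poly[of "[:0, 1:]"] by (simp add: poly_fun_def)

lemma poly_fun_add: "poly_fun f \<Longrightarrow> poly_fun g \<Longrightarrow> poly_fun (\<lambda>x. f x + g x)"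
  unfolding poly_fun_def by (metis poly_add)

lemma poly_fun_minus: "poly_fun f \<Longrightarrow> poly_fun (\<lambda>x. - f x)"
  unfolding poly_fun_def by (metis poly_minus)

lemma poly_fun_mult: "poly_fun f \<Longrightarrow> poly_fun g \<Longrightarrow> poly_fun (\<lambda>x. f x * g x)"
  unfolding poly_fun_def by (metis poly_mult)

lemma poly_fun_power: "poly_fun f \<Longrightarrow> poly_fun (\<lambda>x. f x ^ k)"
  by (induction k) (simp_all add: poly_fun_const poly_fun_mult)

lemma poly_fun_sum: "(\<And>i. i \<in> S \<Longrightarrow> poly_fun (f i)) \<Longrightarrow> poly_fun (\<lambda>x. \<Sum>i\<in>S. f i x)"
  by (induction S rule: infinite_finite_induct) (simp_all add: poly_fun_const poly_fun_add)

lemma poly_fun_comp: "poly_fun g \<Longrightarrow> poly_fun (\<lambda>x. poly Q (g x))"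
  by (metis poly_fun_def poly_pcompose)

lemma poly_fun_heis_f: "poly_fun (\<lambda>x. heis_f p e R x a)"
  unfolding heis_f_def
  by (intro poly_fun_minus poly_fun_sum poly_fun_add poly_fun_power poly_fun_mult poly_fun_const
      poly_fun_id)

text \<open>Unlike \<open>linearized\<close>, this prescribes no field of coefficients and so passes
  along \<open>map_poly cst\<close>.\<close>

definition additive_poly :: "nat \<Rightarrow> 'a::zero poly \<Rightarrow> bool" where
  "additive_poly p R \<longleftrightarrow> (\<forall>k. Polynomial.coeff R k \<noteq> 0 \<longrightarrow> (\<exists>i. k = p ^ i))"

lemma linearized_additive_poly: "linearized p q R \<Longrightarrow> additive_poly p R"
  by (simp add: linearized_def additive_poly_def)

text \<open>The type argument allows two instances, one for the constants and one for the closure of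
  the function field.\<close>

locale char_two =
  fixes ty :: "'a::field itself" and n p :: nat
  assumes char: "CHAR('a) = 2" and n: "n \<ge> 1" and p: "p = 2 ^ n"
begin

lemmas char2 = two_eq_0_simps[where 'a = 'a, OF char]

lemma p2: "p \<ge> 2"
proof -
  have "(2::nat) ^ 1 \<le> 2 ^ n"
    using n by (intro power_increasing) auto
  then show ?thesis
    by (simp add: p)
qed

lemma add_pow2: "((x::'a) + y) ^ (2 ^ k) = x ^ (2 ^ k) + y ^ (2 ^ k)"
  by (rule freshmans_dream') (simp_all add: char)

lemma add_pow: "((x::'a) + y) ^ (p ^ k) = x ^ (p ^ k) + y ^ (p ^ k)"
  by (simp add: p add_pow2 flip: power_mult)

lemma add_pow_p: "((x::'a) + y) ^ p = x ^ p + y ^ p"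
  using add_pow[of x y 1] by simp

lemma sum_pow: "(\<Sum>i\<in>S. f i) ^ (p ^ k) = (\<Sum>i\<in>S. f i ^ (p ^ k) :: 'a)"
  by (rule freshmans_dream_sum'[where n = "n * k"]) (simp_all add: char p flip: power_mult)

lemma sum_pow_p: "(\<Sum>i\<in>S. f i) ^ p = (\<Sum>i\<in>S. f i ^ p :: 'a)"
  using sum_pow[of f S 1] by simp

lemma ring_map_pow2: "ring_map (\<lambda>x::'a. x ^ (2 ^ k))"
  by standard (simp_all add: add_pow2 power_mult_distrib)

lemma ring_map_pow: "ring_map (\<lambda>x::'a. x ^ (p ^ k))"
  by standard (simp_all add: add_pow power_mult_distrib)

lemma poly_additive:
  fixes R :: "'a poly"
  assumes "additive_poly p R"
  shows "poly R (x + y) = poly R x + poly R y"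
proof -
  have "Polynomial.coeff R k * (x + y) ^ k = Polynomial.coeff R k * x ^ k + Polynomial.coeff R k * y ^ k" for k
  proof (cases "Polynomial.coeff R k = 0")
    case False
    then obtain i where "k = p ^ i"
      using assms by (auto simp: additive_poly_def)
    then show ?thesis
      by (simp add: add_pow algebra_simps)
  qed simp
  then show ?thesis
    by (simp add: poly_altdef sum.distrib)
qed

lemma poly_additive_0:
  fixes R :: "'a poly"
  assumes "additive_poly p R"
  shows "poly R 0 = 0"
  using poly_additive[OF assms, of 0 0] by (simp add: char2)

lemma poly_additive_altdef:
  fixes R :: "'a poly"
  assumes "additive_poly p R" "Polynomial.degree R \<le> p ^ e"
  shows "poly R x = (\<Sum>i\<le>e. Polynomial.coeff R (p ^ i) * x ^ (p ^ i))"
proof -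
  have "R = (\<Sum>i\<le>e. Polynomial.monom (Polynomial.coeff R (p ^ i)) (p ^ i))"
  proof (rule poly_eqI)
    fix k
    have inj: "p ^ i = p ^ j \<longleftrightarrow> i = j" for i j
      using p2 by simp
    show "Polynomial.coeff R k =
        Polynomial.coeff (\<Sum>i\<le>e. Polynomial.monom (Polynomial.coeff R (p ^ i)) (p ^ i)) k"
    proof (cases "\<exists>i\<le>e. k = p ^ i")
      case True
      then show ?thesis
        by (auto simp: coeff_sum inj sum.delta')
    next
      case False
      have "Polynomial.coeff R k = 0"
      proof (rule ccontr)
        assume nz: "Polynomial.coeff R k \<noteq> 0"
        then obtain i where i: "k = p ^ i"
          using assms(1) by (auto simp: additive_poly_def)
        have "p ^ i \<le> p ^ e"
          using le_degree[OF nz] assms(2) i by simp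
        then have "i \<le> e"
          using p2 by simp
        with False i show False
          by blast
      qed
      then show ?thesis
        using False by (simp add: coeff_sum) (auto intro!: sum.neutral)
    qed
  qed
  then have "poly R x = poly (\<Sum>i\<le>e. Polynomial.monom (Polynomial.coeff R (p ^ i)) (p ^ i)) x"
    by simp
  then show ?thesis
    by (simp add: poly_sum poly_monom)
qed

text \<open>The signs of a telescoping sum vanish in characteristic two. Such sums are explicit
  Artin-Schreier roots: those in \<open>heis_f\<close>, and later the traces in
  \<open>sheaf_char_witt\<close>.\<close>

lemma telescope: "(\<Sum>j<k. u ^ (p ^ j)) ^ p + (\<Sum>j<k. u ^ (p ^ j)) = u ^ (p ^ k) + (u::'a)"
proof (induction k)
  case 0
  then show ?case
    using p2 by (simp add: char2)
next
  case (Suc k)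
  have "(\<Sum>j<Suc k. u ^ (p ^ j)) ^ p + (\<Sum>j<Suc k. u ^ (p ^ j)) =
      ((\<Sum>j<k. u ^ (p ^ j)) ^ p + (\<Sum>j<k. u ^ (p ^ j))) + u ^ (p ^ Suc k) + u ^ (p ^ k)"
    by (simp add: add_pow_p algebra_simps flip: power_mult)
  then show ?case
    by (simp only: Suc) (simp add: char2 algebra_simps)
qed

lemma heis_f_eq:
  fixes x y :: 'a
  shows "heis_f p e R x y =
    (\<Sum>i<e. \<Sum>j<e - i. (Polynomial.coeff R (p ^ i) * x ^ (p ^ i) * y) ^ (p ^ j)) +
    (\<Sum>i<e. (x * poly R y) ^ (p ^ i))"
proof -
  \<comment> \<open>The truncated subtraction is harmless because \<open>i < e\<close>.\<close>
  have "{..e - i - 1} = {..<e - i}" if "i < e" for i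
    using that by auto
  then show ?thesis
    by (simp add: heis_f_def char2 sum.distrib)
qed

lemma heis_f_add_left:
  "heis_f p e R (x + x') y = heis_f p e R x y + heis_f p e R x' (y::'a)"
  by (simp add: heis_f_eq add_pow algebra_simps sum.distrib)

lemma heis_f_zero_left: "heis_f p e R 0 (y::'a) = 0"
  using heis_f_add_left[of e R 0 0 y] by (simp add: char2)

lemma heis_V_add:
  assumes "additive_poly p R" "x \<in> heis_V p e R" "(y::'a) \<in> heis_V p e R"
  shows "x + y \<in> heis_V p e R"
proof -
  define E where "E x = poly R x ^ (p ^ e) + (\<Sum>i\<le>e. (Polynomial.coeff R (p ^ i) * x) ^ (p ^ (e - i)))" for x
  have "E (x + y) = E x + E y"
    by (simp add: E_def poly_additive[OF assms(1)] add_pow algebra_simps sum.distrib)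
  then show ?thesis
    using assms(2,3) by (simp add: heis_V_def flip: E_def)
qed

text \<open>All inner sums telescope. The top powers combine to \<open>x ^ (p ^ e)\<close> times the
  defining polynomial of \<open>heis_V\<close> at \<open>y\<close>, which is 0, and the bottom
  powers give the right-hand side. This equation keeps the group action on the curve.\<close>

lemma heis_f_frob:
  fixes x y :: 'a
  assumes R: "additive_poly p R" "Polynomial.degree R \<le> p ^ e" and y: "y \<in> heis_V p e R"
  shows "heis_f p e R x y ^ p + heis_f p e R x y = x * poly R y + y * poly R x"
proof -
  define u where "u i = Polynomial.coeff R (p ^ i) * x ^ (p ^ i) * y" for i
  define w where "w = x * poly R y"
  define s where "s = (\<Sum>i\<le>e. (Polynomial.coeff R (p ^ i) * y) ^ (p ^ (e - i)))"
  define T where "T u k = (\<Sum>j<k. u ^ (p ^ j))" for u :: 'a and k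
  have T: "T u k ^ p + T u k = u ^ (p ^ k) + u" for u k
    unfolding T_def by (rule telescope)
  have "heis_f p e R x y ^ p + heis_f p e R x y =
      (\<Sum>i<e. T (u i) (e - i) ^ p + T (u i) (e - i)) + (T w e ^ p + T w e)"
    by (simp add: heis_f_eq add_pow_p sum_pow_p sum.distrib flip: u_def w_def T_def)
  also have "\<dots> = (\<Sum>i<e. u i ^ (p ^ (e - i))) + (\<Sum>i<e. u i) + (w ^ (p ^ e) + w)"
    by (simp add: T sum.distrib)
  \<comment> \<open>The missing term of index \<open>e\<close> is added here and again in the next
    sum; the two copies cancel.\<close>
  also have "(\<Sum>i<e. u i) = y * poly R x + u e"
    by (simp add: poly_additive_altdef[OF R] u_def char2 sum_distrib_left algebra_simps
        flip: lessThan_Suc_atMost)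
  also have "(\<Sum>i<e. u i ^ (p ^ (e - i))) = x ^ (p ^ e) * s + u e"
  proof -
    define v where "v i = (Polynomial.coeff R (p ^ i) * y) ^ (p ^ (e - i))" for i
    have uv: "u i ^ (p ^ (e - i)) = x ^ (p ^ e) * v i" if "i \<le> e" for i
    proof -
      have "(x ^ (p ^ i)) ^ (p ^ (e - i)) = x ^ (p ^ e)"
        using that by (simp flip: power_mult power_add)
      then show ?thesis
        by (simp add: u_def v_def power_mult_distrib mult_ac)
    qed
    have "(\<Sum>i<e. u i ^ (p ^ (e - i))) = (\<Sum>i<e. x ^ (p ^ e) * v i)"
      using uv by (intro sum.cong) auto
    moreover have "u e = x ^ (p ^ e) * v e"
      using uv[of e] by simp
    moreover have "s = (\<Sum>i<e. v i) + v e"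
      unfolding s_def v_def lessThan_Suc_atMost[symmetric] by simp
    ultimately show ?thesis
      by (simp add: char2 distrib_left sum_distrib_left add.assoc)
  qed
  finally have "heis_f p e R x y ^ p + heis_f p e R x y =
      x ^ (p ^ e) * (poly R y ^ (p ^ e) + s) + (x * poly R y + y * poly R x)"
    by (simp add: w_def char2 power_mult_distrib algebra_simps)
  then show ?thesis
    using y by (simp add: heis_V_def s_def)
qed

end

text \<open>A nonconstant polynomial takes all values, in particular one not fixed by \<open>x \<mapsto> x^p\<close>.\<close>

lemma poly_fun_frob_fixed_const:
  fixes f :: "'a::alg_closed_field \<Rightarrow> 'a"
  assumes f: "poly_fun f" "\<And>x. f x ^ p + f x = 0" and "p \<ge> 2"
  shows "f x = f y"
proof -
  obtain Q where Q: "\<And>x. f x = poly Q x"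
    using f(1) by (auto simp: poly_fun_def)
  have "Polynomial.degree Q = 0"
  proof (rule ccontr)
    assume deg: "Polynomial.degree Q \<noteq> 0"
    obtain w :: 'a where w: "w ^ p + w = 1"
      using artin_schreier_solution \<open>p \<ge> 2\<close> by blast
    have "Polynomial.degree (Q + [:- w:]) = Polynomial.degree Q"
      using deg by (intro degree_add_eq_left) simp
    then obtain z where "poly (Q + [:- w:]) z = 0"
      using alg_closed_imp_poly_has_root deg by (metis gr0I)
    then have "f z = w"
      by (simp add: Q)
    with w f(2)[of z] show False
      by simp
  qed
  then obtain c where "Q = [:c:]"
    by (rule degree_eq_zeroE)
  then show ?thesis
    by (simp add: Q)
qed

text \<open>The sum \<open>D\<close> of both sides is a polynomial function of \<open>x\<close>. By
  the equations for \<open>heis_f\<close> and \<open>\<Delta>\<close>, \<open>D x ^ p + D x\<close>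
  is a product whose factor \<open>poly fU a ^ p + poly fU a\<close> is 0, so \<open>D\<close> is
  constant, and it vanishes at 0. The product of the values of \<open>fU\<close> is the carry of
  Witt vector addition: up to the variation of \<open>\<Delta>\<close>, the Heisenberg cocycle is
  the Witt cocycle.\<close>

lemma heis_f_cocycle:
  fixes R fU \<Delta> :: "'a::alg_closed_field poly"
  assumes "char_two TYPE('a) n p"
    and R: "additive_poly p R" "Polynomial.degree R \<le> p ^ e" and fU: "additive_poly p fU"
    and \<Delta>: "\<And>x. poly \<Delta> x ^ p + poly \<Delta> x = x * poly R x + poly fU x * (poly fU x ^ p + s0 * poly fU x)"
    "poly \<Delta> 0 = 0"
    and a: "a \<in> heis_V p e R" "poly fU a ^ p + poly fU a = 0"
  shows "heis_f p e R x a = poly \<Delta> (x + a) + poly \<Delta> x + poly \<Delta> a + poly fU x * poly fU a"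
proof -
  interpret char_two "TYPE('a)" n p
    by fact
  define D where
    "D x = heis_f p e R x a + poly \<Delta> (x + a) + poly \<Delta> x + poly \<Delta> a + poly fU x * poly fU a" for x
  have "poly_fun D"
    unfolding D_def
    by (intro poly_fun_add poly_fun_mult poly_fun_comp poly_fun_heis_f poly_fun_const poly_fun_id)
  moreover have "D x ^ p + D x = 0" for x
  proof -
    let ?f = "poly fU x" and ?g = "poly fU a"
    have "D x ^ p + D x = (heis_f p e R x a ^ p + heis_f p e R x a) +
        (poly \<Delta> (x + a) ^ p + poly \<Delta> (x + a)) + (poly \<Delta> x ^ p + poly \<Delta> x) +
        (poly \<Delta> a ^ p + poly \<Delta> a) + (?f ^ p * ?g ^ p + ?f * ?g)"
      by (simp add: D_def add_pow_p power_mult_distrib algebra_simps)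
    also have "\<dots> = (?f ^ p + ?f) * (?g ^ p + ?g)"
      unfolding \<Delta>(1) heis_f_frob[OF R a(1)]
      by (simp add: poly_additive[OF R(1)] poly_additive[OF fU] add_pow_p algebra_simps char2)
    finally show ?thesis
      by (simp add: a(2))
  qed
  ultimately have "D x = D 0"
    using poly_fun_frob_fixed_const p2 by blast
  also have "D 0 = 0"
    by (simp add: D_def heis_f_zero_left \<Delta>(2) poly_additive_0[OF fU] char2)
  finally have D0: "D x = 0" .
  have "heis_f p e R x a = D x + (poly \<Delta> (x + a) + poly \<Delta> x + poly \<Delta> a + poly fU x * poly fU a)"
    by (simp add: D_def algebra_simps char2)
  then show ?thesis
    by (simp add: D0)
qed


section \<open>Witt vectors of length two as a type\<close>

text \<open>\<open>W2\<close> is a record with a carrier. A type with the same addition gives access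
  to the class of abelian groups, and \<open>map_witt\<close> makes ring homomorphisms act on
  it.\<close>

datatype 'a witt = Witt (wfst: 'a) (wsnd: 'a)

instantiation witt :: (comm_ring_1) ab_group_add
begin

definition "0 = Witt 0 0"
definition "v + w = Witt (wfst v + wfst w) (wsnd v + wsnd w + wfst v * wfst w)"
definition "- v = Witt (- wfst v) (- wsnd v + wfst v ^ 2)"
definition "v - w = v + - w" for v w :: "'a witt"

instance
  by standard
    (auto simp: zero_witt_def plus_witt_def uminus_witt_def minus_witt_def algebra_simps
      power2_eq_square intro: witt.expand)

end

lemma Witt_add: "Witt a b + Witt c d = Witt (a + c) (b + d + a * c)"
  by (simp add: plus_witt_def)

context ring_map
begin

lemma map_witt_add: "map_witt h (v + w) = map_witt h v + map_witt h w"
  by (cases v; cases w) (simp add: Witt_add add mult)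

lemma map_witt_zero: "map_witt h 0 = 0"
  by (simp add: zero_witt_def zero)

lemma map_witt_diff: "map_witt h (v - w) = map_witt h v - map_witt h w"
  by (metis add_diff_cancel_right' diff_add_cancel map_witt_add)

lemma map_witt_sum: "map_witt h (sum f S) = (\<Sum>i\<in>S. map_witt h (f i))"
  by (induction S rule: infinite_finite_induct) (simp_all add: map_witt_zero map_witt_add)

end

definition witt_pair :: "'a witt \<Rightarrow> 'a \<times> 'a" where
  "witt_pair w = (wfst w, wsnd w)"

lemma W2_add: "witt_pair v \<oplus>\<^bsub>W2 K\<^esub> witt_pair w = witt_pair (v + w)"
  by (simp add: W2_def witt_pair_def plus_witt_def)

lemma abelian_monoid_W2: "abelian_monoid (W2 (UNIV :: 'f::field set))"
  by (rule abelian_monoidI) (auto simp: W2_def algebra_simps)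

lemma W2_trace_eq:
  "W2_trace m n (a, b) = witt_pair (\<Sum>i<m div n. map_witt (\<lambda>x. x ^ (2 ^ (i * n))) (Witt a (b::'f::field)))"
proof -
  interpret abelian_monoid "W2 (UNIV :: 'f set)"
    by (rule abelian_monoid_W2)
  have "finsum (W2 UNIV) (\<lambda>i. witt_pair (f i)) {..<k} = witt_pair (\<Sum>i<k. f i)" for f :: "nat \<Rightarrow> 'f witt" and k
  proof (induction k)
    case 0
    show ?case
      by (simp only: lessThan_0 finsum_empty sum.empty) (simp add: W2_def witt_pair_def zero_witt_def)
  next
    case (Suc k)
    have "carrier (W2 UNIV) = (UNIV :: ('f \<times> 'f) set)"
      by (simp add: W2_def)
    then show ?case
      by (simp add: lessThan_Suc Suc W2_add add.commute)
  qed
  from this[of "\<lambda>i. map_witt (\<lambda>x. x ^ (2 ^ (i * n))) (Witt a b)"] show ?thesis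
    by (simp add: W2_trace_def witt_pair_def)
qed

lemma W2_char_eq:
  "W2_char \<xi> k (a, b) = \<xi> (witt_pair (\<Sum>i<k. map_witt (\<lambda>x. x ^ (2 ^ i)) (Witt a (b::'f::field))))"
  by (simp add: W2_char_def W2_trace_eq)

text \<open>Addition is not componentwise, but powers of Frobenius respect it, so the trace
  telescopes as in a field. It converts a difference for the \<open>2 ^ k\<close>-th power map into
  one for squaring.\<close>

lemma (in char_two) witt_telescope:
  "map_witt (\<lambda>x::'a. x ^ 2) (\<Sum>i<k. map_witt (\<lambda>x. x ^ (2 ^ i)) w) - (\<Sum>i<k. map_witt (\<lambda>x. x ^ (2 ^ i)) w)
    = map_witt (\<lambda>x. x ^ (2 ^ k)) w - w"
proof (induction k)
  case 0
  interpret ring_map "\<lambda>x::'a. x ^ 2"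
    using ring_map_pow2[of 1] by simp
  show ?case
    by (simp add: map_witt_zero witt.map_ident)
next
  case (Suc k)
  interpret ring_map "\<lambda>x::'a. x ^ 2"
    using ring_map_pow2[of 1] by simp
  have "map_witt (\<lambda>x. x ^ 2) (map_witt (\<lambda>x. x ^ (2 ^ k)) w) = map_witt (\<lambda>x. x ^ (2 ^ Suc k)) w"
    by (simp add: witt.map_comp comp_def mult.commute flip: power_mult)
  then show ?case
    using Suc by (simp add: map_witt_add algebra_simps)
qed


section \<open>The covering of the affine line\<close>

lemma CHAR_ffc: "CHAR('f::field ffc) = CHAR('f)"
proof (rule CHAR_eqI)
  have of_nat: "of_nat k = cst (of_nat k :: 'f)" for k
    by (induction k) (simp_all add: cst.zero cst.one cst.add)
  show "of_nat CHAR('f) = (0 :: 'f ffc)"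
    by (simp add: of_nat cst.zero)
  show "CHAR('f) dvd k" if "of_nat k = (0 :: 'f ffc)" for k
    using that by (simp add: of_nat cst.eq_0_iff of_nat_eq_0_iff_char_dvd)
qed

section \<open>Rationality over finite fields, and Galois action on polynomial expressions\<close>

lemma Fin_mult: "x \<in> Fin q \<Longrightarrow> y \<in> Fin q \<Longrightarrow> x * y \<in> Fin q"
  by (simp add: Fin_def power_mult_distrib)

lemma Fin_power: "x \<in> Fin q \<Longrightarrow> x ^ k \<in> Fin q"
  by (simp add: Fin_def flip: power_mult) (simp add: power_mult mult.commute[of k])

lemma Fin_inverse: "x \<in> Fin q \<Longrightarrow> inverse x \<in> Fin q"
  by (simp add: Fin_def power_inverse)

lemma Fin_iterate: "x \<in> Fin p \<Longrightarrow> x \<in> Fin (p ^ k)"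
  by (induction k) (simp_all add: Fin_def power_mult)

context char_two
begin

lemma Fin_zero: "(0::'a) \<in> Fin (p ^ k)"
  using p2 by (simp add: Fin_def)

lemma Fin_add: "(x::'a) \<in> Fin (p ^ k) \<Longrightarrow> y \<in> Fin (p ^ k) \<Longrightarrow> x + y \<in> Fin (p ^ k)"
  by (simp add: Fin_def add_pow)

lemma Fin_poly: "poly_over (Fin (p ^ k)) P \<Longrightarrow> (x::'a) \<in> Fin (p ^ k) \<Longrightarrow> poly P x \<in> Fin (p ^ k)"
proof (induction P)
  case (pCons c P)
  have "c \<in> Fin (p ^ k)" "poly_over (Fin (p ^ k)) P"
    using pCons.prems(1) unfolding poly_over_def by (metis coeff_pCons_0, metis coeff_pCons_Suc)
  with pCons show ?case
    by (simp add: Fin_add Fin_mult)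
qed (simp add: Fin_zero)

lemma power_pow_eq_iff: "(x::'a) ^ (2 ^ k) = y ^ (2 ^ k) \<longleftrightarrow> x = y"
proof
  assume "x ^ (2 ^ k) = y ^ (2 ^ k)"
  then have "(x + y) ^ (2 ^ k) = 0"
    by (simp add: add_pow2 char2)
  then have "x + y = 0"
    by simp
  then show "x = y"
    by (simp add: add_eq_0_iff char2)
qed simp

end

lemma rad_pow2:
  fixes u v :: "'b::alg_closed_field"
  assumes "CHAR('b) = 2"
  shows "rad (2 ^ k) u ^ (2 ^ k) = u" "v ^ (2 ^ k) = u \<Longrightarrow> rad (2 ^ k) u = v"
proof -
  interpret char_two "TYPE('b)" 1 2
    by unfold_locales (simp_all add: assms)
  obtain w where w: "w ^ (2 ^ k) = u"
    using nth_root_exists[of "2 ^ k" u] by auto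
  have unique: "rad (2 ^ k) u = v" if "v ^ (2 ^ k) = u" for v
    unfolding rad_def using that by (intro the_equality) (auto simp: power_pow_eq_iff)
  show "rad (2 ^ k) u ^ (2 ^ k) = u"
    using unique[OF w] w by simp
  show "v ^ (2 ^ k) = u \<Longrightarrow> rad (2 ^ k) u = v"
    by (rule unique)
qed

lemma arith_gal_poly:
  assumes "\<sigma> \<in> arith_gal q" "poly_over (Fin q) P"
  shows "\<sigma> (poly (map_poly cst P) x) = poly (map_poly cst P) (\<sigma> x)"
proof -
  interpret field_map \<sigma>
    using assms(1) by (intro field_auts_field_map) (simp add: arith_gal_def)
  have "map_poly \<sigma> (map_poly cst P) = map_poly cst P"
    using assms by (intro poly_eqI) (simp add: coeff_map cst.coeff_map poly_over_def arith_gal_def)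
  then show ?thesis
    using poly_map_poly[of "map_poly cst P" x] by simp
qed

lemma arith_gal_heis_f:
  assumes \<sigma>: "\<sigma> \<in> arith_gal q" and R: "poly_over (Fin q) R" and a: "a \<in> Fin q"
  shows "\<sigma> (heis_f p e (map_poly cst R) x (cst a)) = heis_f p e (map_poly cst R) (\<sigma> x) (cst a)"
proof -
  interpret field_map \<sigma>
    using assms(1) by (intro field_auts_field_map) (simp add: arith_gal_def)
  have "\<sigma> (cst a) = cst a" "\<And>i. \<sigma> (cst (Polynomial.coeff R i)) = cst (Polynomial.coeff R i)"
    using \<sigma> R a by (auto simp: arith_gal_def poly_over_def)
  then show ?thesis
    by (simp add: heis_f_def minus sum add power mult arith_gal_poly[OF \<sigma> R] cst.coeff_map)
qed

lemma cst_heis_f: "heis_f p e (map_poly cst R) (cst a) (cst b) = cst (heis_f p e R a b)"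
  by (simp add: heis_f_def cst.minus cst.sum cst.add cst.power cst.mult cst.poly_map_poly cst.coeff_map)

lemma cst_heis_V: "cst a \<in> heis_V p e (map_poly cst R) \<longleftrightarrow> a \<in> heis_V p e R"
proof -
  have "poly (map_poly cst R) (cst a) ^ (p ^ e) +
      (\<Sum>i\<le>e. (Polynomial.coeff (map_poly cst R) (p ^ i) * cst a) ^ (p ^ (e - i))) =
    cst (poly R a ^ (p ^ e) + (\<Sum>i\<le>e. (Polynomial.coeff R (p ^ i) * a) ^ (p ^ (e - i))))"
    by (simp add: cst.sum cst.add cst.power cst.mult cst.poly_map_poly cst.coeff_map)
  then show ?thesis
    by (simp add: heis_V_def cst.eq_0_iff)
qed

lemma additive_poly_map_cst: "additive_poly p P \<Longrightarrow> additive_poly p (map_poly cst P)"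
  by (simp add: additive_poly_def cst.coeff_map cst.eq_0_iff)

lemma degree_map_cst: "Polynomial.degree (map_poly cst P) = Polynomial.degree P"
  by (rule degree_map_poly) (simp add: cst.eq_0_iff)

text \<open>The data common to the original curve and its twist. \<open>\<alpha>'\<close> is the
  \<open>p\<close>-th root of \<open>\<alpha>\<close>; \<open>R\<close>, \<open>\<Delta>\<close>,
  \<open>s0\<close>, \<open>\<alpha>\<close> and \<open>A\<close> change under the twist, while
  \<open>fU\<close> and \<open>F\<close> do not.\<close>

locale cover = char_two "TYPE('f)" n p
  for n p m q e :: nat and R fU F \<Delta> :: "'f::alg_closed_field poly" and s0 \<alpha> \<alpha>' :: 'f
    and A :: "('f \<times> 'f) set" +
  assumes q: "q = p ^ m"
    and R: "additive_poly p R" "Polynomial.degree R \<le> p ^ e" "poly_over (Fin q) R"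
    and fU: "additive_poly p fU" "poly_over (Fin q) fU"
    and F: "F = fU ^ p + fU" "F \<noteq> 0"
    and Ker_F: "Ker F \<subseteq> Fin q" "Ker F \<subseteq> heis_V p e R"
    and heis_sym: "a \<in> Ker F \<Longrightarrow> a' \<in> Ker F \<Longrightarrow> heis_f p e R a a' = heis_f p e R a' a"
    and A: "A = {(a, b) \<in> carrier (heis p e R). a \<in> Ker F}"
    and \<Delta>: "poly_over (Fin q) \<Delta>" "poly \<Delta> 0 = 0"
      "\<Delta> ^ p + \<Delta> = [:0, 1:] * R + fU * (fU ^ p + Polynomial.smult s0 fU)"
    and \<alpha>: "\<alpha>' ^ p = \<alpha>" "\<alpha>' + \<alpha> = s0 + 1" "\<alpha> \<in> Fin q" "\<alpha>' \<in> Fin q"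
begin

sublocale K: char_two "TYPE('f ffc)" n p
  by unfold_locales (rule trans[OF CHAR_ffc char], rule n, rule p)

abbreviation "Rc \<equiv> map_poly cst R"
abbreviation "fc \<equiv> map_poly cst fU"
abbreviation "\<Delta>c \<equiv> map_poly cst \<Delta>"

lemma poly_F: "poly F a = poly fU a ^ p + poly fU a"
  by (simp add: F)

lemma poly_Fc: "poly (map_poly cst F) x = poly fc x ^ p + poly fc x"
  by (simp add: F cst.map_poly_add cst.map_poly_power)

lemma poly_\<Delta>: "poly \<Delta> a ^ p + poly \<Delta> a = a * poly R a + poly fU a * (poly fU a ^ p + s0 * poly fU a)"
proof -
  have "poly (\<Delta> ^ p + \<Delta>) a = poly ([:0, 1:] * R + fU * (fU ^ p + Polynomial.smult s0 fU)) a"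
    by (simp only: \<Delta>(3))
  then show ?thesis
    by simp
qed

lemma poly_\<Delta>c:
  "poly \<Delta>c x ^ p + poly \<Delta>c x = x * poly Rc x + poly fc x * (poly fc x ^ p + cst s0 * poly fc x)"
proof -
  have "poly (map_poly cst (\<Delta> ^ p + \<Delta>)) x =
      poly (map_poly cst ([:0, 1:] * R + fU * (fU ^ p + Polynomial.smult s0 fU))) x"
    by (simp only: \<Delta>(3))
  then show ?thesis
    by (simp add: cst.map_poly_add cst.map_poly_mult cst.map_poly_power map_poly_pCons
        map_poly_smult[of cst, OF cst.zero cst.mult] cst.zero cst.one)
qed

lemma A_iff: "(a, b) \<in> A \<longleftrightarrow> a \<in> Ker F \<and> b ^ p + b = a * poly R a"
  using Ker_F(2) by (auto simp: A heis_def char2)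

text \<open>The Witt vector component of the isomorphism \<open>\<phi>\<close> of the paper.\<close>

definition witt_of :: "'f \<times> 'f \<Rightarrow> 'f witt" where
  "witt_of = (\<lambda>(a, b). Witt (poly fU a) (b + poly \<Delta> a + \<alpha>' * poly fU a ^ 2))"

text \<open>The choice of \<open>\<alpha>\<close> is made for this. Apply x^p + x to the second
  component: the terms with \<open>R\<close> cancel, the equation of \<open>\<Delta>\<close> leaves
  \<open>(s0 + 1) * poly fU a ^ 2\<close>, and \<open>\<alpha>' + \<alpha> = s0 + 1\<close> removes
  it.\<close>

lemma witt_of_Fin:
  assumes "(a, b) \<in> A"
  shows "wfst (witt_of (a, b)) \<in> Fin p" "wsnd (witt_of (a, b)) \<in> Fin p"
proof -
  let ?f = "poly fU a"
  have f: "?f ^ p + ?f = 0" and b: "b ^ p + b = a * poly R a"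
    using assms by (simp_all add: A_iff Ker_def poly_F)
  then have fp: "?f ^ p = ?f"
    by (simp add: add_eq_0_iff char2)
  then show "wfst (witt_of (a, b)) \<in> Fin p"
    by (simp add: witt_of_def Fin_def)
  have "(?f ^ 2) ^ p = ?f ^ 2"
    using fp by (metis power_mult mult.commute)
  then have "(b + poly \<Delta> a + \<alpha>' * ?f ^ 2) ^ p + (b + poly \<Delta> a + \<alpha>' * ?f ^ 2) =
      (b ^ p + b) + (poly \<Delta> a ^ p + poly \<Delta> a) + (\<alpha>' + \<alpha>) * ?f ^ 2"
    by (simp add: add_pow_p power_mult_distrib \<alpha>(1) algebra_simps)
  also have "\<dots> = 0"
    unfolding b poly_\<Delta> \<alpha>(2) fp by (simp add: algebra_simps power2_eq_square char2)
  finally show "wsnd (witt_of (a, b)) \<in> Fin p"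
    by (simp add: witt_of_def Fin_def add_eq_0_iff char2)
qed

text \<open>The second coordinate is a Witt component, which lies in \<open>Fin p\<close>, plus
  terms that are visibly rational. In this way rationality also holds for the twisted group, which
  is given only as a preimage.\<close>

lemma A_Fin:
  assumes "(a, b) \<in> A"
  shows "a \<in> Fin q" "b \<in> Fin q"
proof -
  show a: "a \<in> Fin q"
    using assms Ker_F(1) by (auto simp: A_iff)
  have "b = wsnd (witt_of (a, b)) + (poly \<Delta> a + \<alpha>' * poly fU a ^ 2)"
    by (simp add: witt_of_def char2 algebra_simps)
  moreover have "wsnd (witt_of (a, b)) \<in> Fin q"
    unfolding q by (rule Fin_iterate) (rule witt_of_Fin[OF assms])
  moreover have "poly \<Delta> a + \<alpha>' * poly fU a ^ 2 \<in> Fin q"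
    using a \<Delta>(1) fU(2) \<alpha>(4) unfolding q
    by (intro Fin_add Fin_mult Fin_power Fin_poly)
  ultimately show "b \<in> Fin q"
    unfolding q by (metis Fin_add)
qed

lemma generic_fibre_iff:
  "(x, y) \<in> generic_fibre p R F \<longleftrightarrow>
    y ^ p + y = x * poly Rc x \<and> poly fc x ^ p + poly fc x = coord"
  by (simp add: generic_fibre_def K.char2 poly_Fc)

text \<open>The difference of the first coordinates is a root of \<open>F\<close>, a polynomial over
  the constants, and hence constant. Corrected by \<open>heis_f\<close>, the difference of the
  second coordinates satisfies an Artin-Schreier equation over the constants, so it is constant
  too.\<close>

lemma generic_fibre_transitive:
  assumes P: "(x, y) \<in> generic_fibre p R F" and P': "(x', y') \<in> generic_fibre p R F"
  shows "\<exists>a b. (a, b) \<in> A \<and> x' = x + cst a \<and> y' = y + cst b + heis_f p e Rc x (cst a)"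
proof -
  have Rc: "additive_poly p Rc" "Polynomial.degree Rc \<le> p ^ e"
    using R by (simp_all add: additive_poly_map_cst degree_map_cst)
  note eq = P[unfolded generic_fibre_iff] P'[unfolded generic_fibre_iff]
  have "poly (map_poly cst F) (x + x') = (poly fc x ^ p + poly fc x) + (poly fc x' ^ p + poly fc x')"
    by (simp add: poly_Fc K.poly_additive[OF additive_poly_map_cst[OF fU(1)]] K.add_pow_p algebra_simps)
  also have "\<dots> = 0"
    using eq by (simp add: K.char2)
  finally have root: "poly (map_poly cst F) (x + x') = 0" .
  then obtain a where a: "x + x' = cst a"
    using root_in_range[OF cst.ring_map_axioms F(2)] by blast
  then have x': "x' = x + cst a"
    by (metis K.char2(2))
  have "cst (poly F a) = 0"
    using root by (simp add: a flip: cst.poly_map_poly)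
  then have a_Ker: "a \<in> Ker F"
    by (simp add: Ker_def cst.eq_0_iff)
  then have aV: "cst a \<in> heis_V p e Rc"
    using Ker_F(2) by (auto simp: cst_heis_V)
  let ?h = "heis_f p e Rc x (cst a)"
  define b0 where "b0 = y + y' + ?h"
  have "b0 ^ p + b0 = (y ^ p + y) + (y' ^ p + y') + (?h ^ p + ?h)"
    by (simp add: b0_def K.add_pow_p algebra_simps)
  also have "\<dots> = cst a * poly Rc (cst a)"
    unfolding K.heis_f_frob[OF Rc aV]
    using eq by (simp add: x' K.poly_additive[OF Rc(1)] K.char2 algebra_simps)
  finally have b0: "b0 ^ p + b0 = cst (a * poly R a)"
    by (simp add: cst.poly_map_poly cst.mult)
  let ?P = "Polynomial.monom 1 p + [:- (a * poly R a), 1:]"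
  have "poly (map_poly cst ?P) b0 = 0"
    using b0 by (simp add: cst.map_poly_add map_poly_monom map_poly_pCons cst.zero cst.one cst.minus
        poly_monom add_diff_eq)
  moreover have "Polynomial.coeff ?P p = 1"
    using p2 by (simp add: coeff_pCons split: nat.split)
  then have "?P \<noteq> 0"
    by (metis coeff_0 zero_neq_one)
  ultimately obtain b where b: "b0 = cst b"
    using root_in_range[OF cst.ring_map_axioms] by blast
  have "cst (b ^ p + b) = cst (a * poly R a)"
    using b0 by (simp add: b cst.add cst.power)
  then have "(a, b) \<in> A"
    using a_Ker by (simp add: A_iff cst.eq_iff)
  moreover have "y' = y + cst b + ?h"
    by (simp add: b0_def K.char2 algebra_simps flip: b)
  ultimately show ?thesis
    using x' by blast
qed

lemma arith_gal_generic_fibre: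
  assumes \<sigma>: "\<sigma> \<in> arith_gal q" and P: "(x, y) \<in> generic_fibre p R F"
  shows "(\<sigma> x, \<sigma> y) \<in> generic_fibre p R F"
proof -
  interpret \<sigma>: field_map \<sigma>
    using \<sigma> by (intro field_auts_field_map) (simp add: arith_gal_def)
  have "\<sigma> (y ^ p + y) = \<sigma> (x * poly Rc x)" "\<sigma> (poly fc x ^ p + poly fc x) = \<sigma> coord"
    using P by (simp_all add: generic_fibre_iff)
  moreover have "\<sigma> coord = coord"
    using \<sigma> by (simp add: arith_gal_def)
  ultimately show ?thesis
    by (simp add: generic_fibre_iff \<sigma>.add \<sigma>.power \<sigma>.mult arith_gal_poly[OF \<sigma> R(3)]
        arith_gal_poly[OF \<sigma> fU(2)])
qed

text \<open>The definition of \<open>sheaf_char\<close> asks for one \<open>g\<close> that works on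
  the whole fibre. The fibre is a single orbit and \<open>A\<close> is commutative and rational, so
  the \<open>g\<close> found at one point works everywhere; it is unique because the action is
  free.\<close>

lemma sheaf_char_eq:
  assumes \<sigma>: "\<sigma> \<in> arith_gal q" and P: "(x, y) \<in> generic_fibre p R F"
    and g: "(a, b) \<in> A" "\<sigma> x = x + cst a" "\<sigma> y = y + cst b + heis_f p e Rc x (cst a)"
  shows "sheaf_char p e R F A \<xi> \<sigma> = inverse (\<xi> (a, b))"
proof -
  interpret \<sigma>: field_map \<sigma>
    using \<sigma> by (intro field_auts_field_map) (simp add: arith_gal_def)
  have Rc: "additive_poly p Rc"
    using R by (simp add: additive_poly_map_cst)
  have "map_prod \<sigma> \<sigma> P' = heis_act p e R P' (a, b)" if P': "P' \<in> generic_fibre p R F" for P'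
  proof -
    obtain x' y' where "P' = (x', y')"
      by (cases P')
    with generic_fibre_transitive[OF P] P' obtain c d where
      cd: "(c, d) \<in> A" "P' = (x + cst c, y + cst d + heis_f p e Rc x (cst c))"
      by blast
    have fixed: "\<sigma> (cst c) = cst c" "\<sigma> (cst d) = cst d"
      using A_Fin[OF cd(1)] \<sigma> by (simp_all add: arith_gal_def)
    have "\<sigma> (heis_f p e Rc x (cst c)) = heis_f p e Rc (x + cst a) (cst c)"
      using arith_gal_heis_f[OF \<sigma> R(3) A_Fin(1)[OF cd(1)]] g(2) by simp
    also have "\<dots> = heis_f p e Rc x (cst c) + cst (heis_f p e R a c)"
      by (simp add: K.heis_f_add_left cst_heis_f)
    finally have h: "\<sigma> (heis_f p e Rc x (cst c)) = heis_f p e Rc x (cst c) + cst (heis_f p e R a c)" .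
    \<comment> \<open>Commutativity of \<open>A\<close> enters through this symmetry.\<close>
    have "heis_f p e R a c = heis_f p e R c a"
      using cd(1) g(1) by (intro heis_sym) (simp_all add: A_iff)
    then have "heis_f p e Rc (x + cst c) (cst a) = heis_f p e Rc x (cst a) + cst (heis_f p e R a c)"
      by (simp add: K.heis_f_add_left cst_heis_f)
    then show ?thesis
      by (simp add: cd(2) heis_act_def \<sigma>.add fixed h g algebra_simps)
  qed
  moreover have "g' = (a, b)" if "\<forall>P \<in> generic_fibre p R F. map_prod \<sigma> \<sigma> P = heis_act p e R P g'" for g'
  proof -
    obtain a' b' where g': "g' = (a', b')"
      by (cases g')
    have "map_prod \<sigma> \<sigma> (x, y) = heis_act p e R (x, y) g'"
      using that P by blast
    then have "\<sigma> x = x + cst a'" "\<sigma> y = y + cst b' + heis_f p e Rc x (cst a')"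
      by (simp_all add: heis_act_def g')
    with g have eq: "x + cst a = x + cst a'"
      "y + cst b + heis_f p e Rc x (cst a) = y + cst b' + heis_f p e Rc x (cst a')"
      by metis+
    then have "a = a'"
      by (simp add: cst.eq_iff)
    moreover have "cst b = cst b'"
      using eq(2) unfolding \<open>a = a'\<close> by simp
    ultimately show ?thesis
      by (simp add: g' cst.eq_iff)
  qed
  ultimately have "(THE g. g \<in> A \<and> (\<forall>P \<in> generic_fibre p R F. map_prod \<sigma> \<sigma> P = heis_act p e R P g)) = (a, b)"
    using g(1) by (intro the_equality) blast+
  then show ?thesis
    by (simp add: sheaf_char_def)
qed

text \<open>The formula of \<open>witt_of\<close> at the generic point, with \<open>y\<close> in
  place of \<open>b\<close>; Galois elements move it by the values of
  \<open>witt_of\<close>.\<close>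

definition generic_witt :: "'f ffc \<times> 'f ffc \<Rightarrow> 'f ffc witt" where
  "generic_witt = (\<lambda>(x, y). Witt (poly fc x) (y + poly \<Delta>c x + cst \<alpha>' * poly fc x ^ 2))"

text \<open>The cancellation of \<open>witt_of_Fin\<close> again, except that the value of
  \<open>fU ^ p + fU\<close> is now \<open>coord\<close> instead of 0; the right-hand side is the
  surplus.\<close>

lemma generic_witt_frob:
  assumes "(x, y) \<in> generic_fibre p R F"
  shows "map_witt (\<lambda>x. x ^ p) (generic_witt (x, y)) - generic_witt (x, y) = Witt coord (cst \<alpha> * coord ^ 2)"
proof -
  let ?X = "poly fc x"
  have y: "y ^ p = y + x * poly Rc x" and s: "coord = ?X ^ p + ?X"
    using assms by (simp_all add: generic_fibre_iff) (metis K.char2(2) add.commute)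
  have \<Delta>p: "poly \<Delta>c x ^ p = poly \<Delta>c x + (x * poly Rc x + ?X * (?X ^ p + cst s0 * ?X))"
    unfolding poly_\<Delta>c[symmetric] by (simp add: K.char2 algebra_simps)
  have s0: "cst s0 = cst \<alpha>' + cst \<alpha> + 1"
  proof -
    have "s0 = \<alpha>' + \<alpha> + 1"
      unfolding \<alpha>(2) by (simp add: char2 algebra_simps)
    then show ?thesis
      by (simp add: cst.add cst.one)
  qed
  have "(y + poly \<Delta>c x + cst \<alpha>' * ?X ^ 2) ^ p = y ^ p + poly \<Delta>c x ^ p + cst \<alpha> * (?X ^ p) ^ 2"
  proof -
    have "cst \<alpha>' ^ p = cst \<alpha>" "(?X ^ 2) ^ p = (?X ^ p) ^ 2"
      by (simp_all add: \<alpha>(1) mult.commute flip: cst.power power_mult)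
    then show ?thesis
      by (simp add: K.add_pow_p power_mult_distrib)
  qed
  also have "\<dots> = (y + poly \<Delta>c x + cst \<alpha>' * ?X ^ 2) + cst \<alpha> * coord ^ 2 + ?X * coord"
    unfolding y \<Delta>p s0 s by (simp add: K.char2 power2_eq_square algebra_simps)
  finally have "map_witt (\<lambda>x. x ^ p) (generic_witt (x, y)) =
      generic_witt (x, y) + Witt coord (cst \<alpha> * coord ^ 2)"
    by (simp add: generic_witt_def Witt_add s K.char2 algebra_simps)
  then show ?thesis
    by simp
qed

text \<open>\<open>heis_f_cocycle\<close> turns the Heisenberg term in the action on
  \<open>y\<close> into the variation of \<open>\<Delta>\<close> and the carry of Witt vector
  addition.\<close>

lemma generic_witt_galois:
  assumes \<sigma>: "\<sigma> \<in> arith_gal q" and g: "(a, b) \<in> A" "\<sigma> x = x + cst a"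
    "\<sigma> y = y + cst b + heis_f p e Rc x (cst a)"
  shows "map_witt \<sigma> (generic_witt (x, y)) - generic_witt (x, y) = map_witt cst (witt_of (a, b))"
proof -
  interpret \<sigma>: field_map \<sigma>
    using \<sigma> by (intro field_auts_field_map) (simp add: arith_gal_def)
  have a: "a \<in> Ker F"
    using g(1) by (simp add: A_iff)
  have fc: "poly fc (x + cst a) = poly fc x + cst (poly fU a)"
    by (simp add: K.poly_additive[OF additive_poly_map_cst[OF fU(1)]] cst.poly_map_poly)
  have "heis_f p e Rc x (cst a) =
      poly \<Delta>c (x + cst a) + poly \<Delta>c x + poly \<Delta>c (cst a) + poly fc x * poly fc (cst a)"
  proof (rule heis_f_cocycle[OF K.char_two_axioms _ _ _ poly_\<Delta>c])
    show "poly fc (cst a) ^ p + poly fc (cst a) = 0"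
      using a by (simp add: Ker_def cst.poly_map_poly poly_F cst.zero flip: cst.power cst.add)
    show "poly \<Delta>c 0 = 0"
      using cst.poly_map_poly[of \<Delta> 0] by (simp add: \<Delta>(2) cst.zero)
    show "cst a \<in> heis_V p e Rc"
      using a Ker_F(2) by (auto simp: cst_heis_V)
  qed (simp_all add: additive_poly_map_cst degree_map_cst R fU)
  then have h: "heis_f p e Rc x (cst a) =
      poly \<Delta>c (x + cst a) + poly \<Delta>c x + cst (poly \<Delta> a) + poly fc x * cst (poly fU a)"
    by (simp add: cst.poly_map_poly)
  have "\<sigma> (cst \<alpha>') = cst \<alpha>'"
    using \<sigma> \<alpha>(4) by (simp add: arith_gal_def)
  then have "map_witt \<sigma> (generic_witt (x, y)) = generic_witt (x, y) + map_witt cst (witt_of (a, b))"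
    by (simp add: generic_witt_def witt_of_def Witt_add \<sigma>.add \<sigma>.mult \<sigma>.power g(2,3) fc h
        arith_gal_poly[OF \<sigma> \<Delta>(1)] arith_gal_poly[OF \<sigma> fU(2)] cst.add cst.mult cst.power
        K.char2 power2_eq_square algebra_simps)
  then show ?thesis
    by simp
qed

end


section \<open>Artin--Schreier--Witt characters\<close>

definition witt_F2 :: "'a::field witt set" where
  "witt_F2 = {w. wfst w \<in> Fin 2 \<and> wsnd w \<in> Fin 2}"

lemma witt_F2_iff: "w \<in> witt_F2 \<longleftrightarrow> map_witt (\<lambda>x. x ^ 2) w = w"
  by (cases w) (simp add: witt_F2_def Fin_def)

lemma Fin_2: "Fin 2 = {0, 1 :: 'a::field}"
proof -
  have "x ^ 2 = x \<longleftrightarrow> x = 0 \<or> x = 1" for x :: 'a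
    by (simp add: power2_eq_square)
  then show ?thesis
    by (auto simp: Fin_def)
qed

text \<open>Witt vectors fixed by Frobenius have entries 0 and 1. Two solutions of the same
  Artin-Schreier-Witt equation thus differ by a vector that Galois elements fix.\<close>

lemma witt_F2_cst:
  assumes "(w :: 'f::field ffc witt) \<in> witt_F2"
  shows "\<exists>v\<in>witt_F2. w = map_witt cst v"
proof -
  have "x \<in> cst ` Fin 2" if "x \<in> Fin 2" for x :: "'f ffc"
    using that by (auto simp: Fin_2 cst.zero cst.one)
  then obtain a b where "wfst w = cst a" "wsnd w = cst b" "a \<in> Fin 2" "b \<in> Fin 2"
    using assms unfolding witt_F2_def by blast
  then show ?thesis
    by (intro bexI[of _ "Witt a b"]) (auto simp: witt_F2_def intro: witt.expand)
qed

lemma map_witt_cst_inj: "map_witt cst v = map_witt cst w \<longleftrightarrow> v = w"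
  by (rule inj_eq[OF witt.inj_map[OF cst.inj]])

text \<open>Multiplication by the Witt vector \<open>(a, b)\<close> as in \<open>W2\<close>; in
  characteristic two it is additive because squaring is.\<close>

definition witt_scale :: "'a::comm_ring_1 \<Rightarrow> 'a \<Rightarrow> 'a witt \<Rightarrow> 'a witt" where
  "witt_scale a b w = Witt (a * wfst w) (b * wfst w ^ 2 + a ^ 2 * wsnd w)"

lemma (in ring_map) map_witt_scale:
  "map_witt h (witt_scale a b w) = witt_scale (h a) (h b) (map_witt h w)"
  by (cases w) (simp add: witt_scale_def add mult power)

definition witt_trace :: "nat \<Rightarrow> 'a::comm_ring_1 witt \<Rightarrow> 'a witt" where
  "witt_trace k w = (\<Sum>i<k. map_witt (\<lambda>x. x ^ (2 ^ i)) w)"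

lemma W2_char_witt_trace: "W2_char \<xi> k (a, b) = \<xi> (witt_pair (witt_trace k (Witt a b)))"
  by (simp add: W2_char_eq witt_trace_def)

lemma (in ring_map) map_witt_trace: "map_witt h (witt_trace k w) = witt_trace k (map_witt h w)"
  by (simp add: witt_trace_def map_witt_sum witt.map_comp comp_def power)

context char_two
begin

lemma ring_map_square: "ring_map (\<lambda>x::'a. x ^ 2)"
  using ring_map_pow2[of 1] by simp

lemma witt_scale_add: "witt_scale a b (v + w) = witt_scale a b v + witt_scale a b (w :: 'a witt)"
  by (cases v; cases w)
    (simp add: witt_scale_def Witt_add power2_eq_square algebra_simps char2)

lemma witt_trace_add: "witt_trace k (v + w) = witt_trace k v + witt_trace k (w :: 'a witt)"
  by (simp add: witt_trace_def sum.distrib ring_map.map_witt_add[OF ring_map_pow2])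

lemma witt_trace_diff: "witt_trace k (v - w) = witt_trace k v - witt_trace k (w :: 'a witt)"
  by (metis add_diff_cancel_right' diff_add_cancel witt_trace_add)

lemma witt_trace_frob:
  "map_witt (\<lambda>x::'a. x ^ 2) (witt_trace k w) - witt_trace k w = map_witt (\<lambda>x. x ^ (2 ^ k)) w - w"
  unfolding witt_trace_def by (rule witt_telescope)

lemma witt_F2_add: "(v :: 'a witt) \<in> witt_F2 \<Longrightarrow> w \<in> witt_F2 \<Longrightarrow> v + w \<in> witt_F2"
  by (simp add: witt_F2_iff ring_map.map_witt_add[OF ring_map_square])

lemma witt_F2_diffI:
  "map_witt (\<lambda>x::'a. x ^ 2) v - v = map_witt (\<lambda>x. x ^ 2) w - w \<Longrightarrow> v - w \<in> witt_F2"
  by (simp add: witt_F2_iff ring_map.map_witt_diff[OF ring_map_square] algebra_simps)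

lemma witt_trace_F2:
  assumes "wfst w \<in> Fin (2 ^ k)" "wsnd w \<in> Fin (2 ^ k)"
  shows "witt_trace k (w :: 'a witt) \<in> witt_F2"
proof -
  have "map_witt (\<lambda>x. x ^ (2 ^ k)) w = w"
    using assms by (cases w) (simp add: Fin_def)
  then show ?thesis
    using witt_trace_frob[of k w] by (simp add: witt_F2_iff)
qed

end

text \<open>Two Artin-Schreier equations in succession; the second contains the carry
  \<open>x * wfst v\<close>.\<close>

lemma witt_artin_schreier_solution:
  fixes v :: "'a::alg_closed_field witt"
  assumes "CHAR('a) = 2"
  shows "\<exists>w. map_witt (\<lambda>x. x ^ 2) w - w = v"
proof -
  note char2 = two_eq_0_simps[where 'a = 'a, OF assms]
  obtain x where x: "x ^ 2 + x = wfst v"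
    using artin_schreier_solution[of 2 "wfst v"] by auto
  obtain y where y: "y ^ 2 + y = wsnd v + x * wfst v"
    using artin_schreier_solution[of 2 "wsnd v + x * wfst v"] by auto
  have "x ^ 2 = x + wfst v"
    by (simp add: char2 algebra_simps flip: x)
  moreover have "y ^ 2 = y + (wsnd v + x * wfst v)"
    by (simp add: char2 algebra_simps flip: y)
  ultimately have "map_witt (\<lambda>x. x ^ 2) (Witt x y) = v + Witt x y"
    by (cases v) (simp add: Witt_add algebra_simps)
  then show ?thesis
    by (intro exI[of _ "Witt x y"]) simp
qed

lemma dual_W2_add:
  assumes "\<xi> \<in> dual (add_monoid (W2 (Fin 2)))" "v \<in> witt_F2" "w \<in> witt_F2"
  shows "\<xi> (witt_pair (v + w)) = \<xi> (witt_pair v) * \<xi> (witt_pair w)"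
proof -
  have "witt_pair v \<in> carrier (add_monoid (W2 (Fin 2)))" "witt_pair w \<in> carrier (add_monoid (W2 (Fin 2)))"
    using assms(2,3) by (simp_all add: witt_F2_def witt_pair_def W2_def)
  then have "\<xi> (witt_pair v \<otimes>\<^bsub>add_monoid (W2 (Fin 2))\<^esub> witt_pair w) = \<xi> (witt_pair v) * \<xi> (witt_pair w)"
    using assms(1) unfolding dual_def by blast
  then show ?thesis
    by (simp add: W2_add)
qed

lemma dual_W2_nz:
  assumes "\<xi> \<in> dual (add_monoid (W2 (Fin 2)))" "v \<in> witt_F2"
  shows "\<xi> (witt_pair v) \<noteq> 0"
  using assms by (auto simp: dual_def witt_F2_def witt_pair_def W2_def)

lemma arith_gal_witt_F2:
  assumes "\<sigma> \<in> arith_gal q" "v \<in> witt_F2" "q \<noteq> 0"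
  shows "map_witt \<sigma> (map_witt cst v) = map_witt cst v"
proof -
  have "x \<in> Fin q" if "x \<in> Fin 2" for x :: 'a
    using that assms(3) by (auto simp: Fin_2) (simp_all add: Fin_def)
  then show ?thesis
    using assms(1,2) by (cases v) (auto simp: arith_gal_def witt_F2_def)
qed

text \<open>Adds the characters to the covering. Condition \<open>c\<close> is the definition of the
  constant with the square root removed; in this form it is visibly stable under adding
  \<open>t\<close> to \<open>c\<close> and \<open>t ^ 2\<close> to \<open>\<alpha>\<close>.\<close>

locale witt_cover = cover n p m q e R fU F \<Delta> s0 \<alpha> \<alpha>' A
  for n p m q e :: nat and R fU F \<Delta> :: "'f::alg_closed_field poly" and s0 \<alpha> \<alpha>' :: 'f and A :: "('f \<times> 'f) set" +
  fixes aF :: "'f poly" and aW bW \<beta> c :: 'f and r :: "'f \<Rightarrow> 'f"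
    and \<psi> \<xi>U :: "'f \<Rightarrow> 'l::{field_char_0, alg_closed_field, metric_space}"
    and \<xi> \<xi>2 \<xi>W :: "'f \<times> 'f \<Rightarrow> 'l"
  assumes m: "m \<ge> 1"
    and aF: "additive_poly p aF" "poly_over (Fin q) aF"
      "Polynomial.monom 1 q + Polynomial.monom 1 1 = pcompose F aF"
    and W: "aW \<in> Fin p" "bW \<in> Fin p" "aW \<noteq> 0"
    and \<xi>2: "\<xi>2 \<in> dual (add_monoid (W2 (Fin 2)))"
    and \<xi>W: "v \<in> Fin p \<Longrightarrow> w \<in> Fin p \<Longrightarrow> \<xi>W (v, w) = W2_char \<xi>2 n (aW * v, bW * v ^ 2 + aW ^ 2 * w)"
    and \<psi>: "w \<in> Fin p \<Longrightarrow> \<psi> w = W2_char \<xi>2 n (0, aW ^ 2 * w)"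
    and \<beta>: "\<beta> \<in> Fin q" "x \<in> Fin q \<Longrightarrow> \<xi>U (r (poly aF x)) = \<psi> (field_trace p m (\<beta> * x))"
    and c: "(c + aW * \<beta>) ^ 2 = \<alpha> + bW / aW ^ 2"
    and \<xi>: "g \<in> A \<Longrightarrow> \<xi> g = \<xi>W (witt_pair (witt_of g)) * \<xi>U (r (fst g))"
begin

lemma q2: "q \<ge> 2"
  unfolding q using self_le_power[of p m] p2 m by linarith

lemma Fin_p_q: "x \<in> Fin p \<Longrightarrow> x \<in> Fin q"
  unfolding q by (rule Fin_iterate)

lemma c_Fin: "c + aW * \<beta> \<in> Fin q" "c \<in> Fin q"
proof -
  have "\<alpha> + bW / aW ^ 2 \<in> Fin q"
    using \<alpha>(3) Fin_p_q[OF W(1)] Fin_p_q[OF W(2)] unfolding q field_class.field_divide_inverse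
    by (intro Fin_add Fin_mult Fin_power Fin_inverse)
  then have "((c + aW * \<beta>) ^ q) ^ 2 = (c + aW * \<beta>) ^ 2"
    unfolding c[symmetric] by (simp add: Fin_def mult.commute flip: power_mult)
  then show d: "c + aW * \<beta> \<in> Fin q"
    using power_pow_eq_iff[of _ 1] by (simp add: Fin_def)
  have "c = (c + aW * \<beta>) + aW * \<beta>"
    by (simp add: char2 algebra_simps)
  then show "c \<in> Fin q"
    using d Fin_mult[OF Fin_p_q[OF W(1)] \<beta>(1)] unfolding q by (metis Fin_add)
qed

text \<open>With this choice of \<open>x\<close>, a Galois translation \<open>z \<mapsto> z + h\<close> acts by \<open>x \<mapsto> x + a(h)\<close>.\<close>

lemma generic_point:
  "\<exists>z x y. z ^ q + z = coord \<and> x = poly (map_poly cst aF) z \<and> (x, y) \<in> generic_fibre p R F"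
proof -
  obtain z :: "'f ffc" where z: "z ^ q + z = coord"
    using artin_schreier_solution q2 by blast
  define x where "x = poly (map_poly cst aF) z"
  obtain y where y: "y ^ p + y = x * poly Rc x"
    using artin_schreier_solution p2 by blast
  have "poly (map_poly cst (Polynomial.monom 1 q + Polynomial.monom 1 1)) z =
      poly (map_poly cst (pcompose F aF)) z"
    by (simp only: aF(3))
  then have "z ^ q + z = poly (map_poly cst F) x"
    by (simp add: cst.map_poly_add cst.map_poly_pcompose map_poly_monom cst.zero cst.one poly_monom
        poly_pcompose x_def)
  then have "(x, y) \<in> generic_fibre p R F"
    using y z by (simp add: generic_fibre_iff poly_Fc)
  with z show ?thesis
    unfolding x_def by blast
qed

text \<open>Both \<open>z\<close> and its image solve the same additive equation, so their sum is a
  root of X^q + X, whose roots are the constants in \<open>Fin q\<close>.\<close>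

lemma arith_gal_root_diff:
  fixes z :: "'f ffc"
  assumes \<sigma>: "\<sigma> \<in> arith_gal q" and z: "z ^ q + z = coord"
  shows "\<exists>h\<in>Fin q. \<sigma> z = z + cst h"
proof -
  interpret \<sigma>: field_map \<sigma>
    using \<sigma> by (intro field_auts_field_map) (simp add: arith_gal_def)
  have "\<sigma> (z ^ q + z) = z ^ q + z"
    using z \<sigma> by (simp add: arith_gal_def)
  then have eq: "\<sigma> z ^ q + \<sigma> z = z ^ q + z"
    by (simp add: \<sigma>.add \<sigma>.power)
  have "(z + \<sigma> z) ^ q + (z + \<sigma> z) = (z ^ q + z) + (\<sigma> z ^ q + \<sigma> z)"
    by (simp add: q K.add_pow algebra_simps)
  then have root: "(z + \<sigma> z) ^ q + (z + \<sigma> z) = 0"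
    by (simp add: eq K.char2)
  let ?P = "Polynomial.monom 1 q + Polynomial.monom 1 1 :: 'f poly"
  have "poly (map_poly cst ?P) (z + \<sigma> z) = 0"
    using root by (simp add: cst.map_poly_add map_poly_monom cst.zero cst.one poly_monom)
  moreover have "Polynomial.coeff ?P q = 1"
    using q2 by simp
  then have "?P \<noteq> 0"
    by (metis coeff_0 zero_neq_one)
  ultimately obtain h where h: "z + \<sigma> z = cst h"
    using root_in_range[OF cst.ring_map_axioms] by blast
  have "cst (h ^ q + h) = 0"
    using root unfolding h by (simp add: cst.add cst.power)
  then have "h \<in> Fin q"
    by (simp add: cst.eq_0_iff Fin_def add_eq_0_iff char2)
  moreover have "\<sigma> z = z + cst h"
    by (simp add: K.char2 flip: h)
  ultimately show ?thesis
    by blast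
qed

text \<open>\<open>T\<close> is compared with a solution \<open>T'\<close> of the same equation that
  is built from the generic point and on which the action of \<open>\<sigma>\<close> can be read
  off. They differ by a vector over the prime field, so \<open>\<sigma>\<close> moves both by the
  same amount.\<close>

theorem sheaf_char_witt:
  assumes \<sigma>: "\<sigma> \<in> arith_gal q"
    and T: "map_witt (\<lambda>x. x ^ 2) T - T = Witt (cst aW * coord) (cst (c * aW) * coord)"
  shows "\<exists>w\<in>witt_F2. map_witt \<sigma> T - T = map_witt cst w \<and>
    sheaf_char p e R F A \<xi> \<sigma> = inverse (\<xi>2 (witt_pair w))"
proof -
  interpret \<sigma>: field_map \<sigma>
    using \<sigma> by (intro field_auts_field_map) (simp add: arith_gal_def)
  have fixed: "\<sigma> (cst x) = cst x" if "x \<in> Fin q" for x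
    using \<sigma> that by (simp add: arith_gal_def)
  have \<sigma>_coord: "\<sigma> coord = coord"
    using \<sigma> by (simp add: arith_gal_def)
  note WFin = Fin_p_q[OF W(1)] Fin_p_q[OF W(2)]
  obtain z x y where z: "z ^ q + z = coord" and x: "x = poly (map_poly cst aF) z"
    and P: "(x, y) \<in> generic_fibre p R F"
    using generic_point by blast
  obtain h where h: "h \<in> Fin q" "\<sigma> z = z + cst h"
    using arith_gal_root_diff[OF \<sigma> z] by blast
  obtain a b where g: "(a, b) \<in> A" "\<sigma> x = x + cst a" "\<sigma> y = y + cst b + heis_f p e Rc x (cst a)"
    using generic_fibre_transitive[OF P arith_gal_generic_fibre[OF \<sigma> P]] by blast
  have "\<sigma> x = x + cst (poly aF h)"
    by (simp add: x arith_gal_poly[OF \<sigma> aF(2)] h(2) K.poly_additive[OF additive_poly_map_cst[OF aF(1)]]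
        cst.poly_map_poly)
  with g(2) have a: "a = poly aF h"
    by (simp add: cst.eq_iff)
  define k where "k = field_trace p m (\<beta> * h)"
  have \<beta>h: "\<beta> * h \<in> Fin q"
    by (rule Fin_mult[OF \<beta>(1) h(1)])
  have "k ^ p + k = (\<beta> * h) ^ q + \<beta> * h"
    unfolding k_def field_trace_def q by (rule telescope)
  also have "\<dots> = 0"
    using \<beta>h by (simp add: Fin_def char2)
  finally have k: "k \<in> Fin p"
    by (simp add: Fin_def add_eq_0_iff char2)
  \<comment> \<open>An Artin-Schreier root of \<open>cst \<beta> * coord\<close>, which
    \<open>\<sigma>\<close> moves by the trace of \<open>\<beta> * h\<close>. It carries the
    contribution of \<open>\<xi>U\<close>.\<close>
  define zt where "zt = (\<Sum>i<m. (cst \<beta> * z) ^ (p ^ i))"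
  have "cst \<beta> ^ q = cst \<beta>"
    using \<beta>(1) by (simp add: Fin_def flip: cst.power)
  then have zt_frob: "zt ^ p + zt = cst \<beta> * coord"
    unfolding zt_def K.telescope by (simp add: power_mult_distrib algebra_simps flip: z q)
  have "cst k = (\<Sum>i<m. (cst \<beta> * cst h) ^ (p ^ i))"
    by (simp add: k_def field_trace_def cst.sum cst.power cst.mult)
  then have zt_galois: "\<sigma> zt = zt + cst k"
    by (simp add: zt_def \<sigma>.sum \<sigma>.power \<sigma>.mult fixed[OF \<beta>(1)] h(2) distrib_left K.add_pow sum.distrib)
  \<comment> \<open>The root goes into the lower component with the factor \<open>aW ^ 2\<close>,
    because \<open>\<psi> w\<close> is the Witt character at \<open>(0, aW ^ 2 * w)\<close>. Both
    factors of \<open>\<xi>\<close> are then read from one Witt vector.\<close>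
  define U where "U = witt_scale (cst aW) (cst bW) (generic_witt (x, y)) + Witt 0 (cst (aW ^ 2) * zt)"
  define V where "V = witt_scale aW bW (witt_of (a, b)) + Witt 0 (aW ^ 2 * k)"
  have "map_witt \<sigma> U = U + map_witt cst V"
  proof -
    have "map_witt \<sigma> (generic_witt (x, y)) = map_witt cst (witt_of (a, b)) + generic_witt (x, y)"
      using generic_witt_galois[OF \<sigma> g] by (simp add: diff_eq_eq)
    moreover have "Witt 0 (cst (aW ^ 2) * (zt + cst k)) = Witt 0 (cst (aW ^ 2) * zt) + map_witt cst (Witt 0 (aW ^ 2 * k))"
      by (simp add: Witt_add cst.zero cst.mult algebra_simps)
    ultimately show ?thesis
      unfolding U_def V_def
      by (simp add: \<sigma>.map_witt_add \<sigma>.map_witt_scale cst.map_witt_add cst.map_witt_scale fixed WFin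
          K.witt_scale_add \<sigma>.zero \<sigma>.mult zt_galois Fin_power)
  qed
  then have U_galois: "map_witt \<sigma> U - U = map_witt cst V"
    by simp
  interpret Fp: ring_map "\<lambda>x::'f ffc. x ^ p"
    using K.ring_map_pow[of 1] by simp
  have cp: "cst aW ^ p = cst aW" "cst bW ^ p = cst bW" "cst (aW ^ 2) ^ p = cst (aW ^ 2)"
    using W Fin_power[OF W(1), of 2] by (simp_all add: Fin_def flip: cst.power)
  have "map_witt (\<lambda>x. x ^ p) U =
      U + witt_scale (cst aW) (cst bW) (Witt coord (cst \<alpha> * coord ^ 2)) + Witt 0 (cst (aW ^ 2 * \<beta>) * coord)"
  proof -
    have "map_witt (\<lambda>x. x ^ p) (generic_witt (x, y)) = Witt coord (cst \<alpha> * coord ^ 2) + generic_witt (x, y)"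
      using generic_witt_frob[OF P] by (simp add: diff_eq_eq)
    moreover have "zt ^ p = zt + cst \<beta> * coord"
      unfolding zt_frob[symmetric] by (simp add: K.char2 algebra_simps)
    then have "Witt 0 (cst (aW ^ 2) * zt ^ p) = Witt 0 (cst (aW ^ 2) * zt) + Witt 0 (cst (aW ^ 2 * \<beta>) * coord)"
      by (simp add: Witt_add cst.mult algebra_simps)
    ultimately show ?thesis
      unfolding U_def
      by (simp add: Fp.map_witt_add Fp.map_witt_scale cp K.witt_scale_add Fp.zero power_mult_distrib
          add_ac)
  qed
  then have U_frob: "map_witt (\<lambda>x. x ^ p) U - U =
      witt_scale (cst aW) (cst bW) (Witt coord (cst \<alpha> * coord ^ 2)) + Witt 0 (cst (aW ^ 2 * \<beta>) * coord)"
    by (simp add: add.assoc)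
  \<comment> \<open>The square root of the coefficient of \<open>coord ^ 2\<close> in the Frobenius
    difference of \<open>U\<close>; the root in the definition of \<open>c\<close> comes from
    here.\<close>
  define d where "d = aW * (c + aW * \<beta>)"
  have "d ^ 2 = aW ^ 2 * (\<alpha> + bW / aW ^ 2)"
    by (simp add: d_def power_mult_distrib c)
  then have d: "d ^ 2 = bW + aW ^ 2 * \<alpha>" "d \<in> Fin q"
    using W(3) Fin_mult[OF WFin(1) c_Fin(1)] by (simp_all add: d_def distrib_left)
  interpret F2: ring_map "\<lambda>x::'f ffc. x ^ 2"
    by (rule K.ring_map_square)
  \<comment> \<open>The trace passes from the \<open>p\<close>-th power map to squaring. The new
    summand cancels the quadratic term and leaves \<open>d * coord\<close>, which together with the
    term \<open>aW ^ 2 * \<beta> * coord\<close> of \<open>U\<close> is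
    \<open>c * aW * coord\<close>.\<close>
  define T' where "T' = witt_trace n U + Witt 0 (cst d * coord)"
  have "map_witt (\<lambda>x. x ^ 2) T' - T' =
      (map_witt (\<lambda>x. x ^ 2) (witt_trace n U) - witt_trace n U) +
      (Witt 0 ((cst d * coord) ^ 2) - Witt 0 (cst d * coord))"
    by (simp add: T'_def F2.map_witt_add)
  also have "\<dots> = (map_witt (\<lambda>x. x ^ p) U - U) + (Witt 0 ((cst d * coord) ^ 2) - Witt 0 (cst d * coord))"
    by (simp add: K.witt_trace_frob p)
  also have "Witt 0 ((cst d * coord) ^ 2) - Witt 0 (cst d * coord) =
      Witt 0 (cst (bW + aW ^ 2 * \<alpha>) * coord ^ 2 + cst d * coord)"
    by (simp add: diff_eq_eq Witt_add power_mult_distrib K.char2 flip: d(1) cst.power)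
  also have "(map_witt (\<lambda>x. x ^ p) U - U) + \<dots> = Witt (cst aW * coord) (cst (c * aW) * coord)"
    by (simp add: U_frob witt_scale_def Witt_add d_def cst.add cst.mult cst.power K.char2
        power2_eq_square algebra_simps)
  finally have "map_witt (\<lambda>x. x ^ 2) T - T = map_witt (\<lambda>x. x ^ 2) T' - T'"
    by (simp add: T)
  then have "T - T' \<in> witt_F2"
    by (rule K.witt_F2_diffI)
  then obtain v where v: "v \<in> witt_F2" "T - T' = map_witt cst v"
    using witt_F2_cst by blast
  have "map_witt \<sigma> (T - T') = T - T'"
    unfolding v(2) using arith_gal_witt_F2[OF \<sigma> v(1)] q2 by simp
  then have "map_witt \<sigma> T - T = map_witt \<sigma> T' - T'"
    by (simp add: \<sigma>.map_witt_diff algebra_simps)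
  also have "\<dots> = witt_trace n (map_witt \<sigma> U - U)"
    by (simp add: T'_def \<sigma>.map_witt_add \<sigma>.map_witt_trace K.witt_trace_diff \<sigma>.zero \<sigma>.mult fixed[OF d(2)] \<sigma>_coord)
  also have "\<dots> = map_witt cst (witt_trace n V)"
    by (simp add: U_galois cst.map_witt_trace)
  finally have galois: "map_witt \<sigma> T - T = map_witt cst (witt_trace n V)" .
  let ?w = "witt_of (a, b)"
  have w_Fin: "wfst ?w \<in> Fin p" "wsnd ?w \<in> Fin p"
    using witt_of_Fin[OF g(1)] by simp_all
  have "Fin p = Fin (p ^ 1)"
    by simp
  then have "wfst (witt_scale aW bW ?w) \<in> Fin p" "wsnd (witt_scale aW bW ?w) \<in> Fin p"
    using w_Fin W(1,2) unfolding witt_scale_def witt.sel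
    by (metis Fin_add Fin_mult Fin_power)+
  then have V1: "witt_trace n (witt_scale aW bW ?w) \<in> witt_F2"
    unfolding p by (rule witt_trace_F2)
  have "(0::'f) \<in> Fin p" "aW ^ 2 * k \<in> Fin p"
    using Fin_zero[of 1] by (simp_all add: Fin_mult Fin_power W(1) k)
  then have V2: "witt_trace n (Witt 0 (aW ^ 2 * k)) \<in> witt_F2"
    unfolding p by (intro witt_trace_F2) simp_all
  have V: "witt_trace n V = witt_trace n (witt_scale aW bW ?w) + witt_trace n (Witt 0 (aW ^ 2 * k))"
    by (simp add: V_def witt_trace_add)
  have "\<xi> (a, b) = \<xi>W (witt_pair ?w) * \<xi>U (r a)"
    using \<xi>[OF g(1)] by simp
  also have "\<xi>U (r a) = \<psi> k"
    using \<beta>(2)[OF h(1)] by (simp add: a k_def)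
  also have "\<dots> = \<xi>2 (witt_pair (witt_trace n (Witt 0 (aW ^ 2 * k))))"
    by (simp add: \<psi>[OF k] W2_char_witt_trace)
  also have "\<xi>W (witt_pair ?w) = \<xi>2 (witt_pair (witt_trace n (witt_scale aW bW ?w)))"
    by (simp add: witt_pair_def[of ?w] \<xi>W[OF w_Fin] W2_char_witt_trace witt_scale_def)
  finally have "\<xi> (a, b) = \<xi>2 (witt_pair (witt_trace n V))"
    by (simp add: V dual_W2_add[OF \<xi>2 V1 V2])
  then have "sheaf_char p e R F A \<xi> \<sigma> = inverse (\<xi>2 (witt_pair (witt_trace n V)))"
    using sheaf_char_eq[OF \<sigma> P g, where \<xi> = \<xi>] by simp
  moreover have "witt_trace n V \<in> witt_F2"
    unfolding V by (rule witt_F2_add[OF V1 V2])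
  ultimately show ?thesis
    using galois by blast
qed

text \<open>Galois elements move \<open>T\<close> by vectors that are themselves fixed, so these
  displacements add up under composition, and the character of \<open>W2\<close> turns sums into
  products.\<close>

lemma rank_one_sheaf_char:
  assumes "is_closure_of_Ql l TYPE('l)"
  shows "rank_one l q (sheaf_char p e R F A \<xi>)"
proof
  show "is_closure_of_Ql l TYPE('l)" "q > 0"
    using assms q2 by simp_all
next
  obtain T where T: "map_witt (\<lambda>x. x ^ 2) T - T = Witt (cst aW * coord) (cst (c * aW) * coord)"
    using witt_artin_schreier_solution[OF K.char] by blast
  fix \<sigma> :: "'f ffc \<Rightarrow> 'f ffc" assume \<sigma>: "\<sigma> \<in> arith_gal q"
  obtain v where v: "v \<in> witt_F2" "map_witt \<sigma> T - T = map_witt cst v"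
    "sheaf_char p e R F A \<xi> \<sigma> = inverse (\<xi>2 (witt_pair v))"
    using sheaf_char_witt[OF \<sigma> T] by blast
  show "sheaf_char p e R F A \<xi> \<sigma> \<noteq> 0"
    using dual_W2_nz[OF \<xi>2 v(1)] by (simp add: v(3))
  fix \<tau> :: "'f ffc \<Rightarrow> 'f ffc" assume \<tau>: "\<tau> \<in> arith_gal q"
  interpret \<sigma>: field_map \<sigma>
    using \<sigma> by (intro field_auts_field_map) (simp add: arith_gal_def)
  obtain w where w: "w \<in> witt_F2" "map_witt \<tau> T - T = map_witt cst w"
    "sheaf_char p e R F A \<xi> \<tau> = inverse (\<xi>2 (witt_pair w))"
    using sheaf_char_witt[OF \<tau> T] by blast
  obtain u where u: "u \<in> witt_F2" "map_witt (\<sigma> \<circ> \<tau>) T - T = map_witt cst u"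
    "sheaf_char p e R F A \<xi> (\<sigma> \<circ> \<tau>) = inverse (\<xi>2 (witt_pair u))"
    using sheaf_char_witt[OF arith_gal_comp[OF \<sigma> \<tau>] T] by blast
  have "map_witt (\<sigma> \<circ> \<tau>) T - T = map_witt \<sigma> (map_witt \<tau> T - T) + (map_witt \<sigma> T - T)"
    by (simp add: \<sigma>.map_witt_diff witt.map_comp)
  also have "\<dots> = map_witt cst (v + w)"
    using arith_gal_witt_F2[OF \<sigma> w(1)] q2 by (simp add: w(2) v(2) cst.map_witt_add add.commute)
  finally have "u = v + w"
    by (simp add: u(2) map_witt_cst_inj)
  then show "sheaf_char p e R F A \<xi> (\<sigma> \<circ> \<tau>) = sheaf_char p e R F A \<xi> \<sigma> * sheaf_char p e R F A \<xi> \<tau>"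
    by (simp add: u(3) v(3) w(3) dual_W2_add[OF \<xi>2 v(1) w(1)])
qed

end


section \<open>Translation of the affine line\<close>

theorem witt_cover_twist:
  fixes R :: "'f::alg_closed_field poly" and \<xi>2 :: "'f \<times> 'f \<Rightarrow> 'l::{field_char_0, alg_closed_field, metric_space}"
  assumes c1: "witt_cover n p m q e R fU F \<Delta> s0 \<alpha> \<alpha>' A aF aW bW \<beta> c r \<psi> \<xi>U \<xi> \<xi>2 \<xi>W"
    and c2: "witt_cover n p m q e Rt fU F \<Delta>t s0t \<alpha>t \<alpha>t' At aF aW bW \<beta> (c + t) r \<psi> \<xi>U \<xi>t \<xi>2 \<xi>W"
    and t: "t \<in> Fin q" and Ql: "is_closure_of_Ql l TYPE('l)"
  shows "tau p q e Rt F At \<xi>t = W2_char \<xi>2 (n * m) (t, t ^ 2 + c * t) * tau p q e R F A \<xi>"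
proof -
  interpret c1: witt_cover n p m q e R fU F \<Delta> s0 \<alpha> \<alpha>' A aF aW bW \<beta> c r \<psi> \<xi>U \<xi> \<xi>2 \<xi>W
    by (rule c1)
  interpret c2: witt_cover n p m q e Rt fU F \<Delta>t s0t \<alpha>t \<alpha>t' At aF aW bW \<beta> "c + t" r \<psi> \<xi>U \<xi>t \<xi>2 \<xi>W
    by (rule c2)
  define \<rho> where "\<rho> = sheaf_char p e R F A \<xi>"
  define \<rho>t where "\<rho>t = sheaf_char p e Rt F At \<xi>t"
  define \<eta> where "\<eta> w = \<xi>2 (witt_pair w)" for w
  have q: "q = 2 ^ (n * m)"
    by (simp add: c1.q c1.p power_mult)
  \<comment> \<open>Moving \<open>coord\<close> by this amount moves \<open>aW * coord\<close> by
    \<open>t\<close>.\<close>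
  define k where "k = t / aW"
  have k: "k \<in> Fin q"
    unfolding k_def field_class.field_divide_inverse
    by (intro Fin_mult Fin_inverse t c1.Fin_p_q c1.W(1))
  obtain \<Theta> :: "'f ffc \<Rightarrow> 'f ffc" where \<Theta>: "\<Theta> \<in> field_auts" "\<And>z. \<Theta> (cst z) = cst z" "\<Theta> coord = coord + cst k"
    using translation_automorphism by blast
  define \<Theta>' where "\<Theta>' = inv_into UNIV \<Theta>"
  interpret \<Theta>: field_map \<Theta>
    by (rule field_auts_field_map[OF \<Theta>(1)])
  have inv: "\<Theta> (\<Theta>' x) = x" "\<Theta>' (\<Theta> x) = x" for x
    unfolding \<Theta>'_def by (rule field_auts_inv_apply[OF \<Theta>(1)])+
  have \<Theta>'_aut: "\<Theta>' \<in> field_auts"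
    unfolding \<Theta>'_def by (rule field_auts_inv[OF \<Theta>(1)])
  interpret \<Theta>': field_map \<Theta>'
    by (rule field_auts_field_map[OF \<Theta>'_aut])
  have \<Theta>'_cst: "\<Theta>' (cst z) = cst z" for z
    using inv(2)[of "cst z"] by (simp add: \<Theta>(2))
  \<comment> \<open>Translations of the line are involutions in characteristic two, even if
    \<open>\<Theta>\<close> and its inverse differ on the closure.\<close>
  have "\<Theta> (coord + cst k) = coord"
    by (simp add: \<Theta>.add \<Theta>(2,3) add.assoc c1.K.char2)
  then have \<Theta>'_coord: "\<Theta>' coord = coord + cst k"
    using inv(2)[of "coord + cst k"] by simp
  have \<Theta>_line: "\<Theta> \<in> line_auts"
    using \<Theta> by (auto simp: line_auts_def image_image)

  obtain T where T: "map_witt (\<lambda>x. x ^ 2) T - T = Witt (cst aW * coord) (cst (c * aW) * coord)"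
    using witt_artin_schreier_solution[OF c1.K.char] by blast
  obtain Tt where Tt: "map_witt (\<lambda>x. x ^ 2) Tt - Tt = Witt (cst aW * coord) (cst ((c + t) * aW) * coord)"
    using witt_artin_schreier_solution[OF c1.K.char] by blast
  \<comment> \<open>A root over the constants: geometric elements fix it, and a lift of Frobenius
    moves it by the trace of \<open>(t, c * t)\<close>.\<close>
  obtain T0 where T0: "map_witt (\<lambda>x. x ^ 2) T0 - T0 = Witt t (c * t)"
    using witt_artin_schreier_solution[OF c1.char] by blast
  interpret sq: ring_map "\<lambda>x::'f ffc. x ^ 2"
    by (rule c1.K.ring_map_square)
  have "map_witt (\<lambda>x. x ^ 2) (map_witt \<Theta>' T) - map_witt \<Theta>' T =
      map_witt \<Theta>' (map_witt (\<lambda>x. x ^ 2) T - T)"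
    by (simp add: \<Theta>'.map_witt_diff witt.map_comp comp_def \<Theta>'.power)
  \<comment> \<open>With \<open>u = aW * coord\<close>, the value \<open>c * (u + t)\<close> equals
    \<open>(c + t) * u + c * t + t * u\<close>, and the last summand is the carry of the Witt
    addition.\<close>
  also have "\<dots> = Witt (cst aW * coord) (cst ((c + t) * aW) * coord) + map_witt cst (Witt t (c * t))"
    using c1.W(3)
    by (simp add: T \<Theta>'.mult \<Theta>'_cst \<Theta>'_coord Witt_add k_def distrib_left flip: cst.mult)
      (simp add: cst.add cst.mult c1.K.char2 algebra_simps)
  also have "\<dots> = map_witt (\<lambda>x. x ^ 2) (Tt + map_witt cst T0) - (Tt + map_witt cst T0)"
  proof -
    have "map_witt cst (Witt t (c * t)) = map_witt (\<lambda>x. x ^ 2) (map_witt cst T0) - map_witt cst T0"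
      unfolding T0[symmetric] by (simp add: cst.map_witt_diff witt.map_comp comp_def cst.power)
    then show ?thesis
      unfolding Tt[symmetric] by (simp add: sq.map_witt_add)
  qed
  finally have "map_witt \<Theta>' T - (Tt + map_witt cst T0) \<in> witt_F2"
    by (rule c1.K.witt_F2_diffI)
  then obtain v where v: "v \<in> witt_F2" "map_witt \<Theta>' T = Tt + map_witt cst T0 + map_witt cst v"
    using witt_F2_cst by (metis add.commute diff_add_cancel)

  \<comment> \<open>The characters at conjugate elements differ by the displacement of
    \<open>T0\<close>; the vector \<open>v\<close> drops out because it is fixed.\<close>
  have conj: "\<exists>w w'. w \<in> witt_F2 \<and> w' \<in> witt_F2 \<and> \<rho>t \<sigma> = inverse (\<eta> w) \<and>
      \<rho> (\<Theta> \<circ> \<sigma> \<circ> inv_into UNIV \<Theta>) = inverse (\<eta> w') \<and>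
      map_witt cst w' = map_witt cst w + (map_witt \<sigma> (map_witt cst T0) - map_witt cst T0)"
    if \<sigma>: "\<sigma> \<in> arith_gal q" for \<sigma>
  proof -
    interpret \<sigma>: field_map \<sigma>
      using \<sigma> by (intro field_auts_field_map) (simp add: arith_gal_def)
    let ?\<sigma> = "\<Theta> \<circ> \<sigma> \<circ> inv_into UNIV \<Theta>"
    have aut: "?\<sigma> \<in> field_auts"
      using \<sigma> \<Theta>(1) by (intro field_auts_conj) (simp_all add: arith_gal_def)
    have \<sigma>_cst: "\<sigma> ` range cst = range cst" "\<And>z. z \<in> Fin q \<Longrightarrow> \<sigma> (cst z) = cst z" "\<sigma> coord = coord"
      using \<sigma> by (simp_all add: arith_gal_def)
    have range: "?\<sigma> (cst z) = \<sigma> (cst z)" for z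
    proof -
      obtain z' where "\<sigma> (cst z) = cst z'"
        using \<sigma>_cst(1) by blast
      then show ?thesis
        by (simp add: \<Theta>'_cst \<Theta>(2) flip: \<Theta>'_def)
    qed
    have "?\<sigma> ` range cst = range cst"
      using \<sigma>_cst(1) by (simp only: image_image range)
    moreover have "?\<sigma> coord = coord"
      by (simp add: \<Theta>'_coord \<sigma>.add \<sigma>_cst k \<Theta>.add \<Theta>(2,3) add.assoc c1.K.char2 flip: \<Theta>'_def)
    ultimately have \<sigma>': "?\<sigma> \<in> arith_gal q"
      using aut \<sigma>_cst(2) range unfolding arith_gal_def by auto
    obtain w where w: "w \<in> witt_F2" "map_witt \<sigma> Tt - Tt = map_witt cst w" "\<rho>t \<sigma> = inverse (\<eta> w)"
      using c2.sheaf_char_witt[OF \<sigma> Tt] unfolding \<rho>t_def \<eta>_def by blast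
    obtain w' where w': "w' \<in> witt_F2" "map_witt ?\<sigma> T - T = map_witt cst w'" "\<rho> ?\<sigma> = inverse (\<eta> w')"
      using c1.sheaf_char_witt[OF \<sigma>' T] unfolding \<rho>_def \<eta>_def by blast
    have "map_witt cst w' = map_witt \<Theta>' (map_witt ?\<sigma> T - T)"
      unfolding w'(2) by (simp add: witt.map_comp comp_def \<Theta>'_cst)
    also have "\<dots> = map_witt \<sigma> (map_witt \<Theta>' T) - map_witt \<Theta>' T"
      by (simp add: \<Theta>'.map_witt_diff witt.map_comp comp_def inv flip: \<Theta>'_def)
    also have "\<dots> = (map_witt \<sigma> Tt - Tt) + (map_witt \<sigma> (map_witt cst T0) - map_witt cst T0)"
      using arith_gal_witt_F2[OF \<sigma> v(1)] c1.q2 by (simp add: v(2) \<sigma>.map_witt_add)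
    finally show ?thesis
      using w w' by (intro exI[of _ w] exI[of _ w']) (simp add: w(2))
  qed

  define u where "u = witt_trace (n * m) (Witt t (c * t))"
  have ct: "c * t \<in> Fin q" "t ^ 2 + c * t \<in> Fin q"
  proof -
    show "c * t \<in> Fin q"
      by (rule Fin_mult[OF c1.c_Fin(2) t])
    then show "t ^ 2 + c * t \<in> Fin q"
      using Fin_power[OF t, of 2] unfolding c1.q by (rule c1.Fin_add[rotated])
  qed
  have u: "u \<in> witt_F2"
    unfolding u_def using t ct by (intro c1.witt_trace_F2) (simp_all add: q)
  \<comment> \<open>\<open>(t, t ^ 2 + c * t)\<close> is the negative of \<open>(t, c * t)\<close>;
    the square is the correction in the negation of Witt vectors.\<close>
  define u' where "u' = witt_trace (n * m) (Witt t (t ^ 2 + c * t))"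
  have u': "u' \<in> witt_F2"
    unfolding u'_def using t ct by (intro c1.witt_trace_F2) (simp_all add: q)
  have "Witt t (t ^ 2 + c * t) + Witt t (c * t) = 0"
    by (simp add: Witt_add zero_witt_def c1.char2 power2_eq_square algebra_simps)
  then have "u' + u = witt_trace (n * m) 0"
    unfolding u_def u'_def by (simp flip: c1.witt_trace_add)
  then have uu: "u' + u = 0"
    using c1.witt_trace_diff[of "n * m" 0 0] by simp
  have mult: "\<eta> (v + w) = \<eta> v * \<eta> w" if "v \<in> witt_F2" "w \<in> witt_F2" for v w
    unfolding \<eta>_def by (rule dual_W2_add[OF c1.\<xi>2 that])
  have nz: "\<eta> w \<noteq> 0" if "w \<in> witt_F2" for w
    unfolding \<eta>_def by (rule dual_W2_nz[OF c1.\<xi>2 that])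
  have "(0 :: 'f witt) \<in> witt_F2"
    using c1.witt_F2_add[OF u' u] by (simp add: uu)
  then have "\<eta> 0 = 1"
    using mult[of 0 0] nz[of 0] by simp
  then have \<eta>u: "\<eta> u' = inverse (\<eta> u)"
    using mult[OF u' u] by (simp add: uu inverse_unique mult.commute)

  interpret rank_one_transport l q \<rho> \<rho>t \<Theta> "\<eta> u'"
  proof -
    interpret r: rank_one l q \<rho>
      unfolding \<rho>_def by (rule c1.rank_one_sheaf_char[OF Ql])
    interpret rt: rank_one l q \<rho>t
      unfolding \<rho>t_def by (rule c2.rank_one_sheaf_char[OF Ql])
    show "rank_one_transport l q \<rho> \<rho>t \<Theta> (\<eta> u')"
    proof
      show "\<Theta> \<in> line_auts"
        by (rule \<Theta>_line)
      show "\<eta> u' \<noteq> 0"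
        by (rule nz[OF u'])
    next
      fix \<sigma> :: "'f ffc \<Rightarrow> 'f ffc" assume \<sigma>: "\<sigma> \<in> geom_gal"
      then have "map_witt \<sigma> (map_witt cst T0) = map_witt cst T0"
        by (simp add: witt.map_comp comp_def geom_gal_def)
      then show "\<rho>t \<sigma> = \<rho> (\<Theta> \<circ> \<sigma> \<circ> inv_into UNIV \<Theta>)"
        using conj[OF geom_gal_arith_gal[OF \<sigma>]] by (auto simp: map_witt_cst_inj)
    next
      fix \<phi> :: "'f ffc \<Rightarrow> 'f ffc" assume \<phi>: "\<phi> \<in> arith_frob_lifts q"
      then have \<phi>_cst: "\<phi> (cst z) = cst (z ^ q)" and \<phi>_coord: "\<phi> coord = coord" and \<phi>_aut: "\<phi> \<in> field_auts" for z
        by (simp_all add: arith_frob_lifts_def)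
      interpret \<phi>: field_map \<phi>
        by (rule field_auts_field_map[OF \<phi>_aut])
      have "\<phi> \<in> arith_gal q"
        using arith_frob_lifts_arith_gal[OF \<phi>] c1.q2 by simp
      from conj[OF this] obtain w w' where w: "w \<in> witt_F2" "w' \<in> witt_F2" "\<rho>t \<phi> = inverse (\<eta> w)"
        "\<rho> (\<Theta> \<circ> \<phi> \<circ> inv_into UNIV \<Theta>) = inverse (\<eta> w')"
        "map_witt cst w' = map_witt cst w + (map_witt \<phi> (map_witt cst T0) - map_witt cst T0)"
        by blast
      have "map_witt \<phi> (map_witt cst T0) - map_witt cst T0 = map_witt cst (map_witt (\<lambda>x. x ^ q) T0 - T0)"
        by (simp add: cst.map_witt_diff witt.map_comp comp_def \<phi>_cst)
      also have "map_witt (\<lambda>x. x ^ q) T0 - T0 = map_witt (\<lambda>x. x ^ 2) (witt_trace (n * m) T0) - witt_trace (n * m) T0"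
        by (simp add: c1.witt_trace_frob q)
      also have "\<dots> = u"
        by (simp add: u_def ring_map.map_witt_trace[OF c1.ring_map_square] flip: c1.witt_trace_diff T0)
      finally have "w' = w + u"
        using w(5) by (simp add: map_witt_cst_inj flip: cst.map_witt_add)
      then show "\<rho> (\<Theta> \<circ> \<phi> \<circ> inv_into UNIV \<Theta>) = \<eta> u' * \<rho>t \<phi>"
        using mult[OF w(1) u] w(3,4) by (simp add: \<eta>u)
      show "\<Theta> \<circ> \<phi> \<circ> inv_into UNIV \<Theta> \<in> arith_frob_lifts q"
        using \<phi>_aut \<Theta>(1) k \<Theta>'_aut
        by (simp add: arith_frob_lifts_def field_auts_comp \<Theta>'_cst \<Theta>'_coord \<phi>_cst \<phi>_coord \<Theta>(2,3)
            \<phi>.add \<Theta>.add Fin_def add.assoc c1.K.char2 flip: \<Theta>'_def)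
      show "inv_into UNIV \<Theta> \<circ> \<phi> \<circ> \<Theta> \<in> arith_frob_lifts q"
        using \<phi>_aut \<Theta>(1) k \<Theta>'_aut
        by (simp add: arith_frob_lifts_def field_auts_comp \<Theta>'_cst \<Theta>'_coord \<phi>_cst \<phi>_coord \<Theta>(2,3)
            \<phi>.add \<Theta>'.add Fin_def add.assoc c1.K.char2 flip: \<Theta>'_def)
    qed
  qed
  have "(x + y) ^ q = x ^ q + y ^ q" for x y :: 'f
    by (simp add: c1.q c1.add_pow)
  then have "arith_frob_lifts q \<noteq> ({} :: ('f ffc \<Rightarrow> 'f ffc) set)"
    using c1.q2 by (intro arith_frob_lifts_nonempty) simp_all
  then have "frob_eigenvalue q \<rho>t = \<eta> u' * frob_eigenvalue q \<rho>"
    by (rule frob_eigenvalue_transport)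
  then show ?thesis
    by (simp add: tau_def \<rho>_def \<rho>t_def \<eta>_def u'_def W2_char_witt_trace)
qed


section \<open>Maximal abelian subgroups of the Heisenberg group\<close>

context char_two
begin

text \<open>By \<open>heis_f_frob\<close> the cocycle supplies exactly the cross terms of
  \<open>(a + a') * poly R (a + a')\<close>.\<close>

lemma heis_mult_closed:
  assumes R: "additive_poly p R" "Polynomial.degree R \<le> p ^ e"
    and "(a, b) \<in> carrier (heis p e R)" "(a', b') \<in> carrier (heis p e (R :: 'a poly))"
  shows "(a + a', b + b' + heis_f p e R a a') \<in> carrier (heis p e R)"
proof -
  have a: "a \<in> heis_V p e R" "a' \<in> heis_V p e R"
    and b: "b ^ p + b = a * poly R a" "b' ^ p + b' = a' * poly R a'"
    using assms(3,4) by (simp_all add: heis_def char2)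
  let ?h = "heis_f p e R a a'"
  have "(b + b' + ?h) ^ p + (b + b' + ?h) = (b ^ p + b) + (b' ^ p + b') + (?h ^ p + ?h)"
    by (simp add: add_pow_p algebra_simps)
  also have "\<dots> = (a + a') * poly R (a + a')"
    unfolding b heis_f_frob[OF R a(2)] by (simp add: poly_additive[OF R(1)] algebra_simps)
  finally show ?thesis
    using heis_V_add[OF R(1) a] by (simp add: heis_def char2)
qed

text \<open>\<open>subgroup\<close> refers to inverses; their value is determined directly from the
  definite description, with both components read off from the multiplication.\<close>

lemma heis_inv:
  assumes R: "additive_poly p R" "Polynomial.degree R \<le> p ^ e"
    and ab: "(a, b) \<in> carrier (heis p e (R :: 'a poly))"
  shows "inv\<^bsub>heis p e R\<^esub> (a, b) = (a, b + heis_f p e R a a)"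
    and "(a, b + heis_f p e R a a) \<in> carrier (heis p e R)"
proof -
  let ?h = "heis_f p e R a a"
  have a: "a \<in> heis_V p e R" and b: "b ^ p + b = a * poly R a"
    using ab by (simp_all add: heis_def char2)
  have "(b + ?h) ^ p + (b + ?h) = (b ^ p + b) + (?h ^ p + ?h)"
    by (simp add: add_pow_p algebra_simps)
  also have "\<dots> = a * poly R a"
    unfolding b heis_f_frob[OF R a] by (simp add: char2)
  finally show mem: "(a, b + ?h) \<in> carrier (heis p e R)"
    using a by (simp add: heis_def char2)
  show "inv\<^bsub>heis p e R\<^esub> (a, b) = (a, b + ?h)"
    unfolding m_inv_def
  proof (rule the_equality)
    show "(a, b + ?h) \<in> carrier (heis p e R) \<and>
        (a, b) \<otimes>\<^bsub>heis p e R\<^esub> (a, b + ?h) = \<one>\<^bsub>heis p e R\<^esub> \<and>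
        (a, b + ?h) \<otimes>\<^bsub>heis p e R\<^esub> (a, b) = \<one>\<^bsub>heis p e R\<^esub>"
      using mem by (simp add: heis_def char2 algebra_simps)
    fix y assume y: "y \<in> carrier (heis p e R) \<and> (a, b) \<otimes>\<^bsub>heis p e R\<^esub> y = \<one>\<^bsub>heis p e R\<^esub> \<and>
        y \<otimes>\<^bsub>heis p e R\<^esub> (a, b) = \<one>\<^bsub>heis p e R\<^esub>"
    obtain a' b' where ab': "y = (a', b')"
      by (cases y)
    have "a + a' = 0" "b + b' + heis_f p e R a a' = 0"
      using y by (simp_all add: ab' heis_def)
    moreover from this have "a' = a"
      by (simp add: add_eq_0_iff char2)
    ultimately have "b' = b + ?h"
      by (metis char2(2) add.commute add.left_commute add.right_neutral)
    then show "y = (a, b + ?h)"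
      by (simp add: ab' \<open>a' = a\<close>)
  qed
qed

text \<open>Whether two elements commute depends only on their first coordinates. So the full
  preimage \<open>B\<close> of the projection of \<open>A\<close> is again an abelian subgroup, and
  maximality makes it equal to \<open>A\<close>.\<close>

lemma maximal_abelian_subgroup_heis:
  assumes R: "additive_poly p R" "Polynomial.degree R \<le> p ^ e"
    and A: "maximal_abelian_subgroup A (heis p e (R :: 'a poly))"
  shows "A = {(a, b) \<in> carrier (heis p e R). a \<in> fst ` A}"
    and "a \<in> fst ` A \<Longrightarrow> a' \<in> fst ` A \<Longrightarrow> heis_f p e R a a' = heis_f p e R a' a"
    and "fst ` A \<subseteq> heis_V p e R"
proof -
  let ?G = "heis p e R"
  define B where "B = {(a, b) \<in> carrier ?G. a \<in> fst ` A}"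
  have sub: "subgroup A ?G" and comm: "\<And>x y. x \<in> A \<Longrightarrow> y \<in> A \<Longrightarrow> x \<otimes>\<^bsub>?G\<^esub> y = y \<otimes>\<^bsub>?G\<^esub> x"
    using A by (auto simp: maximal_abelian_subgroup_def abelian_subgroup_def)
  have AG: "A \<subseteq> carrier ?G"
    using sub by (rule subgroup.subset)
  then show V: "fst ` A \<subseteq> heis_V p e R"
    by (auto simp: heis_def)
  have sym: "heis_f p e R a a' = heis_f p e R a' a" if aa: "a \<in> fst ` A" "a' \<in> fst ` A" for a a'
  proof -
    obtain b b' where "(a, b) \<in> A" "(a', b') \<in> A"
      using aa by auto
    from comm[OF this] show ?thesis
      by (simp add: heis_def algebra_simps)
  qed
  then show "a \<in> fst ` A \<Longrightarrow> a' \<in> fst ` A \<Longrightarrow> heis_f p e R a a' = heis_f p e R a' a"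
    by blast
  have fst_add: "a + a' \<in> fst ` A" if aa: "a \<in> fst ` A" "a' \<in> fst ` A" for a a'
  proof -
    obtain b b' where "(a, b) \<in> A" "(a', b') \<in> A"
      using aa by auto
    from subgroup.m_closed[OF sub this] show ?thesis
      by (force simp: heis_def)
  qed
  have "subgroup B ?G"
  proof
    show "B \<subseteq> carrier ?G"
      by (auto simp: B_def)
    show "\<one>\<^bsub>?G\<^esub> \<in> B"
      using subgroup.one_closed[OF sub] AG by (force simp: B_def heis_def)
    show "x \<otimes>\<^bsub>?G\<^esub> y \<in> B" if "x \<in> B" "y \<in> B" for x y
    proof -
      obtain a b a' b' where "x = (a, b)" "y = (a', b')"
        by (cases x; cases y)
      moreover have "(a, b) \<otimes>\<^bsub>?G\<^esub> (a', b') = (a + a', b + b' + heis_f p e R a a')"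
        by (simp add: heis_def)
      ultimately show ?thesis
        using that heis_mult_closed[OF R, of a b a' b'] fst_add by (simp add: B_def)
    qed
    show "inv\<^bsub>?G\<^esub> x \<in> B" if "x \<in> B" for x
      using that heis_inv[OF R] by (cases x) (simp add: B_def)
  qed
  moreover have "x \<otimes>\<^bsub>?G\<^esub> y = y \<otimes>\<^bsub>?G\<^esub> x" if "x \<in> B" "y \<in> B" for x y
  proof -
    obtain a b a' b' where xy: "x = (a, b)" "y = (a', b')"
      by (cases x; cases y)
    then have "heis_f p e R a a' = heis_f p e R a' a"
      using that by (intro sym) (simp_all add: B_def)
    then show ?thesis
      by (simp add: xy heis_def algebra_simps)
  qed
  ultimately have "abelian_subgroup B ?G"
    by (simp add: abelian_subgroup_def)
  moreover have "A \<subseteq> B"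
    using AG by (force simp: B_def)
  ultimately have "B = A"
    using A by (simp add: maximal_abelian_subgroup_def)
  then show "A = {(a, b) \<in> carrier ?G. a \<in> fst ` A}"
    by (simp add: B_def)
qed

section \<open>Adding a linear term to \<open>R\<close>\<close>

lemma coeff_add_linear:
  "Polynomial.coeff (R + Polynomial.monom w 1) (p ^ i) = Polynomial.coeff R (p ^ i) + (if i = 0 then w else (0::'a))"
proof -
  have "1 = p ^ i \<longleftrightarrow> i = 0"
    using p2 by (cases i) auto
  then show ?thesis
    by (simp only: Polynomial.coeff_add coeff_monom)
qed

text \<open>The linear term contributes the same sum twice, once through the coefficient of index 0
  and once through the value of the polynomial at \<open>y\<close>; the copies cancel.\<close>

lemma heis_f_add_linear:
  "heis_f p e (R + Polynomial.monom w 1) x y = heis_f p e R x (y::'a)"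
proof -
  let ?R = "R + Polynomial.monom w 1"
  have "(\<Sum>j<e - i. (Polynomial.coeff ?R (p ^ i) * x ^ (p ^ i) * y) ^ (p ^ j)) =
      (\<Sum>j<e - i. (Polynomial.coeff R (p ^ i) * x ^ (p ^ i) * y) ^ (p ^ j)) +
      (if i = 0 then \<Sum>j<e. (w * x * y) ^ (p ^ j) else 0)" for i
    using p2 by (simp only: coeff_add_linear) (simp add: distrib_right add_pow sum.distrib zero_power)
  then have "(\<Sum>i<e. \<Sum>j<e - i. (Polynomial.coeff ?R (p ^ i) * x ^ (p ^ i) * y) ^ (p ^ j)) =
      (\<Sum>i<e. \<Sum>j<e - i. (Polynomial.coeff R (p ^ i) * x ^ (p ^ i) * y) ^ (p ^ j)) +
      (\<Sum>j<e. (w * x * y) ^ (p ^ j))"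
    by (simp add: sum.distrib sum.delta)
  moreover have "(\<Sum>i<e. (x * poly ?R y) ^ (p ^ i)) =
      (\<Sum>i<e. (x * poly R y) ^ (p ^ i)) + (\<Sum>j<e. (w * x * y) ^ (p ^ j))"
  proof -
    have "x * poly ?R y = x * poly R y + w * x * y"
      by (simp add: poly_monom algebra_simps)
    then show ?thesis
      by (simp add: add_pow sum.distrib)
  qed
  ultimately show ?thesis
    by (simp add: heis_f_eq char2 add_ac)
qed

text \<open>Again two equal contributions, \<open>(w * x) ^ (p ^ e)\<close>, one from each part of
  the defining polynomial.\<close>

lemma heis_V_add_linear: "heis_V p e (R + Polynomial.monom w 1) = (heis_V p e R :: 'a set)"
proof -
  let ?R = "R + Polynomial.monom w 1"
  have "(Polynomial.coeff ?R (p ^ i) * x) ^ (p ^ (e - i)) =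
      (Polynomial.coeff R (p ^ i) * x) ^ (p ^ (e - i)) + (if i = 0 then (w * x) ^ (p ^ e) else 0)" for i x
    using p2 by (simp only: coeff_add_linear) (simp add: distrib_right add_pow zero_power)
  then have "(\<Sum>i\<le>e. (Polynomial.coeff ?R (p ^ i) * x) ^ (p ^ (e - i))) =
      (\<Sum>i\<le>e. (Polynomial.coeff R (p ^ i) * x) ^ (p ^ (e - i))) + (w * x) ^ (p ^ e)" for x
    by (simp add: sum.distrib sum.delta)
  moreover have "poly ?R x ^ (p ^ e) = poly R x ^ (p ^ e) + (w * x) ^ (p ^ e)" for x
    by (simp add: poly_monom add_pow)
  ultimately show ?thesis
    by (simp add: heis_V_def char2 add_ac)
qed

lemma poly_over_add:
  "poly_over (Fin (p ^ k)) P \<Longrightarrow> poly_over (Fin (p ^ k)) Q \<Longrightarrow> poly_over (Fin (p ^ k)) (P + Q :: 'a poly)"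
  by (simp add: poly_over_def Fin_add)

lemma Fin_sum: "(\<And>i. i \<in> S \<Longrightarrow> f i \<in> Fin (p ^ k)) \<Longrightarrow> (\<Sum>i\<in>S. f i) \<in> (Fin (p ^ k) :: 'a set)"
  by (induction S rule: infinite_finite_induct) (simp_all add: Fin_zero Fin_add)

lemma poly_over_mult:
  "poly_over (Fin (p ^ k)) P \<Longrightarrow> poly_over (Fin (p ^ k)) Q \<Longrightarrow> poly_over (Fin (p ^ k)) (P * Q :: 'a poly)"
  by (simp add: poly_over_def coeff_mult Fin_sum Fin_mult)

lemma poly_over_power:
  "poly_over (Fin (p ^ k)) P \<Longrightarrow> poly_over (Fin (p ^ k)) (P ^ j :: 'a poly)"
proof (induction j)
  case 0
  have "(1::'a) \<in> Fin (p ^ k)"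
    by (simp add: Fin_def)
  then show ?case
    by (simp add: poly_over_def Fin_zero)
qed (simp add: poly_over_mult)

end

lemma pcompose_monom: "pcompose (Polynomial.monom c k) P = Polynomial.smult c (P ^ k)"
  for P :: "'a::comm_semiring_1 poly"
  by (induction k) (simp_all add: monom_0 monom_Suc pcompose_pCons)

section \<open>The original data and the twisted data both form a Witt covering\<close>

theorem theorem1p2:
  fixes l n m p q e :: nat
    and R fU S \<Delta> F aF \<Delta>t Rt :: "'f::alg_closed_field poly"
    and A At :: "('f \<times> 'f) set" and Abar Ubar :: "'f set"
    and s0 \<alpha> aW bW \<beta> c t :: 'f and r :: "'f \<Rightarrow> 'f"
    and \<psi> \<xi>U :: "'f \<Rightarrow> 'l::{field_char_0, alg_closed_field, metric_space}"
    and \<xi> \<xi>t \<xi>2 \<xi>W :: "'f \<times> 'f \<Rightarrow> 'l"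
  assumes "is_closure_of_F2 TYPE('f)"
    and "Factorial_Ring.prime l" "l \<noteq> 2" "is_closure_of_Ql l TYPE('l)"
    and "n \<ge> 1" "p = 2 ^ n" "m \<ge> 1" "q = p ^ m"
    and "e \<ge> 1" "linearized p q R" "Polynomial.degree R = p ^ e"
    and "maximal_abelian_subgroup A (heis p e R)" "A \<subseteq> Fin q \<times> Fin q"
    and "Abar = fst ` A" "Ubar = {a \<in> Abar. heis_f p e R a a = 0}"
    and "linearized p q fU" "separable_poly fU" "Ubar = Ker fU"
    and "F = fU ^ p + fU" "Abar = Ker F"
    and "s0 \<in> Fin q" "S = Polynomial.monom 1 p + Polynomial.monom s0 1"
    and "poly_over (Fin q) \<Delta>" "poly \<Delta> 0 = 0"
    and "\<Delta> ^ p + \<Delta> = [:0, 1:] * R + fU * pcompose S fU"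
    and "\<alpha> \<in> Fin q" "rad p \<alpha> + \<alpha> = s0 + 1"
    and "\<forall>x\<in>Abar. \<forall>y\<in>Abar. r (x + y) = r x + r y"
    and "\<forall>k\<in>Fin p. \<forall>x\<in>Abar. r (k * x) = k * r x"
    and "r ` Abar \<subseteq> Ubar" "\<forall>u\<in>Ubar. r u = u"
    and "\<xi>2 \<in> dual (add_monoid (W2 (Fin 2)))" "inj_on \<xi>2 (carrier (W2 (Fin 2)))"
    and "\<psi> \<in> dual (additive_group (Fin p))" "\<exists>x\<in>Fin p. \<psi> x \<noteq> 1"
    and "\<xi> \<in> dual (heis p e R \<lparr>carrier := A\<rparr>)" "\<forall>k\<in>Fin p. \<xi> (0, k) = \<psi> k"
    and "\<xi>W \<in> dual (add_monoid (W2 (Fin p)))" "\<xi>U \<in> dual (additive_group Ubar)"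
    and "\<forall>g\<in>A. \<xi> g = (box_char \<xi>W \<xi>U \<circ> phi p fU \<Delta> \<alpha> r) g"
    and "(aW, bW) \<in> Units (W2 (Fin p))"
    and "\<forall>u\<in>carrier (W2 (Fin p)). \<xi>W u = W2_char \<xi>2 n ((aW, bW) \<otimes>\<^bsub>W2 (Fin p)\<^esub> u)"
    and "linearized p q aF" "Polynomial.monom 1 q + Polynomial.monom 1 1 = pcompose aF F"
    and "pcompose aF F = pcompose F aF"
    and "\<beta> \<in> Fin q" "\<forall>x\<in>Fin q. \<xi>U (r (poly aF x)) = \<psi> (field_trace p m (\<beta> * x))"
    and "c = rad 2 (\<alpha> + bW / aW ^ 2) + aW * \<beta>"
    and "t \<in> Fin q" "Rt = R + Polynomial.monom (F_star p e F t ^ 2) 1"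
    and "At = {(a, b) \<in> carrier (heis p e Rt). a \<in> Abar}"
    and "poly_over (Fin q) \<Delta>t" "poly \<Delta>t 0 = 0"
    and "\<Delta>t ^ p + \<Delta>t = [:0, 1:] * Rt
           + fU * pcompose (S + Polynomial.monom ((rad p t + t) ^ 2) 1) fU"
    and "\<xi>t = box_char \<xi>W \<xi>U \<circ> phi p fU \<Delta>t (t ^ 2 + \<alpha>) r"
  shows "tau p q e Rt F At \<xi>t
       = W2_char \<xi>2 (n * m) (t, t ^ 2 + c * t) * tau p q e R F A \<xi>"
proof -
  note p = \<open>p = 2 ^ n\<close> and q = \<open>q = p ^ m\<close>
  have char: "CHAR('f) = 2"
    using \<open>is_closure_of_F2 TYPE('f)\<close> by (simp add: is_closure_of_F2_def)
  interpret char_two "TYPE('f)" n p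
    by unfold_locales (fact char, fact, fact)
  have R: "additive_poly p R" "Polynomial.degree R \<le> p ^ e" "poly_over (Fin q) R"
    using \<open>linearized p q R\<close> \<open>Polynomial.degree R = p ^ e\<close>
    by (simp_all add: linearized_additive_poly) (simp add: linearized_def)
  have fU: "additive_poly p fU" "poly_over (Fin q) fU"
    using \<open>linearized p q fU\<close> by (simp_all add: linearized_additive_poly) (simp add: linearized_def)
  have aF: "additive_poly p aF" "poly_over (Fin q) aF"
    using \<open>linearized p q aF\<close> by (simp_all add: linearized_additive_poly) (simp add: linearized_def)
  note A_max = maximal_abelian_subgroup_heis[OF R(1,2) \<open>maximal_abelian_subgroup A (heis p e R)\<close>]
  note Abar = \<open>Abar = fst ` A\<close> and KerF = \<open>Abar = Ker F\<close>
  have KerF_Fin: "Ker F \<subseteq> Fin q" and KerF_V: "Ker F \<subseteq> heis_V p e R"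
    using \<open>A \<subseteq> Fin q \<times> Fin q\<close> A_max(3) unfolding KerF[symmetric] Abar by auto
  have sym: "heis_f p e R a a' = heis_f p e R a' a" if "a \<in> Ker F" "a' \<in> Ker F" for a a'
    using that A_max(2) unfolding KerF[symmetric] Abar by blast
  have A: "A = {(a, b) \<in> carrier (heis p e R). a \<in> Ker F}"
    using A_max(1) unfolding KerF[symmetric] Abar .
  have aF_eq: "Polynomial.monom 1 q + Polynomial.monom 1 1 = pcompose F aF"
    using \<open>Polynomial.monom 1 q + Polynomial.monom 1 1 = pcompose aF F\<close>
      \<open>pcompose aF F = pcompose F aF\<close> by simp
  have "q > 1"
    using p2 \<open>m \<ge> 1\<close> unfolding q by (intro one_less_power) simp_all
  then have "Polynomial.coeff (Polynomial.monom 1 q + Polynomial.monom (1::'f) 1) q = 1"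
    by simp
  \<comment> \<open>\<open>F\<close> cannot vanish because its composite with \<open>aF\<close> is
    x^q + x.\<close>
  then have "pcompose F aF \<noteq> 0"
    unfolding aF_eq[symmetric] by (metis coeff_0 zero_neq_one)
  then have F0: "F \<noteq> 0"
    by (metis pcompose_0)
  have rad_p: "rad p u ^ p = u" "v ^ p = u \<Longrightarrow> rad p u = v" for u v :: 'f
    unfolding p by (rule rad_pow2[OF char], rule rad_pow2(2)[OF char])
  have rad_Fin: "rad (2 ^ k) u \<in> Fin q" if "u \<in> Fin q" for u :: 'f and k
  proof -
    have "(rad (2 ^ k) u ^ q) ^ (2 ^ k) = (rad (2 ^ k) u ^ (2 ^ k)) ^ q"
      by (simp only: mult.commute flip: power_mult)
    also have "\<dots> = rad (2 ^ k) u ^ (2 ^ k)"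
      using that unfolding rad_pow2(1)[OF char] by (simp add: Fin_def)
    finally show ?thesis
      by (simp add: power_pow_eq_iff Fin_def)
  qed
  have rad_p_Fin: "rad p u \<in> Fin q" if "u \<in> Fin q" for u :: 'f
    unfolding p by (rule rad_Fin[OF that])

  have W: "aW \<in> Fin p" "bW \<in> Fin p" "aW \<noteq> 0"
    using \<open>(aW, bW) \<in> Units (W2 (Fin p))\<close> by (auto simp: Units_def W2_def)
  have \<xi>W: "\<xi>W (v, w) = W2_char \<xi>2 n (aW * v, bW * v ^ 2 + aW ^ 2 * w)" if "v \<in> Fin p" "w \<in> Fin p" for v w
    using \<open>\<forall>u\<in>carrier (W2 (Fin p)). \<xi>W u = W2_char \<xi>2 n ((aW, bW) \<otimes>\<^bsub>W2 (Fin p)\<^esub> u)\<close> that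
    by (simp add: W2_def)
  have zero_Fin: "(0::'f) \<in> Fin p"
    using Fin_zero[of 1] by simp
  have fU0: "poly fU 0 = 0" and F00: "poly F 0 = 0"
    using poly_additive_0[OF fU(1)] p2 by (simp_all add: \<open>F = fU ^ p + fU\<close>)
  have r0: "r 0 = 0"
    using \<open>\<forall>u\<in>Ubar. r u = u\<close> fU0 unfolding \<open>Ubar = Ker fU\<close> by (simp add: Ker_def)
  have "0 \<in> Ubar"
    using fU0 by (simp add: \<open>Ubar = Ker fU\<close> Ker_def)
  moreover have "\<forall>x\<in>Ubar. \<xi>U x \<noteq> 0" "\<forall>x\<in>Ubar. \<forall>y\<in>Ubar. \<xi>U (x + y) = \<xi>U x * \<xi>U y"
    using \<open>\<xi>U \<in> dual (additive_group Ubar)\<close> by (simp_all add: dual_def additive_group_def)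
  ultimately have \<xi>U0: "\<xi>U 0 = 1"
    by (metis add_0 mult_cancel_left2)
  have \<xi>: "\<xi> (a, b) = \<xi>W (poly fU a, b + poly \<Delta> a + rad p \<alpha> * poly fU a ^ 2) * \<xi>U (r a)" if "(a, b) \<in> A" for a b
    using \<open>\<forall>g\<in>A. \<xi> g = (box_char \<xi>W \<xi>U \<circ> phi p fU \<Delta> \<alpha> r) g\<close> that by (simp add: box_char_def phi_def)
  \<comment> \<open>Evaluate \<open>\<xi>\<close> at the central element \<open>(0, w)\<close>: its
    Witt component is \<open>(0, w)\<close>, and \<open>\<xi>U\<close> takes the value 1
    there.\<close>
  have \<psi>: "\<psi> w = W2_char \<xi>2 n (0, aW ^ 2 * w)" if "w \<in> Fin p" for w
  proof -
    have "0 \<in> Ker F"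
      by (simp add: Ker_def F00)
    then have "(0, w) \<in> A"
      using that KerF_V unfolding A by (auto simp: heis_def Fin_def)
    then show ?thesis
      using \<open>\<forall>k\<in>Fin p. \<xi> (0, k) = \<psi> k\<close> that \<xi>[of 0 w]
      by (simp add: fU0 \<open>poly \<Delta> 0 = 0\<close> r0 \<xi>U0 \<xi>W zero_Fin)
  qed

  define w where "w = F_star p e F t ^ 2"
  have Rt: "Rt = R + Polynomial.monom w 1"
    by (simp add: w_def \<open>Rt = _\<close>)
  have F_over: "poly_over (Fin q) F"
    unfolding q \<open>F = fU ^ p + fU\<close> using fU(2)[unfolded q] by (intro poly_over_add poly_over_power)
  have "F_star p e F t \<in> Fin q"
    unfolding F_star_def q
  proof (rule Fin_sum)
    fix i
    have "rad (2 ^ (n * i)) (Polynomial.coeff F (p ^ i) * t) \<in> Fin q"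
      using F_over \<open>t \<in> Fin q\<close> by (intro rad_Fin Fin_mult) (simp_all add: poly_over_def)
    moreover have "2 ^ (n * i) = p ^ i"
      by (simp only: p power_mult)
    ultimately show "rad (p ^ i) (Polynomial.coeff F (p ^ i) * t) \<in> Fin (p ^ m)"
      by (simp only: q)
  qed
  then have w_Fin: "w \<in> Fin q"
    unfolding w_def by (rule Fin_power)
  have Rt_over: "poly_over (Fin q) Rt"
    unfolding Rt q by (rule poly_over_add) (use R(3) w_Fin Fin_zero in \<open>simp_all add: poly_over_def q\<close>)
  have Rt_additive: "additive_poly p Rt"
    unfolding additive_poly_def
  proof (intro allI impI)
    fix k assume "Polynomial.coeff Rt k \<noteq> 0"
    then have "Polynomial.coeff R k \<noteq> 0 \<or> k = p ^ 0"
      by (auto simp: Rt split: if_splits)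
    then show "\<exists>i. k = p ^ i"
      using R(1) unfolding additive_poly_def by blast
  qed
  have Rt_degree: "Polynomial.degree Rt \<le> p ^ e"
    unfolding Rt using R(2) p2
    by (intro degree_add_le order_trans[OF degree_monom_le]) simp_all
  have heis_f_Rt: "heis_f p e Rt x y = heis_f p e R x y" for x y
    unfolding Rt by (rule heis_f_add_linear)
  have heis_V_Rt: "heis_V p e Rt = heis_V p e R"
    unfolding Rt by (rule heis_V_add_linear)

  have rad_square: "rad p (t ^ 2 + \<alpha>) = rad p t ^ 2 + rad p \<alpha>"
  proof (rule rad_p(2))
    have "(rad p t ^ 2) ^ p = (rad p t ^ p) ^ 2"
      by (simp add: mult.commute flip: power_mult)
    then show "(rad p t ^ 2 + rad p \<alpha>) ^ p = t ^ 2 + \<alpha>"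
      by (simp add: add_pow_p rad_p(1))
  qed

  \<comment> \<open>One verification for both sets of data. The hypotheses list what the twist
    changes; \<open>heis_V\<close> and \<open>heis_f\<close> are unaffected by it.\<close>
  have witt_cover: "witt_cover n p m q e R' fU F \<Delta>' s0' \<alpha>1 (rad p \<alpha>1) A' aF aW bW \<beta> c' r \<psi> \<xi>U \<xi>' \<xi>2 \<xi>W"
    if R': "additive_poly p R'" "Polynomial.degree R' \<le> p ^ e" "poly_over (Fin q) R'"
      "heis_V p e R' = heis_V p e R" "\<And>x y. heis_f p e R' x y = heis_f p e R x y"
    and A': "A' = {(a, b) \<in> carrier (heis p e R'). a \<in> Ker F}"
    and \<Delta>': "poly_over (Fin q) \<Delta>'" "poly \<Delta>' 0 = 0"
      "\<Delta>' ^ p + \<Delta>' = [:0, 1:] * R' + fU * (fU ^ p + Polynomial.smult s0' fU)"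
    and \<alpha>1: "\<alpha>1 \<in> Fin q" "rad p \<alpha>1 + \<alpha>1 = s0' + 1"
    and c': "(c' + aW * \<beta>) ^ 2 = \<alpha>1 + bW / aW ^ 2"
    and \<xi>': "\<And>a b. (a, b) \<in> A' \<Longrightarrow>
      \<xi>' (a, b) = \<xi>W (poly fU a, b + poly \<Delta>' a + rad p \<alpha>1 * poly fU a ^ 2) * \<xi>U (r a)"
    for R' \<Delta>' s0' \<alpha>1 A' c' \<xi>'
  proof -
    have cover: "cover n p m q e R' fU F \<Delta>' s0' \<alpha>1 (rad p \<alpha>1) A'"
    proof (intro cover.intro cover_axioms.intro)
      show "Ker F \<subseteq> heis_V p e R'"
        using KerF_V by (simp add: R'(4))
      show "heis_f p e R' a a' = heis_f p e R' a' a" if "a \<in> Ker F" "a' \<in> Ker F" for a a'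
        unfolding R'(5) by (rule sym[OF that])
    qed (fact char_two_axioms q R'(1-3) fU \<open>F = fU ^ p + fU\<close> F0 KerF_Fin A' \<Delta>' rad_p(1)
        \<alpha>1 rad_p_Fin[OF \<alpha>1(1)])+
    show ?thesis
    proof (intro witt_cover.intro witt_cover_axioms.intro)
      show "\<xi>U (r (poly aF x)) = \<psi> (field_trace p m (\<beta> * x))" if "x \<in> Fin q" for x
        using that \<open>\<forall>x\<in>Fin q. \<xi>U (r (poly aF x)) = \<psi> (field_trace p m (\<beta> * x))\<close> by blast
      show "\<xi>' g = \<xi>W (witt_pair (cover.witt_of fU \<Delta>' (rad p \<alpha>1) g)) * \<xi>U (r (fst g))" if "g \<in> A'" for g
        using that by (cases g) (simp add: \<xi>' cover.witt_of_def[OF cover] witt_pair_def)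
    qed (fact cover \<open>m \<ge> 1\<close> aF aF_eq W \<open>\<xi>2 \<in> dual (add_monoid (W2 (Fin 2)))\<close> \<xi>W \<psi> \<open>\<beta> \<in> Fin q\<close> c')+
  qed
  have c_eq: "(c + aW * \<beta>) ^ 2 = \<alpha> + bW / aW ^ 2"
  proof -
    have "c + aW * \<beta> = rad 2 (\<alpha> + bW / aW ^ 2)"
      by (simp add: \<open>c = _\<close> add.assoc char2)
    then show ?thesis
      using rad_pow2(1)[OF char, of 1] by simp
  qed
  \<comment> \<open>The value \<open>v = 0\<close> serves the original curve and
    \<open>v = (rad p t + t) ^ 2\<close> the twist.\<close>
  have S: "pcompose (S + Polynomial.monom v 1) fU = fU ^ p + Polynomial.smult (s0 + v) fU" for v
    by (simp add: \<open>S = _\<close> pcompose_add pcompose_monom smult_add_left)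
  have c1: "witt_cover n p m q e R fU F \<Delta> s0 \<alpha> (rad p \<alpha>) A aF aW bW \<beta> c r \<psi> \<xi>U \<xi> \<xi>2 \<xi>W"
  proof (rule witt_cover)
    show "\<Delta> ^ p + \<Delta> = [:0, 1:] * R + fU * (fU ^ p + Polynomial.smult s0 fU)"
      using \<open>\<Delta> ^ p + \<Delta> = [:0, 1:] * R + fU * pcompose S fU\<close> S[of 0] by simp
  qed (fact R refl A \<open>poly_over (Fin q) \<Delta>\<close> \<open>poly \<Delta> 0 = 0\<close> \<open>\<alpha> \<in> Fin q\<close> \<open>rad p \<alpha> + \<alpha> = s0 + 1\<close> c_eq \<xi>)+
  have c2: "witt_cover n p m q e Rt fU F \<Delta>t (s0 + (rad p t + t) ^ 2) (t ^ 2 + \<alpha>) (rad p (t ^ 2 + \<alpha>)) At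
      aF aW bW \<beta> (c + t) r \<psi> \<xi>U \<xi>t \<xi>2 \<xi>W"
  proof (rule witt_cover)
    show "At = {(a, b) \<in> carrier (heis p e Rt). a \<in> Ker F}"
      using \<open>At = _\<close> by (simp add: KerF)
    show "\<Delta>t ^ p + \<Delta>t = [:0, 1:] * Rt + fU * (fU ^ p + Polynomial.smult (s0 + (rad p t + t) ^ 2) fU)"
      using \<open>\<Delta>t ^ p + \<Delta>t = _\<close> by (simp only: S)
    show "t ^ 2 + \<alpha> \<in> Fin q"
      using Fin_power[OF \<open>t \<in> Fin q\<close>, of 2] \<open>\<alpha> \<in> Fin q\<close> unfolding q by (rule Fin_add)
    have square_add: "(x + y) ^ 2 = x ^ 2 + y ^ 2" for x y :: 'f
      using add_pow2[of x y 1] by simp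
    \<comment> \<open>Adding \<open>t ^ 2\<close> to \<open>\<alpha>\<close> changes
      \<open>rad p \<alpha> + \<alpha>\<close> by \<open>(rad p t + t) ^ 2\<close>, which is the
      amount added to \<open>s0\<close>.\<close>
    have "rad p (t ^ 2 + \<alpha>) + (t ^ 2 + \<alpha>) = (rad p \<alpha> + \<alpha>) + (rad p t + t) ^ 2"
      by (simp add: rad_square square_add)
    then show "rad p (t ^ 2 + \<alpha>) + (t ^ 2 + \<alpha>) = s0 + (rad p t + t) ^ 2 + 1"
      by (simp add: \<open>rad p \<alpha> + \<alpha> = s0 + 1\<close>)
    have "(c + t + aW * \<beta>) ^ 2 = (c + aW * \<beta>) ^ 2 + t ^ 2"
      by (simp add: add.assoc flip: square_add) (simp add: add.commute)
    then show "(c + t + aW * \<beta>) ^ 2 = t ^ 2 + \<alpha> + bW / aW ^ 2"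
      by (simp add: c_eq)
    show "\<xi>t (a, b) = \<xi>W (poly fU a, b + poly \<Delta>t a + rad p (t ^ 2 + \<alpha>) * poly fU a ^ 2) * \<xi>U (r a)" for a b
      by (simp add: \<open>\<xi>t = _\<close> box_char_def phi_def)
  qed (fact Rt_additive Rt_degree Rt_over heis_V_Rt heis_f_Rt \<open>poly_over (Fin q) \<Delta>t\<close> \<open>poly \<Delta>t 0 = 0\<close>)+
  show ?thesis
    by (rule witt_cover_twist[OF c1 c2 \<open>t \<in> Fin q\<close> \<open>is_closure_of_Ql l TYPE('l)\<close>])
qed

end
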